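(* Let $d=2$. Fix $\kappa\ge4$ an even integer, and fix an even integer $j$ with $1\le j\le\lfloor\kappa/2\rfloor$. There is a sequence $\{\mathcal{F}_n\}_{n=1}^\infty$, which depends on $\kappa$, such that $\{\mathcal{F}_n\}\subset\big(\cos(j\pi/\kappa)\cos((j+1)\pi/\kappa),\ \cos((j-1)\pi/\kappa)\cos((j+1)\pi/\kappa)\big)\cap\boldsymbol{\Theta}_\kappa(D)$ and $\mathcal{F}_n<\mathcal{F}_{n+1}<\mathcal{F}_{n+2}$ for all $n\ge1$. Also $\mathcal{F}_{2n-1},\mathcal{F}_{2n}\in\boldsymbol{\Theta}_{n,\kappa}(D)$ for all $n\ge1$, and for each $n\ge1$ there are real numbers $X_0,\ldots,X_{n+1}$ solving, with $\mathcal{F}_n$, the system $(\Sigma_n)$ of the context and satisfying $$\cos((j+1)\pi/\kappa)=:X_{n+1}<X_n<\cdots<X_1<X_0<\cos((j-1)\pi/\kappa).$$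
   Context: Operators. For $d \geq 1$ let $\mathscr{H}=\ell^2(\mathbb{Z}^d)$, let $S_i$ be the shift $(S_i^{\pm 1} u)(n) = u(n_1,\ldots,n_i \mp 1,\ldots,n_d)$, $\Delta_i = \frac12 (S_i + S_i^* )$ and $D=D[d] = \prod_{i=1}^d \Delta_i$ (Molchanov--Vainberg Laplacian); $\sigma(D)=[-1,1]$. Let $(N_i u)(n) = n_i u(n)$. For $p,\kappa \in \mathbb{N}^*=\{1,2,\ldots\}$ let $A_i(p,\kappa)$ be the closure of $\frac{1}{4\mathrm{i}}\left[(S_i^{p\kappa}-S_i^{-p\kappa})N_i + N_i (S_i^{p\kappa}-S_i^{-p\kappa})\right]$ defined on compactly supported sequences, and $A_{p\kappa} = \sum_{i=1}^d A_i(p,\kappa)$ (self-adjoint). Thresholds. $\boldsymbol{\mu}_\kappa(D)$ is the set of $E \in \sigma(D)$ for which there exist a self-adjoint linear combination (finite or infinite) $\mathbb{A} = \sum_{p \geq 1} \rho_{p\kappa} A_{p\kappa}$, $\rho_{p\kappa}\in\mathbb{R}$, an interval $I \ni E$ and $\gamma>0$ with $1_I(D)[D,\mathrm{i}\mathbb{A}]_\circ 1_I(D) \geq \gamma 1_I(D)$, where $1_I(D)$ is the spectral projection of $D$ on $I$ and $[D,\mathrm{i}\mathbb{A}]_\circ$ is the bounded extension of the commutator from compactly supported sequences. $\boldsymbol{\Theta}_\kappa(D) = \sigma(D)\setminus \boldsymbol{\mu}_\kappa(D)$. Let $T_n,U_n$ be the Chebyshev polynomials of the first and second kind, $T_n(\cos\theta)=\cos(n\theta)$,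 $U_{n-1}(\cos\theta)=\sin(n\theta)/\sin\theta$. For $\vec{x}\in[-1,1]^d$ let $g_{p\kappa}(\vec{x}) = \sum_{i=1}^d \big(\prod_{l \neq i} x_l\big)(1-x_i^2)U_{p\kappa-1}(x_i)$, and $S_E = \{\vec{x}\in[-1,1]^d : \prod_{l=1}^d x_l = E\}$. The function $G_\kappa = \sum_p \rho_{p\kappa} g_{p\kappa}$ represents $[D,\mathrm{i}\mathbb{A}]_\circ$ by functional calculus (with $\Delta_i \leftrightarrow x_i$), and by continuity of $G_\kappa$, $E\in\boldsymbol{\mu}_\kappa(D)$ iff $G_\kappa>0$ on $S_E$ for some such $\mathbb{A}$. For $m\in\mathbb{N}^*$, $\boldsymbol{\Theta}_{m,\kappa}(D)$ is the set of $E\in[-1,1]$ such that there are $\vec{x}_0,\ldots,\vec{x}_m \in S_E$ and real numbers $\omega_0,\ldots,\omega_{m-1}\leq 0$ with $g_{p\kappa}(\vec{x}_m) = \sum_{q=0}^{m-1}\omega_q\, g_{p\kappa}(\vec{x}_q)$ for all $p\in\mathbb{N}^*$. System $(\Sigma_n)$ in the unknowns $\mathcal{F}_n,X_0,\ldots,X_{n+1}$: if $n$ is odd, $T_\kappa(X_q)=T_\kappa(X_{n-q})$ for $0\le q\le(n-1)/2$ and $X_{n-q}=\mathcal{F}_n/X_{1+q}$ for $-1\le q\le(n-1)/2$; if $n$ is even, $T_\kappa(X_q)=T_\kappa(X_{n-q})$ for $0\le q\le n/2-1$ and $X_{n-q}=\mathcal{F}_n/X_{1+q}$ for $-1\le q\le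 n/2-1$.
   Formalization: The formal theorem also assumes that the displayed energy interval is nonempty, i.e. 2(j+1) < κ; this excludes only j = κ/2 and j = κ/2 − 1, where the interval is empty and the claim is false (e.g. κ = 4, j = 2 gives (0, −1/2)). *)

theory Defs
  imports "HOL-Analysis.Analysis"
begin

section \<open>The Hilbert space of square-summable families\<close>

definition ell2 :: "('i \<Rightarrow> complex) set" where
  "ell2 = {u. (\<lambda>n. (cmod (u n))\<^sup>2) summable_on UNIV}"

definition ell2_inner :: "('i \<Rightarrow> complex) \<Rightarrow> ('i \<Rightarrow> complex) \<Rightarrow> complex" where
  "ell2_inner u v = (\<Sum>\<^sub>\<infinity>n. cnj (u n) * v n)"

text \<open>Only meaningful on \<^const>\<open>ell2\<close>: an infinite sum that does not exist has value 0.\<close>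
definition ell2_norm :: "('i \<Rightarrow> complex) \<Rightarrow> real" where
  "ell2_norm u = sqrt (\<Sum>\<^sub>\<infinity>n. (cmod (u n))\<^sup>2)"

definition compact_supp :: "('i \<Rightarrow> complex) set" where
  "compact_supp = {u. finite {n. u n \<noteq> 0}}"

section \<open>Operators\<close>

text \<open>
  A bounded operator is a function on all families of which only the restriction to
  \<^const>\<open>ell2\<close> matters.  An unbounded operator is given by its graph.
\<close>

definition bounded_op :: "(('i \<Rightarrow> complex) \<Rightarrow> ('i \<Rightarrow> complex)) \<Rightarrow> bool" where
  "bounded_op T \<longleftrightarrow>
     (\<forall>u\<in>ell2. T u \<in> ell2) \<and>
     (\<forall>u\<in>ell2. \<forall>v\<in>ell2. T (\<lambda>n. u n + v n) = (\<lambda>n. T u n + T v n)) \<and>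
     (\<forall>c. \<forall>u\<in>ell2. T (\<lambda>n. c * u n) = (\<lambda>n. c * T u n)) \<and>
     (\<exists>K. \<forall>u\<in>ell2. ell2_norm (T u) \<le> K * ell2_norm u)"

definition op_le ::
  "(('i \<Rightarrow> complex) \<Rightarrow> ('i \<Rightarrow> complex)) \<Rightarrow> (('i \<Rightarrow> complex) \<Rightarrow> ('i \<Rightarrow> complex)) \<Rightarrow> bool" where
  "op_le S T \<longleftrightarrow>
     (\<forall>u\<in>ell2. ell2_inner u (\<lambda>n. T u n - S u n) \<in> \<real> \<and>
               0 \<le> Re (ell2_inner u (\<lambda>n. T u n - S u n)))"

definition op_spectrum :: "(('i \<Rightarrow> complex) \<Rightarrow> ('i \<Rightarrow> complex)) \<Rightarrow> complex set" where
  "op_spectrum T =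
     {z. \<not> (\<exists>R. bounded_op R \<and>
               (\<forall>u\<in>ell2. R (\<lambda>n. T u n - z * u n) = u \<and> (\<lambda>n. T (R u) n - z * R u n) = u))}"

definition orth_projection :: "(('i \<Rightarrow> complex) \<Rightarrow> ('i \<Rightarrow> complex)) \<Rightarrow> bool" where
  "orth_projection P \<longleftrightarrow>
     bounded_op P \<and> (\<forall>u\<in>ell2. P (P u) = P u) \<and>
     (\<forall>u\<in>ell2. \<forall>v\<in>ell2. ell2_inner (P u) v = ell2_inner u (P v))"

text \<open>
  \<open>P\<close> is the spectral measure of the bounded self-adjoint operator \<open>T\<close>: a projection-valued
  Borel measure on the line with \<open>T = \<integral>x dP(x)\<close> in the weak sense.  By the spectral theorem it
  exists and its values on \<^const>\<open>ell2\<close> are unique; \<open>P B\<close> is the spectral projection \<open>1\<^sub>B(T)\<close>.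
\<close>
definition scalar_spectral_measure ::
  "(real set \<Rightarrow> ('i \<Rightarrow> complex) \<Rightarrow> ('i \<Rightarrow> complex)) \<Rightarrow> ('i \<Rightarrow> complex) \<Rightarrow> real measure" where
  "scalar_spectral_measure P u =
     measure_of UNIV (sets borel) (\<lambda>B. ennreal (Re (ell2_inner u (P B u))))"

definition spectral_measure_of ::
  "(('i \<Rightarrow> complex) \<Rightarrow> ('i \<Rightarrow> complex)) \<Rightarrow>
   (real set \<Rightarrow> ('i \<Rightarrow> complex) \<Rightarrow> ('i \<Rightarrow> complex)) \<Rightarrow> bool" where
  "spectral_measure_of T P \<longleftrightarrow>
     (\<forall>B\<in>sets borel. orth_projection (P B)) \<and>
     (\<forall>u\<in>ell2. P UNIV u = u) \<and>
     (\<forall>B\<in>sets borel. \<forall>C\<in>sets borel. \<forall>u\<in>ell2. P (B \<inter> C) u = P B (P C u)) \<and>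
     (\<forall>B. range B \<subseteq> sets borel \<and> disjoint_family (B :: nat \<Rightarrow> real set) \<longrightarrow>
        (\<forall>u\<in>ell2. (\<lambda>N. ell2_norm (\<lambda>n. (\<Sum>k<N. P (B k) u n) - P (\<Union>k. B k) u n))
           \<longlonglongrightarrow> 0)) \<and>
     (\<forall>u\<in>ell2. integrable (scalar_spectral_measure P u) (\<lambda>x. x) \<and>
        ell2_inner u (T u) = complex_of_real (\<integral>x. x \<partial>scalar_spectral_measure P u))"

definition op_closure ::
  "(('i \<Rightarrow> complex) \<times> ('i \<Rightarrow> complex)) set \<Rightarrow> (('i \<Rightarrow> complex) \<times> ('i \<Rightarrow> complex)) set" where
  "op_closure G =
     {(u, v). u \<in> ell2 \<and> v \<in> ell2 \<and>
        (\<exists>a b. (\<forall>k::nat. (a k, b k) \<in> G) \<and>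
           (\<lambda>k. ell2_norm (\<lambda>n. a k n - u n)) \<longlonglongrightarrow> 0 \<and>
           (\<lambda>k. ell2_norm (\<lambda>n. b k n - v n)) \<longlonglongrightarrow> 0)}"

definition op_adjoint ::
  "(('i \<Rightarrow> complex) \<times> ('i \<Rightarrow> complex)) set \<Rightarrow> (('i \<Rightarrow> complex) \<times> ('i \<Rightarrow> complex)) set" where
  "op_adjoint G =
     {(v, w). v \<in> ell2 \<and> w \<in> ell2 \<and> (\<forall>(u, Tu)\<in>G. ell2_inner v Tu = ell2_inner w u)}"

definition self_adjoint_op :: "(('i \<Rightarrow> complex) \<times> ('i \<Rightarrow> complex)) set \<Rightarrow> bool" where
  "self_adjoint_op G \<longleftrightarrow> op_adjoint G = G"

section \<open>The Molchanov--Vainberg Laplacian and the conjugate operators\<close>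

text \<open>\<open>\<int>\<^sup>d\<close> is the type \<^typ>\<open>int ^ 'd\<close>; \<open>shift i k\<close> is the power \<open>S\<^sub>i\<^sup>k\<close>, \<open>k\<close> any integer.\<close>

definition shift :: "'d::finite \<Rightarrow> int \<Rightarrow> (int ^ 'd \<Rightarrow> complex) \<Rightarrow> (int ^ 'd \<Rightarrow> complex)" where
  "shift i k u = (\<lambda>n. u (n - axis i k))"

definition Delta :: "'d::finite \<Rightarrow> (int ^ 'd \<Rightarrow> complex) \<Rightarrow> (int ^ 'd \<Rightarrow> complex)" where
  "Delta i u = (\<lambda>n. (shift i 1 u n + shift i (- 1) u n) / 2)"

text \<open>The composition of all \<open>\<Delta>\<^sub>i\<close>; the order is irrelevant as they commute.\<close>
definition MV_laplacian :: "(int ^ 'd::finite \<Rightarrow> complex) \<Rightarrow> (int ^ 'd \<Rightarrow> complex)" where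
  "MV_laplacian = Finite_Set.fold (\<lambda>i T. Delta i \<circ> T) id UNIV"

lemma shift_commute: "shift i k (shift l m u) = shift l m (shift i k u)"
  by (simp add: shift_def algebra_simps)

lemma Delta_commute: "Delta i \<circ> Delta l = Delta l \<circ> Delta i"
proof -
  have "Delta i (Delta l u) n = Delta l (Delta i u) n" for u n
    by (simp add: Delta_def shift_def algebra_simps add_divide_distrib)
  thus ?thesis by (auto simp: fun_eq_iff)
qed

lemma comp_fun_commute_Delta: "comp_fun_commute (\<lambda>(i::'d::finite) T. Delta i \<circ> T)"
proof
  fix i l :: 'd
  show "(\<lambda>T. Delta l \<circ> T) \<circ> (\<lambda>T. Delta i \<circ> T) = (\<lambda>T. Delta i \<circ> T) \<circ> (\<lambda>T. Delta l \<circ> T)"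
    using Delta_commute[of i l] by (simp add: fun_eq_iff)
qed

lemma MV_laplacian_2: "MV_laplacian = Delta (1::2) \<circ> Delta 2"
proof -
  interpret comp_fun_commute "\<lambda>(i::2) T. Delta i \<circ> T" by (rule comp_fun_commute_Delta)
  show ?thesis unfolding MV_laplacian_def UNIV_2 by (simp add: fold_insert)
qed

definition position :: "'d::finite \<Rightarrow> (int ^ 'd \<Rightarrow> complex) \<Rightarrow> (int ^ 'd \<Rightarrow> complex)" where
  "position i u = (\<lambda>n. of_int (n $ i) * u n)"

text \<open>
  The argument \<open>k\<close> plays the role of \<open>p\<kappa>\<close>.  These are the operators on compactly supported
  sequences; the closure is taken in \<open>conj_comb\<close> below, after summation.
\<close>
definition conj_op_i :: "'d::finite \<Rightarrow> nat \<Rightarrow> (int ^ 'd \<Rightarrow> complex) \<Rightarrow> (int ^ 'd \<Rightarrow> complex)" where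
  "conj_op_i i k u =
     (let W = (\<lambda>v n. shift i (int k) v n - shift i (- int k) v n)
      in (\<lambda>n. 1 / (4 * \<i>) * (W (position i u) n + position i (W u) n)))"

definition conj_op :: "nat \<Rightarrow> (int ^ 'd::finite \<Rightarrow> complex) \<Rightarrow> (int ^ 'd \<Rightarrow> complex)" where
  "conj_op k u = (\<lambda>n. \<Sum>i\<in>UNIV. conj_op_i i k u n)"

text \<open>
  The sum over \<open>p \<ge> 1\<close> of \<open>\<rho>\<^sub>p\<^sub>\<kappa> A\<^sub>p\<^sub>\<kappa>\<close> on those compactly supported sequences on which the
  series converges in norm.
\<close>
definition conj_comb_core ::
  "nat \<Rightarrow> (nat \<Rightarrow> real) \<Rightarrow> ((int ^ 'd::finite \<Rightarrow> complex) \<times> (int ^ 'd \<Rightarrow> complex)) set" where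
  "conj_comb_core \<kappa> \<rho> =
     {(u, v). u \<in> compact_supp \<and> v \<in> ell2 \<and>
        (\<lambda>N. ell2_norm (\<lambda>n. (\<Sum>p=1..N. of_real (\<rho> (p * \<kappa>)) * conj_op (p * \<kappa>) u n) - v n))
          \<longlonglongrightarrow> 0}"

definition conj_comb ::
  "nat \<Rightarrow> (nat \<Rightarrow> real) \<Rightarrow> ((int ^ 'd::finite \<Rightarrow> complex) \<times> (int ^ 'd \<Rightarrow> complex)) set" where
  "conj_comb \<kappa> \<rho> = op_closure (conj_comb_core \<kappa> \<rho>)"

text \<open>
  \<open>C\<close> is the bounded extension of the commutator \<open>[T, \<i>A]\<close> from compactly supported sequences,
  for an operator \<open>T\<close> that preserves compact supports.
\<close>
definition commutator_ext ::
  "(('i \<Rightarrow> complex) \<Rightarrow> ('i \<Rightarrow> complex)) \<Rightarrow> (('i \<Rightarrow> complex) \<times> ('i \<Rightarrow> complex)) set \<Rightarrow>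
   (('i \<Rightarrow> complex) \<Rightarrow> ('i \<Rightarrow> complex)) \<Rightarrow> bool" where
  "commutator_ext T A C \<longleftrightarrow>
     bounded_op C \<and>
     (\<forall>u v w. u \<in> compact_supp \<and> (u, v) \<in> A \<and> (T u, w) \<in> A \<longrightarrow>
        C u = (\<lambda>n. T (\<lambda>m. \<i> * v m) n - \<i> * w n))"

section \<open>Thresholds\<close>

text \<open>
  The estimate \<open>1\<^sub>J(T) [T, \<i>A] 1\<^sub>J(T) \<ge> \<gamma> 1\<^sub>J(T)\<close>.  The interval \<open>J\<close> is open: if \<open>T\<close> has no
  eigenvalues, then \<open>1\<^sub>J(T) = 0\<close> for \<open>J = {E}\<close> and the estimate would be void.
\<close>
definition mourre_estimate ::
  "(('i \<Rightarrow> complex) \<Rightarrow> ('i \<Rightarrow> complex)) \<Rightarrow> (('i \<Rightarrow> complex) \<times> ('i \<Rightarrow> complex)) set \<Rightarrow>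
   real \<Rightarrow> bool" where
  "mourre_estimate T A E \<longleftrightarrow>
     (\<exists>C P J \<gamma>. commutator_ext T A C \<and> spectral_measure_of T P \<and>
        open J \<and> is_interval J \<and> E \<in> J \<and> \<gamma> > 0 \<and>
        op_le (\<lambda>u n. of_real \<gamma> * P J u n) (\<lambda>u. P J (C (P J u))))"

text \<open>The argument of type \<^typ>\<open>'d itself\<close> carries the dimension.\<close>
definition sigma_D :: "'d::finite itself \<Rightarrow> real set" where
  "sigma_D (_ :: 'd itself) =
     {E. complex_of_real E \<in> op_spectrum (MV_laplacian :: (int ^ 'd \<Rightarrow> complex) \<Rightarrow> _)}"

definition mu_set :: "'d::finite itself \<Rightarrow> nat \<Rightarrow> real set" where
  "mu_set (_ :: 'd itself) \<kappa> =
     {E \<in> sigma_D TYPE('d).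
        \<exists>\<rho> A. A = (conj_comb \<kappa> \<rho> :: ((int ^ 'd \<Rightarrow> complex) \<times> (int ^ 'd \<Rightarrow> complex)) set) \<and>
          (compact_supp :: (int ^ 'd \<Rightarrow> complex) set) \<subseteq> Domain (conj_comb_core \<kappa> \<rho>) \<and>
          self_adjoint_op A \<and> mourre_estimate MV_laplacian A E}"

definition Theta_set :: "'d::finite itself \<Rightarrow> nat \<Rightarrow> real set" where
  "Theta_set (_ :: 'd itself) \<kappa> = sigma_D TYPE('d) - mu_set TYPE('d) \<kappa>"

fun cheb_T :: "nat \<Rightarrow> real \<Rightarrow> real" where
  "cheb_T 0 x = 1"
| "cheb_T (Suc 0) x = x"
| "cheb_T (Suc (Suc n)) x = 2 * x * cheb_T (Suc n) x - cheb_T n x"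

fun cheb_U :: "nat \<Rightarrow> real \<Rightarrow> real" where
  "cheb_U 0 x = 1"
| "cheb_U (Suc 0) x = 2 * x"
| "cheb_U (Suc (Suc n)) x = 2 * x * cheb_U (Suc n) x - cheb_U n x"

lemma cheb_T_cos: "cheb_T n (cos t) = cos (real n * t)"
proof (induction n "cos t" rule: cheb_T.induct)
  case (3 n)
  have "cos (real (Suc (Suc n)) * t) + cos (real n * t) = 2 * cos t * cos (real (Suc n) * t)"
    using cos_add[of "real (Suc n) * t" t] cos_diff[of "real (Suc n) * t" t]
    by (simp add: algebra_simps)
  with 3 show ?case by simp
qed auto

lemma cheb_U_sin: "cheb_U n (cos t) * sin t = sin (real (Suc n) * t)"
proof (induction n "cos t" rule: cheb_U.induct)
  case 2
  show ?case using sin_double[of t] by (simp add: algebra_simps)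
next
  case (3 n)
  have "sin (real (Suc (Suc (Suc n))) * t) + sin (real (Suc n) * t)
        = 2 * cos t * sin (real (Suc (Suc n)) * t)"
    using sin_add[of "real (Suc (Suc n)) * t" t] sin_diff[of "real (Suc (Suc n)) * t" t]
    by (simp add: algebra_simps)
  with 3 show ?case by (simp add: algebra_simps)
qed auto

definition g_fun :: "nat \<Rightarrow> real ^ 'd::finite \<Rightarrow> real" where
  "g_fun k x = (\<Sum>i\<in>UNIV. (\<Prod>l\<in>UNIV - {i}. x $ l) * (1 - (x $ i)\<^sup>2) * cheb_U (k - 1) (x $ i))"

definition S_set :: "real \<Rightarrow> (real ^ 'd::finite) set" where
  "S_set E = {x. (\<forall>l. -1 \<le> x $ l \<and> x $ l \<le> 1) \<and> (\<Prod>l\<in>UNIV. x $ l) = E}"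

definition Theta_m_set :: "'d::finite itself \<Rightarrow> nat \<Rightarrow> nat \<Rightarrow> real set" where
  "Theta_m_set (_ :: 'd itself) m \<kappa> =
     {E. -1 \<le> E \<and> E \<le> 1 \<and>
        (\<exists>(x :: nat \<Rightarrow> real ^ 'd) \<omega>.
           (\<forall>q\<le>m. x q \<in> S_set E) \<and> (\<forall>q<m. \<omega> q \<le> 0) \<and>
           (\<forall>p\<ge>1. g_fun (p * \<kappa>) (x m) = (\<Sum>q<m. \<omega> q * g_fun (p * \<kappa>) (x q))))}"

text \<open>
  The system \<open>\<Sigma>\<^sub>n\<close>.  In the second family the index is \<open>r = q + 1 \<ge> 0\<close>, which ranges up to
  \<open>(n + 1) / 2\<close> for odd and \<open>n / 2\<close> for even \<open>n\<close>; quotients are required to be genuine.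
\<close>
definition Sigma_system :: "nat \<Rightarrow> nat \<Rightarrow> real \<Rightarrow> (nat \<Rightarrow> real) \<Rightarrow> bool" where
  "Sigma_system \<kappa> n F X \<longleftrightarrow>
     (if odd n
      then (\<forall>q. q \<le> (n - 1) div 2 \<longrightarrow> cheb_T \<kappa> (X q) = cheb_T \<kappa> (X (n - q))) \<and>
           (\<forall>r. r \<le> (n + 1) div 2 \<longrightarrow> X r \<noteq> 0 \<and> X (n + 1 - r) = F / X r)
      else (\<forall>q. q + 1 \<le> n div 2 \<longrightarrow> cheb_T \<kappa> (X q) = cheb_T \<kappa> (X (n - q))) \<and>
           (\<forall>r. r \<le> n div 2 \<longrightarrow> X r \<noteq> 0 \<and> X (n + 1 - r) = F / X r))"

text \<open>
  For \<open>j \<le> \<kappa> / 2\<close> the left end point of this energy interval lies below the right one exactly when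
  \<open>cos ((j + 1) \<pi> / \<kappa>) > 0\<close>; the interval is empty for the remaining \<open>j\<close>.
\<close>
lemma energy_interval_nonempty_iff:
  fixes \<kappa> j :: nat
  assumes "1 \<le> j" "j \<le> \<kappa> div 2"
  shows "cos (real j * pi / \<kappa>) * cos ((real j + 1) * pi / \<kappa>)
           < cos ((real j - 1) * pi / \<kappa>) * cos ((real j + 1) * pi / \<kappa>)
         \<longleftrightarrow> 2 * (j + 1) < \<kappa>"
proof -
  have k: "real \<kappa> > 0" "2 * j \<le> \<kappa>" using assms by linarith+
  have k2: "2 * real j \<le> real \<kappa>" using k(2) by linarith
  have j1: "real j + 1 \<le> real \<kappa>" using assms k2 by linarith
  have le: "(real j + 1) * pi / \<kappa> \<le> pi"
    using mult_left_mono[OF j1, of pi] k by (simp add: field_simps)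
  have lt: "cos (real j * pi / \<kappa>) < cos ((real j - 1) * pi / \<kappa>)"
  proof (rule cos_monotone_0_pi)
    show "0 \<le> (real j - 1) * pi / \<kappa>" using assms by simp
    show "(real j - 1) * pi / \<kappa> < real j * pi / \<kappa>"
      using k by (intro divide_strict_right_mono mult_strict_right_mono) auto
    have "real j * pi / \<kappa> \<le> (real j + 1) * pi / \<kappa>"
      using k by (intro divide_right_mono mult_right_mono) auto
    thus "real j * pi / \<kappa> \<le> pi" using le by linarith
  qed
  have "cos (real j * pi / \<kappa>) * cos ((real j + 1) * pi / \<kappa>)
           < cos ((real j - 1) * pi / \<kappa>) * cos ((real j + 1) * pi / \<kappa>)
        \<longleftrightarrow> 0 < cos ((real j + 1) * pi / \<kappa>)"
    using lt by (auto simp: mult_less_cancel_right)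
  also have "\<dots> \<longleftrightarrow> cos (pi / 2) < cos ((real j + 1) * pi / \<kappa>)" by simp
  also have "\<dots> \<longleftrightarrow> (real j + 1) * pi / \<kappa> < pi / 2"
    using le by (intro cos_mono_less_eq) auto
  also have "\<dots> \<longleftrightarrow> pi * (2 * (real j + 1)) < pi * real \<kappa>"
    using k by (simp add: field_simps)
  also have "\<dots> \<longleftrightarrow> 2 * (real j + 1) < real \<kappa>" by simp
  also have "\<dots> \<longleftrightarrow> 2 * (j + 1) < \<kappa>"
    using of_nat_less_iff[of "2 * (j + 1)" \<kappa>, where ?'a = real]
    by (simp add: add.commute)
  finally show ?thesis .
qed

end

theory Submission
  imports Defs
begin

text \<open>
  Two independent arguments carry the theorem.

  The first shows that an energy with a sign-reversing linear dependence is a threshold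
  (\<open>Theta_m_set_subset_Theta_set\<close>).  A plane wave with wave vector \<open>\<theta>\<close>, cut off to a large cube, is
  an approximate eigenvector of every polynomial in the shifts; the approximate eigenvalue is obtained
  by replacing the shift along \<open>i\<close> by \<open>exp (- \<i> \<theta>\<^sub>i)\<close>.  For the Laplacian it is
  \<open>cos \<theta>\<^sub>1 cos \<theta>\<^sub>2\<close>, for the commutator with the \<open>k\<close>-th conjugate operator it is \<open>g\<^sub>k\<close> at
  \<open>(cos \<theta>\<^sub>1, cos \<theta>\<^sub>2)\<close>.  If an infinite combination \<open>\<Sum> \<rho>\<^sub>p\<^sub>\<kappa> A\<^sub>p\<^sub>\<kappa>\<close> is defined on all compactly
  supported sequences, its value on a point mass is square summable, so \<open>(p \<rho>\<^sub>p\<^sub>\<kappa>)\<close> is square summable and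
  \<open>(\<rho>\<^sub>p\<^sub>\<kappa>)\<close> is summable (\<open>coefficients_summable\<close>).  Hence the series \<open>G = \<Sum> \<rho>\<^sub>p\<^sub>\<kappa> g\<^sub>p\<^sub>\<kappa>\<close> converges
  absolutely, and the commutator acts on the wave packets asymptotically as multiplication by \<open>G\<close>
  (\<open>commutator_ext_packet\<close>).  A packet whose Laplacian eigenvalue is \<open>E\<close> is asymptotically fixed by
  the spectral projection on a neighbourhood of \<open>E\<close> (\<open>spectral_localization\<close>), so an estimate of Mourre
  type at \<open>E\<close> forces \<open>G \<ge> \<gamma> > 0\<close> on all of \<open>S\<^sub>E\<close>.  This is incompatible with
  \<open>G(x\<^sub>m) = \<Sum> \<omega>\<^sub>q G(x\<^sub>q)\<close>, \<open>\<omega>\<^sub>q \<le> 0\<close>.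

  The second constructs the energies.  Write \<open>a, c, b\<close> for \<open>(j - 1)\<pi>/\<kappa>, j\<pi>/\<kappa>, (j + 1)\<pi>/\<kappa>\<close>.  On the
  interval from \<open>cos b\<close> to \<open>cos a\<close> the equation \<open>T\<^sub>\<kappa> x = T\<^sub>\<kappa> y\<close> with \<open>x \<noteq> y\<close> means that the angles of \<open>x\<close>
  and \<open>y\<close> are mirror images about \<open>c\<close>, that is \<open>y = \<sigma> x\<close> with \<open>\<sigma> x = cos (2c - arccos x)\<close>.  The system
  \<open>\<Sigma>\<^sub>n\<close> is therefore solved by taking for the first half of the list the orbit of \<open>x \<mapsto> F / \<sigma> x\<close> that
  starts, one step before \<open>X\<^sub>0\<close>, at \<open>cos a\<close>, and for the second half its mirror image under \<open>\<sigma>\<close>,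
  provided that the two halves fit together.  As
  \<open>x \<sigma> x \<ge> cos a cos b > F\<close>, the map moves every point of \<open>[cos c, cos a]\<close> down;
  the orbit increases with \<open>F\<close>.
  Energies of even index are those for which the orbit hits the fixed point \<open>cos c\<close> of \<open>\<sigma>\<close> exactly; in
  between, the intermediate value theorem gives energies of odd index for which the orbit hits
  \<open>\<surd>F\<close>, so that the list closes up at a point with \<open>X\<^sup>2 = F\<close>.  Finally, with \<open>h\<^sub>q = sin (p \<kappa> \<theta>\<^sub>q)\<close>,
  the mirror symmetry reads \<open>h\<^sub>n\<^sub>-\<^sub>q = - h\<^sub>q\<close>, which makes \<open>g\<close> at \<open>(X\<^sub>q, X\<^sub>n\<^sub>+\<^sub>1\<^sub>-\<^sub>q)\<close> equal to
  \<open>\<alpha>\<^sub>q h\<^sub>q - \<beta>\<^sub>q h\<^sub>q\<^sub>-\<^sub>1\<close> with positive \<open>\<alpha>\<^sub>q, \<beta>\<^sub>q\<close> that do not depend on \<open>p\<close>.  Solving for \<open>h\<^sub>q\<close> step by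
  step gives nonnegative combinations, and at the middle of the list \<open>g\<close> is a negative multiple of
  the last \<open>h\<close>: this is the required dependence (\<open>chain_angles_in_Theta_m_set\<close>).
\<close>

section \<open>Square-summable families\<close>

lemma ell2_product_summable:
  assumes "u \<in> ell2" "v \<in> ell2"
  shows "(\<lambda>n. cnj (u n) * v n) summable_on UNIV"
proof (rule abs_summable_summable, rule Infinite_Sum.abs_summable_on_comparison_test')
  show "(\<lambda>n. (cmod (u n))\<^sup>2 + (cmod (v n))\<^sup>2) summable_on UNIV"
    using assms by (intro summable_on_add) (auto simp: ell2_def)
  show "norm (cnj (u n) * v n) \<le> (cmod (u n))\<^sup>2 + (cmod (v n))\<^sup>2" for n
  proof -
    have "2 * (cmod (u n) * cmod (v n)) \<le> (cmod (u n))\<^sup>2 + (cmod (v n))\<^sup>2"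
      using sum_squares_bound[of "cmod (u n)" "cmod (v n)"] by simp
    moreover have "0 \<le> cmod (u n) * cmod (v n)" by simp
    ultimately show ?thesis by (simp add: norm_mult del: mult_nonneg_nonneg)
  qed
qed

lemma ell2_add:
  assumes "u \<in> ell2" "v \<in> ell2"
  shows "(\<lambda>n. u n + v n) \<in> ell2"
proof -
  have "(\<lambda>n. (cmod (u n + v n))\<^sup>2) summable_on UNIV"
  proof (rule summable_on_comparison_test)
    show "(\<lambda>n. 2 * ((cmod (u n))\<^sup>2 + (cmod (v n))\<^sup>2)) summable_on UNIV"
      using assms by (intro summable_on_cmult_right summable_on_add) (auto simp: ell2_def)
    show "(cmod (u n + v n))\<^sup>2 \<le> 2 * ((cmod (u n))\<^sup>2 + (cmod (v n))\<^sup>2)" for n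
    proof -
      have "(cmod (u n + v n))\<^sup>2 \<le> (cmod (u n) + cmod (v n))\<^sup>2"
        by (intro power_mono norm_triangle_ineq) auto
      also have "\<dots> \<le> 2 * ((cmod (u n))\<^sup>2 + (cmod (v n))\<^sup>2)"
        using sum_squares_bound[of "cmod (u n)" "cmod (v n)"] by (simp add: power2_sum)
      finally show ?thesis by simp
    qed
  qed simp
  thus ?thesis by (simp add: ell2_def)
qed

lemma ell2_scale: "u \<in> ell2 \<Longrightarrow> (\<lambda>n. c * u n) \<in> ell2"
  by (auto simp: ell2_def norm_mult power_mult_distrib intro!: summable_on_cmult_right)

lemma ell2_diff: "u \<in> ell2 \<Longrightarrow> v \<in> ell2 \<Longrightarrow> (\<lambda>n. u n - v n) \<in> ell2"
  using ell2_add[OF _ ell2_scale[of v "-1"], of u] by simp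

lemma compact_supp_ell2: "compact_supp \<subseteq> ell2"
proof
  fix u :: "'i \<Rightarrow> complex" assume "u \<in> compact_supp"
  hence fin: "finite {n. u n \<noteq> 0}" by (simp add: compact_supp_def)
  have "(\<lambda>n. (cmod (u n))\<^sup>2) summable_on UNIV \<longleftrightarrow>
          (\<lambda>n. (cmod (u n))\<^sup>2) summable_on {n. u n \<noteq> 0}"
    by (rule summable_on_cong_neutral) auto
  thus "u \<in> ell2" using fin by (simp add: ell2_def)
qed

lemma ell2_zero [simp]: "(\<lambda>n. 0) \<in> ell2"
  by (simp add: ell2_def)

lemma ell2_sum: "finite I \<Longrightarrow> (\<And>i. i \<in> I \<Longrightarrow> f i \<in> ell2) \<Longrightarrow> (\<lambda>n. \<Sum>i\<in>I. f i n) \<in> ell2"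
  by (induction rule: finite_induct) (auto intro: ell2_add)

lemma ell2_inner_add_right:
  "u \<in> ell2 \<Longrightarrow> v \<in> ell2 \<Longrightarrow> w \<in> ell2 \<Longrightarrow>
     ell2_inner u (\<lambda>n. v n + w n) = ell2_inner u v + ell2_inner u w"
  unfolding ell2_inner_def distrib_left
  by (intro infsum_add ell2_product_summable)

lemma ell2_inner_scale_right: "ell2_inner u (\<lambda>n. c * v n) = c * ell2_inner u v"
  unfolding ell2_inner_def by (subst mult.left_commute) (rule infsum_cmult_right')

lemma ell2_inner_commute: "ell2_inner v u = cnj (ell2_inner u v)"
  unfolding ell2_inner_def by (simp flip: infsum_cnj add: mult.commute)

lemma ell2_inner_add_left:
  "u \<in> ell2 \<Longrightarrow> v \<in> ell2 \<Longrightarrow> w \<in> ell2 \<Longrightarrow>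
     ell2_inner (\<lambda>n. v n + w n) u = ell2_inner v u + ell2_inner w u"
  by (subst (1 2 3) ell2_inner_commute) (simp add: ell2_inner_add_right)

lemma ell2_inner_scale_left: "ell2_inner (\<lambda>n. c * v n) u = cnj c * ell2_inner v u"
  by (subst (1 2) ell2_inner_commute) (simp add: ell2_inner_scale_right)

lemma ell2_inner_diff_right:
  "u \<in> ell2 \<Longrightarrow> v \<in> ell2 \<Longrightarrow> w \<in> ell2 \<Longrightarrow>
     ell2_inner u (\<lambda>n. v n - w n) = ell2_inner u v - ell2_inner u w"
  using ell2_inner_add_right[of u v "\<lambda>n. - 1 * w n"] ell2_scale[of w "-1"]
    ell2_inner_scale_right[of u "-1" w] by simp

lemma ell2_inner_diff_left:
  "u \<in> ell2 \<Longrightarrow> v \<in> ell2 \<Longrightarrow> w \<in> ell2 \<Longrightarrow>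
     ell2_inner (\<lambda>n. v n - w n) u = ell2_inner v u - ell2_inner w u"
  by (subst (1 2 3) ell2_inner_commute) (simp add: ell2_inner_diff_right)

lemma ell2_norm_nonneg [simp]: "0 \<le> ell2_norm u"
  unfolding ell2_norm_def by (simp add: infsum_nonneg)

lemma ell2_norm_sq: "(ell2_norm u)\<^sup>2 = (\<Sum>\<^sub>\<infinity>n. (cmod (u n))\<^sup>2)"
  unfolding ell2_norm_def by (simp add: infsum_nonneg)

lemma ell2_inner_self:
  assumes "u \<in> ell2"
  shows "ell2_inner u u = complex_of_real ((ell2_norm u)\<^sup>2)"
proof -
  have "ell2_inner u u = (\<Sum>\<^sub>\<infinity>n. complex_of_real ((cmod (u n))\<^sup>2))"
    unfolding ell2_inner_def
    by (intro infsum_cong) (simp add: complex_norm_square mult.commute del: of_real_power)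
  also have "\<dots> = complex_of_real (\<Sum>\<^sub>\<infinity>n. (cmod (u n))\<^sup>2)"
    using assms by (intro infsumI has_sum_of_real has_sum_infsum) (simp add: ell2_def)
  finally show ?thesis by (simp add: ell2_norm_sq)
qed

lemma ell2_norm_scale: "ell2_norm (\<lambda>n. c * u n) = cmod c * ell2_norm u"
  by (simp add: ell2_norm_def norm_mult power_mult_distrib infsum_cmult_right' real_sqrt_mult)

lemma ell2_norm_ge_coord:
  assumes "u \<in> ell2"
  shows "cmod (u n) \<le> ell2_norm u"
proof (rule power2_le_imp_le)
  show "(cmod (u n))\<^sup>2 \<le> (ell2_norm u)\<^sup>2"
    using finite_sum_le_infsum[of "\<lambda>n. (cmod (u n))\<^sup>2" UNIV "{n}"] assms
    by (simp add: ell2_norm_sq ell2_def)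
qed simp

lemma ell2_norm_zero [simp]: "ell2_norm (\<lambda>n. 0) = 0"
  by (simp add: ell2_norm_def)

lemma ell2_norm_eq_0D: "u \<in> ell2 \<Longrightarrow> ell2_norm u = 0 \<Longrightarrow> u = (\<lambda>n. 0)"
  using ell2_norm_ge_coord[of u] by (auto simp: fun_eq_iff)

lemma ell2_Cauchy_Schwarz:
  assumes "u \<in> ell2" "v \<in> ell2"
  shows "cmod (ell2_inner u v) \<le> ell2_norm u * ell2_norm v"
proof (cases "ell2_norm u = 0")
  case True
  hence "u = (\<lambda>n. 0)" using assms ell2_norm_eq_0D by blast
  thus ?thesis by (simp add: ell2_inner_def)
next
  case False
  define N where "N = (ell2_norm u)\<^sup>2"
  define z where "z = ell2_inner u v"
  have N: "N > 0" using False by (simp add: N_def)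
  define w where "w = (\<lambda>n. v n - (z / N) * u n)"
  have w: "w \<in> ell2" unfolding w_def using assms by (intro ell2_diff ell2_scale)
  have "ell2_inner u w = z - (z / N) * N"
    unfolding w_def
    by (simp only: ell2_inner_diff_right[OF assms ell2_scale[OF assms(1)]] ell2_inner_scale_right
        ell2_inner_self[OF assms(1)] N_def z_def)
  hence uw: "ell2_inner u w = 0" using N by simp
  have "ell2_inner w w = ell2_inner v w - cnj (z / N) * ell2_inner u w"
    using ell2_inner_diff_left[OF w assms(2) ell2_scale[OF assms(1)], of "z / N"]
    by (simp only: ell2_inner_scale_left w_def[symmetric])
  also have "\<dots> = ell2_inner v w" using uw by simp
  also have "\<dots> = ell2_inner v v - (z / N) * cnj z"
    using ell2_inner_diff_right[OF assms(2,2) ell2_scale[OF assms(1)], of "z / N"]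
    by (simp only: ell2_inner_scale_right w_def z_def ell2_inner_commute[of v u])
  also have "\<dots> = complex_of_real ((ell2_norm v)\<^sup>2) - complex_of_real ((cmod z)\<^sup>2) / N"
    by (simp only: ell2_inner_self[OF assms(2)] complex_norm_square times_divide_eq_left)
  also have "\<dots> = complex_of_real ((ell2_norm v)\<^sup>2 - (cmod z)\<^sup>2 / N)"
    by (simp only: of_real_diff of_real_divide)
  finally have "(ell2_norm w)\<^sup>2 = (ell2_norm v)\<^sup>2 - (cmod z)\<^sup>2 / N"
    unfolding ell2_inner_self[OF w] of_real_eq_iff .
  hence "(cmod z)\<^sup>2 / N \<le> (ell2_norm v)\<^sup>2" using zero_le_power2[of "ell2_norm w"] by linarith
  hence "(cmod z)\<^sup>2 \<le> (ell2_norm u * ell2_norm v)\<^sup>2"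
    using N by (simp add: N_def field_simps)
  thus ?thesis unfolding z_def by (rule power2_le_imp_le) simp
qed

lemma ell2_norm_triangle:
  assumes "u \<in> ell2" "v \<in> ell2"
  shows "ell2_norm (\<lambda>n. u n + v n) \<le> ell2_norm u + ell2_norm v"
proof (rule power2_le_imp_le)
  have "complex_of_real ((ell2_norm (\<lambda>n. u n + v n))\<^sup>2)
        = ell2_inner u u + ell2_inner v v + (ell2_inner u v + cnj (ell2_inner u v))"
    using assms by (simp add: ell2_inner_add_left ell2_inner_add_right ell2_add
        ell2_inner_commute[of v u] del: of_real_power flip: ell2_inner_self)
  hence "complex_of_real ((ell2_norm (\<lambda>n. u n + v n))\<^sup>2)
        = complex_of_real ((ell2_norm u)\<^sup>2 + (ell2_norm v)\<^sup>2 + 2 * Re (ell2_inner u v))"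
    using assms by (simp add: ell2_inner_self complex_add_cnj)
  hence "(ell2_norm (\<lambda>n. u n + v n))\<^sup>2
        = (ell2_norm u)\<^sup>2 + (ell2_norm v)\<^sup>2 + 2 * Re (ell2_inner u v)"
    unfolding of_real_eq_iff .
  moreover have "Re (ell2_inner u v) \<le> ell2_norm u * ell2_norm v"
    using complex_Re_le_cmod ell2_Cauchy_Schwarz[OF assms] by (rule order_trans)
  ultimately show "(ell2_norm (\<lambda>n. u n + v n))\<^sup>2 \<le> (ell2_norm u + ell2_norm v)\<^sup>2"
    by (simp add: power2_sum)
qed simp

lemma ell2_norm_minus_commute: "ell2_norm (\<lambda>n. u n - v n) = ell2_norm (\<lambda>n. v n - u n)"
  by (simp add: ell2_norm_def norm_minus_commute)

lemma ell2_norm_diff_triangle: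
  assumes "u \<in> ell2" "v \<in> ell2" "w \<in> ell2"
  shows "ell2_norm (\<lambda>n. u n - w n) \<le> ell2_norm (\<lambda>n. u n - v n) + ell2_norm (\<lambda>n. v n - w n)"
  using ell2_norm_triangle[OF ell2_diff[OF assms(1,2)] ell2_diff[OF assms(2,3)]] by simp

lemma ell2_norm_le_add_diff:
  assumes "u \<in> ell2" "v \<in> ell2"
  shows "ell2_norm u \<le> ell2_norm v + ell2_norm (\<lambda>n. u n - v n)"
  using ell2_norm_triangle[OF assms(2) ell2_diff[OF assms]] by simp

lemma ell2_norm_sum_le:
  "finite I \<Longrightarrow> (\<And>i. i \<in> I \<Longrightarrow> f i \<in> ell2) \<Longrightarrow>
     ell2_norm (\<lambda>n. \<Sum>i\<in>I. f i n) \<le> (\<Sum>i\<in>I. ell2_norm (f i))"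
proof (induction rule: finite_induct)
  case (insert i I)
  have "ell2_norm (\<lambda>n. f i n + (\<Sum>i\<in>I. f i n)) \<le> ell2_norm (f i) + ell2_norm (\<lambda>n. \<Sum>i\<in>I. f i n)"
    using insert by (intro ell2_norm_triangle ell2_sum) auto
  also have "ell2_norm (\<lambda>n. \<Sum>i\<in>I. f i n) \<le> (\<Sum>i\<in>I. ell2_norm (f i))" using insert by auto
  finally show ?case using insert by simp
qed simp

section \<open>Spectral localization\<close>

lemma bounded_op_ell2: "bounded_op T \<Longrightarrow> u \<in> ell2 \<Longrightarrow> T u \<in> ell2"
  unfolding bounded_op_def by blast

lemma bounded_op_add:
  "bounded_op T \<Longrightarrow> u \<in> ell2 \<Longrightarrow> v \<in> ell2 \<Longrightarrow> T (\<lambda>n. u n + v n) = (\<lambda>n. T u n + T v n)"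
  unfolding bounded_op_def by blast

lemma bounded_op_scale:
  "bounded_op T \<Longrightarrow> u \<in> ell2 \<Longrightarrow> T (\<lambda>n. c * u n) = (\<lambda>n. c * T u n)"
  unfolding bounded_op_def by blast

lemma bounded_op_diff:
  assumes "bounded_op T" "u \<in> ell2" "v \<in> ell2"
  shows "T (\<lambda>n. u n - v n) = (\<lambda>n. T u n - T v n)"
proof -
  have "T (\<lambda>n. u n + -1 * v n) = (\<lambda>n. T u n + T (\<lambda>n. -1 * v n) n)"
    using assms(2) ell2_scale[OF assms(3)] by (rule bounded_op_add[OF assms(1)])
  also have "T (\<lambda>n. -1 * v n) = (\<lambda>n. -1 * T v n)"
    using assms(3) by (rule bounded_op_scale[OF assms(1)])
  finally show ?thesis by simp
qed

lemma bounded_op_bound: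
  assumes "bounded_op T"
  obtains K where "K \<ge> 0" "\<And>u. u \<in> ell2 \<Longrightarrow> ell2_norm (T u) \<le> K * ell2_norm u"
proof -
  from assms obtain K where K: "\<forall>u\<in>ell2. ell2_norm (T u) \<le> K * ell2_norm u"
    unfolding bounded_op_def by blast
  show ?thesis
  proof (rule that[of "max K 0"])
    fix u :: "'a \<Rightarrow> complex" assume u: "u \<in> ell2"
    have "ell2_norm (T u) \<le> K * ell2_norm u" using K u by blast
    also have "\<dots> \<le> max K 0 * ell2_norm u" by (intro mult_right_mono) auto
    finally show "ell2_norm (T u) \<le> max K 0 * ell2_norm u" .
  qed auto
qed

text \<open>
  The spectral measure is tied to \<open>T\<close> only through the quadratic form \<open>\<langle>u, T u\<rangle> = \<integral>x d\<mu>\<^sub>u\<close>.  That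
  the projections commute with \<open>T\<close>, and hence that approximate eigenvectors are spectrally localized,
  has to be derived from this.
\<close>
locale spectral_resolution =
  fixes T :: "('i \<Rightarrow> complex) \<Rightarrow> ('i \<Rightarrow> complex)"
    and P :: "real set \<Rightarrow> ('i \<Rightarrow> complex) \<Rightarrow> ('i \<Rightarrow> complex)"
  assumes bounded: "bounded_op T" and spectral: "spectral_measure_of T P"
begin

lemma proj: "B \<in> sets borel \<Longrightarrow> orth_projection (P B)"
  using spectral unfolding spectral_measure_of_def by blast

lemma proj_bounded: "B \<in> sets borel \<Longrightarrow> bounded_op (P B)"
  using proj unfolding orth_projection_def by blast

lemma proj_ell2: "B \<in> sets borel \<Longrightarrow> u \<in> ell2 \<Longrightarrow> P B u \<in> ell2"
  using bounded_op_ell2 proj_bounded by blast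

lemma proj_symmetric:
  "B \<in> sets borel \<Longrightarrow> u \<in> ell2 \<Longrightarrow> v \<in> ell2 \<Longrightarrow> ell2_inner (P B u) v = ell2_inner u (P B v)"
  using proj unfolding orth_projection_def by blast

lemma proj_idem: "B \<in> sets borel \<Longrightarrow> u \<in> ell2 \<Longrightarrow> P B (P B u) = P B u"
  using proj unfolding orth_projection_def by blast

lemma proj_UNIV: "u \<in> ell2 \<Longrightarrow> P UNIV u = u"
  using spectral unfolding spectral_measure_of_def by blast

lemma proj_Int:
  "B \<in> sets borel \<Longrightarrow> C \<in> sets borel \<Longrightarrow> u \<in> ell2 \<Longrightarrow> P B (P C u) = P (B \<inter> C) u"
  using spectral unfolding spectral_measure_of_def by metis

lemma proj_countably_additive:
  "range B \<subseteq> sets borel \<Longrightarrow> disjoint_family (B :: nat \<Rightarrow> real set) \<Longrightarrow> u \<in> ell2 \<Longrightarrow>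
     (\<lambda>N. ell2_norm (\<lambda>n. (\<Sum>k<N. P (B k) u n) - P (\<Union>k. B k) u n)) \<longlonglongrightarrow> 0"
  using spectral unfolding spectral_measure_of_def by blast

lemma proj_empty:
  assumes "u \<in> ell2"
  shows "P {} u = (\<lambda>n. 0)"
proof -
  have "(\<lambda>N. ell2_norm (\<lambda>n. (\<Sum>k<N. P {} u n) - P {} u n)) \<longlonglongrightarrow> 0"
    using proj_countably_additive[of "\<lambda>_. {}" u] assms by (simp add: disjoint_family_on_def)
  hence "(\<lambda>N. ell2_norm (\<lambda>n. (\<Sum>k<N+2. P {} u n) - P {} u n)) \<longlonglongrightarrow> 0"
    by (rule LIMSEQ_ignore_initial_segment)
  moreover have "ell2_norm (\<lambda>n. (\<Sum>k<N+2. P {} u n) - P {} u n)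
      = ell2_norm (\<lambda>n. (of_nat N + 1) * P {} u n)" for N
    by (simp add: algebra_simps)
  ultimately have "(\<lambda>N. norm (of_nat N + 1 :: complex) * ell2_norm (P {} u)) \<longlonglongrightarrow> 0"
    by (simp only: ell2_norm_scale)
  moreover have "ell2_norm (P {} u) \<le> norm (of_nat N + 1 :: complex) * ell2_norm (P {} u)" for N
  proof -
    have "norm (of_nat N + 1 :: complex) = real N + 1"
      using norm_of_nat[of "Suc N", where 'a = complex] by (simp add: add.commute)
    thus ?thesis using mult_right_mono[of 1 "real N + 1" "ell2_norm (P {} u)"] by simp
  qed
  ultimately have "ell2_norm (P {} u) \<le> 0"
    by (intro LIMSEQ_le_const) auto
  hence "ell2_norm (P {} u) = 0" using ell2_norm_nonneg[of "P {} u"] by linarith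
  thus ?thesis using ell2_norm_eq_0D proj_ell2[of "{}" u] assms by auto
qed

text \<open>
  Finite additivity is countable additivity for the sequence \<open>B, C, {}, {}, \<dots>\<close>, whose partial
  sums are eventually constant.
\<close>
lemma proj_Un_disjoint:
  assumes B: "B \<in> sets borel" and C: "C \<in> sets borel" and disj: "B \<inter> C = {}" and u: "u \<in> ell2"
  shows "P (B \<union> C) u = (\<lambda>n. P B u n + P C u n)"
proof -
  define D where "D = (\<lambda>k::nat. if k = 0 then B else if k = 1 then C else {})"
  have D: "range D \<subseteq> sets borel" "disjoint_family D" "(\<Union>k. D k) = B \<union> C"
    using B C disj by (auto simp: D_def disjoint_family_on_def split: if_splits)
  have S: "(\<Sum>k<N+2. P (D k) u n) = P B u n + P C u n" for N n
  proof (induction N)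
    case 0
    show ?case by (simp add: D_def numeral_2_eq_2)
  next
    case (Suc N)
    thus ?case using u by (simp add: D_def proj_empty)
  qed
  have "(\<lambda>N. ell2_norm (\<lambda>n. (\<Sum>k<N+2. P (D k) u n) - P (B \<union> C) u n)) \<longlonglongrightarrow> 0"
    using LIMSEQ_ignore_initial_segment[OF proj_countably_additive[OF D(1,2) u], of 2] D(3) by simp
  hence "ell2_norm (\<lambda>n. (P B u n + P C u n) - P (B \<union> C) u n) = 0"
    by (simp only: S LIMSEQ_const_iff)
  moreover have "(\<lambda>n. (P B u n + P C u n) - P (B \<union> C) u n) \<in> ell2"
    using B C u by (intro ell2_diff ell2_add proj_ell2) auto
  ultimately have "(\<lambda>n. (P B u n + P C u n) - P (B \<union> C) u n) = (\<lambda>n. 0)"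
    using ell2_norm_eq_0D by blast
  thus ?thesis by (simp add: fun_eq_iff)
qed

lemma proj_add_Compl:
  assumes "B \<in> sets borel" "u \<in> ell2"
  shows "(\<lambda>n. P B u n + P (- B) u n) = u"
  using proj_Un_disjoint[of B "- B" u] proj_UNIV[of u] assms by simp

lemma inner_proj:
  assumes "B \<in> sets borel" "u \<in> ell2"
  shows "ell2_inner u (P B u) = complex_of_real ((ell2_norm (P B u))\<^sup>2)"
  using proj_symmetric[OF assms(1,2) proj_ell2[OF assms]] proj_idem[OF assms]
    ell2_inner_self[OF proj_ell2[OF assms]] by simp

abbreviation \<mu> :: "('i \<Rightarrow> complex) \<Rightarrow> real measure" where
  "\<mu> \<equiv> scalar_spectral_measure P"

lemma sets_mu [simp, measurable_cong]: "sets (\<mu> u) = sets borel"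
  unfolding scalar_spectral_measure_def
  using sets.sets_measure_of_eq[of "borel :: real measure"] by simp

lemma space_mu [simp]: "space (\<mu> u) = UNIV"
  using sets_eq_imp_space_eq[OF sets_mu] by simp

lemma emeasure_mu:
  assumes B: "B \<in> sets borel" and u: "u \<in> ell2"
  shows "emeasure (\<mu> u) B = ennreal ((ell2_norm (P B u))\<^sup>2)"
proof -
  let ?f = "\<lambda>B. ennreal (Re (ell2_inner u (P B u)))"
  have "emeasure (\<mu> u) B = ?f B"
  proof (rule emeasure_measure_of)
    show "\<mu> u = measure_of UNIV (sets borel) ?f" by (simp add: scalar_spectral_measure_def)
    show "positive (sets (\<mu> u)) ?f"
      using u by (simp add: positive_def proj_empty ell2_inner_def)
    show "countably_additive (sets (\<mu> u)) ?f"
    proof (rule countably_additiveI)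
      fix A :: "nat \<Rightarrow> real set"
      assume A: "range A \<subseteq> sets (\<mu> u)" "disjoint_family A" "\<Union> (range A) \<in> sets (\<mu> u)"
      have Ak: "A k \<in> sets borel" for k using A(1) by auto
      let ?d = "\<lambda>N n. (\<Sum>k<N. P (A k) u n) - P (\<Union>k. A k) u n"
      have eq: "(\<Sum>k<N. ell2_inner u (P (A k) u)) - ell2_inner u (P (\<Union>k. A k) u)
                 = ell2_inner u (?d N)" for N
      proof -
        have "(\<Sum>k<N. ell2_inner u (P (A k) u)) = ell2_inner u (\<lambda>n. \<Sum>k<N. P (A k) u n)"
        proof (induction N)
          case (Suc N)
          have "(\<lambda>n. \<Sum>k<N. P (A k) u n) \<in> ell2" using Ak u by (intro ell2_sum proj_ell2) auto
          thus ?case using Suc ell2_inner_add_right[OF u _ proj_ell2[OF Ak u]] by simp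
        qed (simp add: ell2_inner_def)
        moreover have "(\<lambda>n. \<Sum>k<N. P (A k) u n) \<in> ell2" using Ak u by (intro ell2_sum proj_ell2) auto
        moreover have "P (\<Union>k. A k) u \<in> ell2" using A(3) u by (intro proj_ell2) auto
        ultimately show ?thesis using u by (simp add: ell2_inner_diff_right)
      qed
      have d: "?d N \<in> ell2" for N
        using A(3) Ak u by (intro ell2_diff ell2_sum proj_ell2) auto
      have "(\<lambda>N. ell2_inner u (?d N)) \<longlonglongrightarrow> 0"
      proof (rule Lim_null_comparison)
        show "\<forall>\<^sub>F N in sequentially. norm (ell2_inner u (?d N)) \<le> ell2_norm u * ell2_norm (?d N)"
          using u d by (intro always_eventually allI ell2_Cauchy_Schwarz)
        show "(\<lambda>N. ell2_norm u * ell2_norm (?d N)) \<longlonglongrightarrow> 0"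
          using tendsto_mult_left[OF proj_countably_additive[OF _ A(2) u], of "ell2_norm u"] A(1)
          by simp
      qed
      hence "(\<lambda>k. ell2_inner u (P (A k) u)) sums ell2_inner u (P (\<Union>k. A k) u)"
        unfolding sums_def by (simp only: flip: eq) (rule LIM_zero_cancel)
      hence "(\<lambda>k. Re (ell2_inner u (P (A k) u))) sums Re (ell2_inner u (P (\<Union>k. A k) u))"
        by (rule sums_Re)
      thus "(\<Sum>i. ?f (A i)) = ?f (\<Union> (range A))"
        using Ak u by (intro suminf_ennreal_eq) (auto simp: inner_proj)
    qed
    show "B \<in> sets (\<mu> u)" using B by simp
  qed auto
  thus ?thesis using inner_proj[OF B u] by simp
qed

lemma finite_measure_mu: "u \<in> ell2 \<Longrightarrow> finite_measure (\<mu> u)"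
  by (rule finite_measureI) (simp add: emeasure_mu)

lemma measure_mu: "B \<in> sets borel \<Longrightarrow> u \<in> ell2 \<Longrightarrow> measure (\<mu> u) B = (ell2_norm (P B u))\<^sup>2"
  by (simp add: measure_def emeasure_mu)

lemma integrable_mu: "u \<in> ell2 \<Longrightarrow> integrable (\<mu> u) (\<lambda>x. x)"
  using spectral unfolding spectral_measure_of_def by blast

lemma inner_eq_integral: "u \<in> ell2 \<Longrightarrow> ell2_inner u (T u) = complex_of_real (\<integral>x. x \<partial>\<mu> u)"
  using spectral unfolding spectral_measure_of_def by blast

lemma mu_proj:
  assumes B: "B \<in> sets borel" and u: "u \<in> ell2"
  shows "\<mu> (P B u) = density (\<mu> u) (\<lambda>x. ennreal (indicator B x))"
proof (rule measure_eqI)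
  fix A assume "A \<in> sets (\<mu> (P B u))"
  hence A: "A \<in> sets borel" by simp
  have "emeasure (density (\<mu> u) (\<lambda>x. ennreal (indicator B x))) A
        = (\<integral>\<^sup>+x. ennreal (indicator B x) * indicator A x \<partial>\<mu> u)"
    using A B by (intro emeasure_density) auto
  also have "\<dots> = (\<integral>\<^sup>+x. indicator (A \<inter> B) x \<partial>\<mu> u)"
    by (intro nn_integral_cong) (auto split: split_indicator)
  also have "\<dots> = emeasure (\<mu> u) (A \<inter> B)"
    using A B by (intro nn_integral_indicator) auto
  finally show "emeasure (\<mu> (P B u)) A
      = emeasure (density (\<mu> u) (\<lambda>x. ennreal (indicator B x))) A"
    using A B u by (simp add: emeasure_mu proj_ell2 proj_Int)
qed simp

lemma integral_mu_proj:
  assumes "B \<in> sets borel" "u \<in> ell2"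
  shows "(\<integral>x. x \<partial>\<mu> (P B u)) = (\<integral>x. indicator B x * x \<partial>\<mu> u)"
  using assms by (subst mu_proj) (simp_all add: integral_density)

text \<open>
  The scalar measure of \<open>P B u\<close> is the restriction of that of \<open>u\<close> to \<open>B\<close>, so the first moments add up.
\<close>
lemma quadratic_form_split:
  assumes B: "B \<in> sets borel" and u: "u \<in> ell2"
  shows "ell2_inner u (T u)
       = ell2_inner (P B u) (T (P B u)) + ell2_inner (P (- B) u) (T (P (- B) u))"
proof -
  have int: "integrable (\<mu> u) (\<lambda>x. indicator C x * x)" if "C \<in> sets borel" for C :: "real set"
    using integrable_mult_indicator[of C "\<mu> u" "\<lambda>x. x"] integrable_mu[OF u] that by simp
  have "(\<integral>x. x \<partial>\<mu> u) = (\<integral>x. indicator B x * x + indicator (- B) x * x \<partial>\<mu> u)"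
    by (intro Bochner_Integration.integral_cong) (auto simp: indicator_def)
  also have "\<dots> = (\<integral>x. indicator B x * x \<partial>\<mu> u) + (\<integral>x. indicator (- B) x * x \<partial>\<mu> u)"
    using B by (intro Bochner_Integration.integral_add int) auto
  also have "\<dots> = (\<integral>x. x \<partial>\<mu> (P B u)) + (\<integral>x. x \<partial>\<mu> (P (- B) u))"
    using B u by (simp add: integral_mu_proj)
  finally show ?thesis using B u by (simp add: inner_eq_integral proj_ell2)
qed

text \<open>
  This is the commutation of \<open>T\<close> with \<open>P B\<close>, in weak form.  For \<open>w\<close> in the range of \<open>P B\<close> and \<open>z\<close>
  in the range of the complementary projection the quadratic form at \<open>c w + z\<close> has no cross terms;
  the choices \<open>c = 1\<close> and \<open>c = \<i>\<close> separate the two of them, a polarization argument.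
\<close>
lemma cross_term_zero:
  assumes B: "B \<in> sets borel" and u: "u \<in> ell2" and v: "v \<in> ell2"
  shows "ell2_inner (P B u) (T (P (- B) v)) = 0"
proof -
  define w where "w = P B u"
  define z where "z = P (- B) v"
  have wz: "w \<in> ell2" "z \<in> ell2" using assms by (auto simp: w_def z_def proj_ell2)
  have Pw: "P B w = w" "P (- B) w = (\<lambda>n. 0)" "P (- B) z = z" "P B z = (\<lambda>n. 0)"
    using assms by (auto simp: w_def z_def proj_idem proj_Int proj_empty)
  have key: "c * ell2_inner z (T w) + cnj c * ell2_inner w (T z) = 0" for c
  proof -
    let ?x = "\<lambda>n. c * w n + z n"
    have cw: "(\<lambda>n. c * w n) \<in> ell2" using wz by (intro ell2_scale)
    have x: "?x \<in> ell2" using wz cw by (intro ell2_add)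
    have PB: "P B ?x = (\<lambda>n. c * w n)" "P (- B) ?x = z"
      using B Pw bounded_op_add[OF proj_bounded cw wz(2)] bounded_op_scale[OF proj_bounded wz(1), of _ c]
      by simp_all
    have T: "T ?x = (\<lambda>n. T (\<lambda>n. c * w n) n + T z n)" using cw wz(2) by (rule bounded_op_add[OF bounded])
    have "ell2_inner ?x (T ?x) = ell2_inner (\<lambda>n. c * w n) (T (\<lambda>n. c * w n)) + ell2_inner z (T z)"
      using quadratic_form_split[OF B x] by (simp only: PB)
    moreover have "ell2_inner ?x (T ?x) =
        ell2_inner (\<lambda>n. c * w n) (T (\<lambda>n. c * w n)) + ell2_inner z (T z)
        + (ell2_inner z (T (\<lambda>n. c * w n)) + ell2_inner (\<lambda>n. c * w n) (T z))"
      unfolding T using cw wz x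
      by (simp add: ell2_inner_add_right ell2_inner_add_left bounded_op_ell2[OF bounded] ell2_add)
    ultimately have "ell2_inner z (T (\<lambda>n. c * w n)) + ell2_inner (\<lambda>n. c * w n) (T z) = 0" by simp
    thus ?thesis
      by (simp add: bounded_op_scale[OF bounded wz(1)] ell2_inner_scale_left ell2_inner_scale_right)
  qed
  have "ell2_inner w (T z) = 0" using key[of 1] key[of \<i>] by (simp add: algebra_simps complex_eq_iff)
  thus ?thesis by (simp add: w_def z_def)
qed

lemma inner_shifted_proj:
  assumes B: "B \<in> sets borel" and u: "u \<in> ell2"
  shows "ell2_inner (P B u) (\<lambda>n. T u n - E * u n)
       = complex_of_real (\<integral>x. x \<partial>\<mu> (P B u)) - E * complex_of_real ((ell2_norm (P B u))\<^sup>2)"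
proof -
  let ?w = "P B u" and ?z = "P (- B) u"
  have w: "?w \<in> ell2" "?z \<in> ell2" using B u by (auto intro!: proj_ell2)
  have "T u = (\<lambda>n. T ?w n + T ?z n)"
    using bounded_op_add[OF bounded w] unfolding proj_add_Compl[OF B u] .
  hence "ell2_inner ?w (T u) = ell2_inner ?w (T ?w) + ell2_inner ?w (T ?z)"
    using ell2_inner_add_right[OF w(1) bounded_op_ell2[OF bounded w(1)] bounded_op_ell2[OF bounded w(2)]]
    by simp
  also have "\<dots> = complex_of_real (\<integral>x. x \<partial>\<mu> ?w)"
    using B u w by (simp add: cross_term_zero inner_eq_integral)
  finally have *: "ell2_inner ?w (T u) = complex_of_real (\<integral>x. x \<partial>\<mu> ?w)" .
  have "ell2_inner ?w u = complex_of_real ((ell2_norm ?w)\<^sup>2)"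
    using proj_symmetric[OF B u u] inner_proj[OF B u] by simp
  thus ?thesis
    using * ell2_inner_diff_right[OF w(1) bounded_op_ell2[OF bounded u] ell2_scale[OF u, of E]]
    by (simp add: ell2_inner_scale_right)
qed

lemma AE_mu_proj:
  assumes B: "B \<in> sets borel" and u: "u \<in> ell2"
  shows "AE x in \<mu> (P B u). x \<in> B"
  unfolding mu_proj[OF assms] using B by (subst AE_density) (auto simp: indicator_def)

text \<open>
  Test the residual \<open>T u - E u\<close> against \<open>w = P B u\<close>: by the vanishing of the cross term this gives
  \<open>\<integral>(x - E) d\<mu>\<^sub>w\<close>, and the integrand has modulus at least \<open>\<delta>\<close> and constant sign on \<open>B\<close>.  The
  one-sidedness of \<open>B\<close> is what makes a first-moment argument sufficient.
\<close>
lemma off_band_estimate: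
  assumes B: "B \<in> sets borel" and u: "u \<in> ell2" and \<delta>: "\<delta> > 0"
    and side: "(\<forall>x\<in>B. x \<ge> E + \<delta>) \<or> (\<forall>x\<in>B. x \<le> E - \<delta>)"
  shows "\<delta> * ell2_norm (P B u) \<le> ell2_norm (\<lambda>n. T u n - complex_of_real E * u n)"
proof -
  let ?w = "P B u" and ?r = "\<lambda>n. T u n - complex_of_real E * u n"
  have w: "?w \<in> ell2" using B u by (rule proj_ell2)
  have r: "?r \<in> ell2" by (intro ell2_diff ell2_scale bounded_op_ell2[OF bounded] u)
  interpret finite_measure "\<mu> ?w" using w by (rule finite_measure_mu)
  have const: "(\<integral>x. c \<partial>\<mu> ?w) = c * (ell2_norm ?w)\<^sup>2" for c :: real
    by (simp add: measure_mu[OF _ w] proj_UNIV[OF w])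
  have "\<delta> * (ell2_norm ?w)\<^sup>2 \<le> \<bar>(\<integral>x. x \<partial>\<mu> ?w) - E * (ell2_norm ?w)\<^sup>2\<bar>"
    using side
  proof
    assume *: "\<forall>x\<in>B. x \<ge> E + \<delta>"
    have AE: "AE x in \<mu> ?w. x \<ge> E + \<delta>"
      by (rule eventually_mono[OF AE_mu_proj[OF B u]]) (use * in blast)
    have "(\<integral>x. E + \<delta> \<partial>\<mu> ?w) \<le> (\<integral>x. x \<partial>\<mu> ?w)"
      by (rule integral_mono_AE[OF _ _ AE]) (simp_all add: integrable_mu[OF w])
    hence "\<delta> * (ell2_norm ?w)\<^sup>2 \<le> (\<integral>x. x \<partial>\<mu> ?w) - E * (ell2_norm ?w)\<^sup>2"
      by (simp only: const distrib_right)
    thus ?thesis by linarith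
  next
    assume *: "\<forall>x\<in>B. x \<le> E - \<delta>"
    have AE: "AE x in \<mu> ?w. x \<le> E - \<delta>"
      by (rule eventually_mono[OF AE_mu_proj[OF B u]]) (use * in blast)
    have "(\<integral>x. x \<partial>\<mu> ?w) \<le> (\<integral>x. E - \<delta> \<partial>\<mu> ?w)"
      by (rule integral_mono_AE[OF _ _ AE]) (simp_all add: integrable_mu[OF w])
    hence "\<delta> * (ell2_norm ?w)\<^sup>2 \<le> E * (ell2_norm ?w)\<^sup>2 - (\<integral>x. x \<partial>\<mu> ?w)"
      by (simp only: const left_diff_distrib)
    thus ?thesis by linarith
  qed
  also have "\<dots> = cmod (ell2_inner ?w ?r)"
    unfolding inner_shifted_proj[OF B u] of_real_mult[symmetric] of_real_diff[symmetric]
      norm_of_real ..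
  also have "\<dots> \<le> ell2_norm ?w * ell2_norm ?r" using w r by (rule ell2_Cauchy_Schwarz)
  finally have "(\<delta> * ell2_norm ?w) * ell2_norm ?w \<le> ell2_norm ?r * ell2_norm ?w"
    by (simp add: power2_eq_square algebra_simps)
  hence "ell2_norm ?w > 0 \<Longrightarrow> ?thesis" by (rule mult_right_le_imp_le)
  moreover have "ell2_norm ?w = 0 \<Longrightarrow> ?thesis" by simp
  ultimately show ?thesis using ell2_norm_nonneg[of ?w] by linarith
qed

lemma spectral_localization:
  assumes J: "open J" "E \<in> J"
  obtains K where "\<And>u. u \<in> ell2 \<Longrightarrow>
    ell2_norm (\<lambda>n. P J u n - u n) \<le> K * ell2_norm (\<lambda>n. T u n - complex_of_real E * u n)"
proof -
  obtain \<delta> where \<delta>: "\<delta> > 0" "ball E \<delta> \<subseteq> J" using J open_contains_ball by blast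
  \<comment> \<open>The complement of J is cut at E into two one-sided pieces.\<close>
  define B1 where "B1 = - J \<inter> {E..}"
  define B2 where "B2 = - J \<inter> {..<E}"
  have meas: "J \<in> sets borel" "B1 \<in> sets borel" "B2 \<in> sets borel"
    using J by (auto simp: B1_def B2_def)
  have far: "\<bar>x - E\<bar> \<ge> \<delta>" if "x \<notin> J" for x
    using \<delta>(2) that by (force simp: subset_iff dist_real_def abs_minus_commute)
  have 1: "\<forall>x\<in>B1. x \<ge> E + \<delta>" using far by (force simp: B1_def)
  have 2: "\<forall>x\<in>B2. x \<le> E - \<delta>" using far by (force simp: B2_def)
  show ?thesis
  proof (rule that[of "2 / \<delta>"])
    fix u :: "'i \<Rightarrow> complex" assume u: "u \<in> ell2"
    have split: "- J = B1 \<union> B2" "B1 \<inter> B2 = {}" by (auto simp: B1_def B2_def)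
    have "(\<lambda>n. u n - P J u n) = P (- J) u"
      using proj_add_Compl[OF meas(1) u] by (auto simp: fun_eq_iff algebra_simps)
    also have "\<dots> = (\<lambda>n. P B1 u n + P B2 u n)"
      unfolding split(1) using meas split(2) u by (intro proj_Un_disjoint)
    finally have "ell2_norm (\<lambda>n. P J u n - u n) = ell2_norm (\<lambda>n. P B1 u n + P B2 u n)"
      by (subst ell2_norm_minus_commute) simp
    also have "\<dots> \<le> ell2_norm (P B1 u) + ell2_norm (P B2 u)"
      using meas u by (intro ell2_norm_triangle proj_ell2)
    finally have "\<delta> * ell2_norm (\<lambda>n. P J u n - u n) \<le> \<delta> * ell2_norm (P B1 u) + \<delta> * ell2_norm (P B2 u)"
      using \<delta>(1) by (simp flip: distrib_left)
    also have "\<dots> \<le> 2 * ell2_norm (\<lambda>n. T u n - complex_of_real E * u n)"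
      using off_band_estimate[of B1 u \<delta> E] off_band_estimate[of B2 u \<delta> E] meas u \<delta>(1) 1 2 by simp
    finally show "ell2_norm (\<lambda>n. P J u n - u n)
        \<le> 2 / \<delta> * ell2_norm (\<lambda>n. T u n - complex_of_real E * u n)"
      using \<delta>(1) by (simp add: field_simps)
  qed
qed

end

section \<open>Wave packets\<close>

text \<open>
  The set of sites where a cube of side \<open>L\<close> and its unit translate along \<open>i\<close> differ is of this form,
  with a two-element set \<open>S\<close>; the cube itself has \<open>S = {0..<L}\<close>.
\<close>
definition slab :: "'d::finite \<Rightarrow> int set \<Rightarrow> nat \<Rightarrow> (int ^ 'd) set" where
  "slab i S L = {n. n $ i \<in> S \<and> (\<forall>j. j \<noteq> i \<longrightarrow> n $ j \<in> {0..<int L})}"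

lemma slab_bij:
  "bij_betw (\<lambda>n j. n $ j) (slab i S L) (Pi\<^sub>E UNIV (\<lambda>j. if j = i then S else {0..<int L}))"
proof (rule bij_betwI[where g = "\<lambda>f. \<chi> j. f j"])
  show "(\<lambda>n j. n $ j) \<in> slab i S L \<rightarrow> (Pi\<^sub>E UNIV (\<lambda>j. if j = i then S else {0..<int L}))"
    by (auto simp: slab_def)
  show "(\<lambda>f. \<chi> j. f j) \<in> (Pi\<^sub>E UNIV (\<lambda>j. if j = i then S else {0..<int L})) \<rightarrow> slab i S L"
    by (auto simp: slab_def PiE_def Pi_def)
qed (auto simp: vec_eq_iff)

lemma card_slab: "card (slab (i :: 'd::finite) S L) = card S * L ^ (CARD('d) - 1)"
proof -
  have "card (slab i S L) = (\<Prod>j\<in>UNIV. card (if j = i then S else {0..<int L}))"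
    using bij_betw_same_card[OF slab_bij[of i S L]] by (simp add: card_PiE)
  also have "\<dots> = card S * (\<Prod>j\<in>UNIV - {i}. card (if j = i then S else {0..<int L}))"
    by (subst prod.remove[of _ i]) auto
  also have "(\<Prod>j\<in>UNIV - {i}. card (if j = i then S else {0..<int L})) = (\<Prod>j\<in>UNIV - {i}. L)"
    by (intro prod.cong) auto
  finally show ?thesis by (simp add: card_Diff_singleton)
qed

lemma finite_slab: "finite S \<Longrightarrow> finite (slab i S L)"
  using bij_betw_finite[OF slab_bij[of i S L]] by (auto intro!: finite_PiE)

lemma ell2_norm_flat:
  assumes "finite S" and "\<And>n. (cmod (v n))\<^sup>2 = (if n \<in> S then c else 0)"
  shows "v \<in> ell2" and "ell2_norm v = sqrt (real (card S) * c)"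
proof -
  have "v \<in> compact_supp"
    unfolding compact_supp_def
  proof (rule CollectI, rule finite_subset[OF _ assms(1)])
    have "n \<in> S" if "v n \<noteq> 0" for n
      using assms(2)[of n] that by (auto split: if_splits)
    thus "{n. v n \<noteq> 0} \<subseteq> S" by blast
  qed
  thus "v \<in> ell2" using compact_supp_ell2 by blast
  have "(\<Sum>\<^sub>\<infinity>n. (cmod (v n))\<^sup>2) = (\<Sum>\<^sub>\<infinity>n\<in>S. c)"
    by (rule infsum_cong_neutral) (auto simp: assms(2))
  also have "\<dots> = real (card S) * c" using assms(1) by simp
  finally show "ell2_norm v = sqrt (real (card S) * c)" by (simp add: ell2_norm_def)
qed

definition packet :: "(real ^ 'd::finite) \<Rightarrow> nat \<Rightarrow> int ^ 'd \<Rightarrow> complex" where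
  "packet \<theta> L = (\<lambda>n. if \<forall>j. n $ j \<in> {0..<int L}
     then cis (\<Sum>j\<in>UNIV. of_int (n $ j) * \<theta> $ j) / of_real (sqrt (real L ^ CARD('d))) else 0)"

lemma cube_slab: "{n. \<forall>j. n $ j \<in> {0..<int L}} = slab i {0..<int L} L"
  by (auto simp: slab_def)

lemma
  fixes \<theta> :: "real ^ 'd::finite"
  assumes L: "L > 0"
  shows packet_ell2: "packet \<theta> L \<in> ell2" and packet_norm: "ell2_norm (packet \<theta> L) = 1"
    and packet_compact_supp: "packet \<theta> L \<in> compact_supp"
proof -
  define i :: 'd where "i = undefined"
  have sq: "(cmod (packet \<theta> L n))\<^sup>2
      = (if n \<in> slab i {0..<int L} L then 1 / real L ^ CARD('d) else 0)" for n
    using L unfolding cube_slab[symmetric] by (simp add: packet_def norm_divide power_divide)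
  note flat = ell2_norm_flat[OF finite_slab sq]
  show "packet \<theta> L \<in> ell2" using flat(1) by simp
  have "L * L ^ (CARD('d) - 1) = L ^ CARD('d)"
    by (metis Suc_diff_1 power_Suc zero_less_card_finite)
  hence "real L * real L ^ (CARD('d) - 1) = real L ^ CARD('d)"
    by (metis of_nat_mult of_nat_power)
  thus "ell2_norm (packet \<theta> L) = 1" using flat(2) L by (simp add: card_slab)
  show "packet \<theta> L \<in> compact_supp"
    unfolding compact_supp_def
  proof (rule CollectI, rule finite_subset)
    show "{n. packet \<theta> L n \<noteq> 0} \<subseteq> slab i {0..<int L} L"
      unfolding cube_slab[symmetric] by (auto simp: packet_def)
    show "finite (slab i {0..<int L} L)" by (intro finite_slab) auto
  qed
qed

lemma shift_ell2_norm: "ell2_norm (shift i k u) = ell2_norm u"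
proof -
  have "bij_betw (\<lambda>n. n - axis i k) UNIV UNIV"
    by (rule bij_betwI[where g = "\<lambda>n. n + axis i k"]) auto
  thus ?thesis
    unfolding ell2_norm_def shift_def
    using infsum_reindex_bij_betw[of "\<lambda>n. n - axis i k" UNIV UNIV "\<lambda>n. (cmod (u n))\<^sup>2"] by simp
qed

lemma shift_ell2: "u \<in> ell2 \<Longrightarrow> shift i k u \<in> ell2"
proof -
  have "bij_betw (\<lambda>n. n - axis i k) UNIV UNIV"
    by (rule bij_betwI[where g = "\<lambda>n. n + axis i k"]) auto
  thus "u \<in> ell2 \<Longrightarrow> shift i k u \<in> ell2"
    unfolding ell2_def shift_def
    using summable_on_reindex_bij_betw[of "\<lambda>n. n - axis i k" UNIV UNIV "\<lambda>n. (cmod (u n))\<^sup>2"] by simp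
qed

lemma packet_phase:
  fixes n :: "int ^ 'd::finite"
  shows "cis (\<Sum>j\<in>UNIV. of_int ((n - axis i k) $ j) * \<theta> $ j)
       = cis (- of_int k * \<theta> $ i) * cis (\<Sum>j\<in>UNIV. of_int (n $ j) * \<theta> $ j)"
proof -
  have "(\<Sum>j\<in>UNIV. of_int ((n - axis i k) $ j) * \<theta> $ j)
      = (\<Sum>j\<in>UNIV. of_int (n $ j) * \<theta> $ j - (if j = i then of_int k * \<theta> $ i else 0))"
    by (intro sum.cong) (auto simp: axis_def algebra_simps)
  also have "\<dots> = (\<Sum>j\<in>UNIV. of_int (n $ j) * \<theta> $ j) - of_int k * \<theta> $ i"
    by (simp add: sum_subtractf)
  finally show ?thesis by (simp add: cis_mult)
qed

text \<open>
  Up to the phase the shift only moves the cube, so the error lives on two faces with \<open>L ^ (d - 1)\<close>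
  sites each, where it has squared modulus \<open>L ^ (- d)\<close>.
\<close>
lemma shift_packet_norm:
  fixes \<theta> :: "real ^ 'd::finite"
  assumes L: "L > 0" and k: "k = 1 \<or> k = - 1"
  shows "ell2_norm (\<lambda>n. shift i k (packet \<theta> L) n - cis (- of_int k * \<theta> $ i) * packet \<theta> L n)
       = sqrt (2 / real L)"
proof -
  define S where "S = (if k = 1 then {0, int L} else {- 1, int L - 1})"
  have fin: "finite (slab i S L)" and cS: "card S = 2"
    using L by (auto simp: S_def intro!: finite_slab)
  let ?c = "cis (- of_int k * \<theta> $ i)"
  let ?w = "\<lambda>n::int^'d. cis (\<Sum>j\<in>UNIV. of_int (n $ j) * \<theta> $ j) / of_real (sqrt (real L ^ CARD('d)))"
  define Q where "Q = {n::int^'d. \<forall>j. n $ j \<in> {0..<int L}}"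
  have "shift i k (packet \<theta> L) n - ?c * packet \<theta> L n
      = (of_bool (n - axis i k \<in> Q) - of_bool (n \<in> Q)) * (?c * ?w n)" for n
    unfolding shift_def packet_def packet_phase by (simp add: Q_def algebra_simps)
  moreover have "cmod (?c * ?w n) = 1 / sqrt (real L ^ CARD('d))" for n
    by (simp add: norm_mult norm_divide)
  ultimately have "cmod (shift i k (packet \<theta> L) n - ?c * packet \<theta> L n)
      = cmod (of_bool (n - axis i k \<in> Q) - of_bool (n \<in> Q)) * (1 / sqrt (real L ^ CARD('d)))" for n
    by (simp only: norm_mult)
  hence v: "(cmod (shift i k (packet \<theta> L) n - ?c * packet \<theta> L n))\<^sup>2
      = (if (n - axis i k \<in> Q) \<noteq> (n \<in> Q) then 1 / real L ^ CARD('d) else 0)" for n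
    by (cases "n - axis i k \<in> Q"; cases "n \<in> Q") (simp_all add: power_divide)
  have "(n - axis i k \<in> Q) \<noteq> (n \<in> Q) \<longleftrightarrow> n \<in> slab i S L" for n
  proof -
    define R where "R \<longleftrightarrow> (\<forall>j. j \<noteq> i \<longrightarrow> n $ j \<in> {0..<int L})"
    have at_i: "(\<forall>j. A j) \<longleftrightarrow> A i \<and> (\<forall>j. j \<noteq> i \<longrightarrow> A j)" for A :: "'d \<Rightarrow> bool"
      by metis
    have "n \<in> Q \<longleftrightarrow> n $ i \<in> {0..<int L} \<and> R"
      unfolding Q_def R_def mem_Collect_eq by (rule at_i)
    moreover have "n - axis i k \<in> Q \<longleftrightarrow> n $ i - k \<in> {0..<int L} \<and> R"
    proof -
      have "n - axis i k \<in> Q \<longleftrightarrow> (n - axis i k) $ i \<in> {0..<int L} \<and>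
          (\<forall>j. j \<noteq> i \<longrightarrow> (n - axis i k) $ j \<in> {0..<int L})"
        unfolding Q_def mem_Collect_eq by (rule at_i)
      thus ?thesis by (simp add: R_def axis_def)
    qed
    moreover have "n \<in> slab i S L \<longleftrightarrow> n $ i \<in> S \<and> R" by (simp add: slab_def R_def)
    moreover have "n $ i \<in> S \<longleftrightarrow> (n $ i - k \<in> {0..<int L}) \<noteq> (n $ i \<in> {0..<int L})"
      using k L by (auto simp: S_def)
    ultimately show ?thesis by blast
  qed
  hence "ell2_norm (\<lambda>n. shift i k (packet \<theta> L) n - ?c * packet \<theta> L n)
      = sqrt (real (card (slab i S L)) * (1 / real L ^ CARD('d)))"
    using v by (intro ell2_norm_flat(2)[OF fin]) simp
  also have "real (card (slab i S L)) * (1 / real L ^ CARD('d)) = 2 / real L"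
  proof -
    have "real L ^ CARD('d) = real L * real L ^ (CARD('d) - 1)"
      by (metis Suc_diff_1 power_Suc zero_less_card_finite)
    thus ?thesis using L by (simp add: card_slab cS)
  qed
  finally show ?thesis .
qed

text \<open>
  The operator \<open>T\<close> is linear with bound \<open>K\<close>, and the packets of wave vector \<open>\<theta>\<close> are approximate
  eigenvectors with eigenvalue \<open>z\<close>.  The bound is carried along because the convergence need
  not be uniform over an infinite family of operators, and dominated convergence will need it.
  The cubes have side \<open>Suc L\<close>, so that every packet is normalized.
\<close>
definition packet_symbol ::
  "(real ^ 'd::finite) \<Rightarrow> ((int ^ 'd \<Rightarrow> complex) \<Rightarrow> (int ^ 'd \<Rightarrow> complex)) \<Rightarrow> real \<Rightarrow> complex \<Rightarrow> bool" where
  "packet_symbol \<theta> T K z \<longleftrightarrow>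
     0 \<le> K \<and> (\<forall>u\<in>ell2. T u \<in> ell2) \<and>
     (\<forall>u\<in>ell2. \<forall>v\<in>ell2. T (\<lambda>n. u n + v n) = (\<lambda>n. T u n + T v n)) \<and>
     (\<forall>c. \<forall>u\<in>ell2. T (\<lambda>n. c * u n) = (\<lambda>n. c * T u n)) \<and>
     (\<forall>u\<in>ell2. ell2_norm (T u) \<le> K * ell2_norm u) \<and>
     (\<lambda>L. ell2_norm (\<lambda>n. T (packet \<theta> (Suc L)) n - z * packet \<theta> (Suc L) n)) \<longlonglongrightarrow> 0"

lemma packet_symbolD:
  assumes "packet_symbol \<theta> T K z"
  shows "0 \<le> K" and "bounded_op T" and "\<And>u. u \<in> ell2 \<Longrightarrow> ell2_norm (T u) \<le> K * ell2_norm u"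
    and "(\<lambda>L. ell2_norm (\<lambda>n. T (packet \<theta> (Suc L)) n - z * packet \<theta> (Suc L) n)) \<longlonglongrightarrow> 0"
  using assms unfolding packet_symbol_def bounded_op_def by blast+

lemma packet_symbolI:
  assumes "0 \<le> K" "\<And>u. u \<in> ell2 \<Longrightarrow> T u \<in> ell2"
    "\<And>u v. u \<in> ell2 \<Longrightarrow> v \<in> ell2 \<Longrightarrow> T (\<lambda>n. u n + v n) = (\<lambda>n. T u n + T v n)"
    "\<And>c u. u \<in> ell2 \<Longrightarrow> T (\<lambda>n. c * u n) = (\<lambda>n. c * T u n)"
    "\<And>u. u \<in> ell2 \<Longrightarrow> ell2_norm (T u) \<le> K * ell2_norm u"
    "f \<longlonglongrightarrow> 0"
    "\<And>L. ell2_norm (\<lambda>n. T (packet \<theta> (Suc L)) n - z * packet \<theta> (Suc L) n) \<le> f L"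
  shows "packet_symbol \<theta> T K z"
proof -
  have "(\<lambda>L. ell2_norm (\<lambda>n. T (packet \<theta> (Suc L)) n - z * packet \<theta> (Suc L) n)) \<longlonglongrightarrow> 0"
    by (rule tendsto_sandwich[OF _ _ tendsto_const assms(6)])
       (use assms(7) in \<open>auto intro!: always_eventually\<close>)
  thus ?thesis unfolding packet_symbol_def using assms(1-5) by blast
qed

lemma packet_symbol_shift_unit:
  assumes "k = 1 \<or> k = - 1"
  shows "packet_symbol \<theta> (shift i k) 1 (cis (- of_int k * \<theta> $ i))"
proof (rule packet_symbolI)
  show "(\<lambda>L. sqrt (2 / real (Suc L))) \<longlonglongrightarrow> 0"
  proof -
    have "(\<lambda>L. 2 * inverse (real (Suc L))) \<longlonglongrightarrow> 2 * 0"
      by (intro tendsto_intros LIMSEQ_inverse_real_of_nat)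
    hence "(\<lambda>L. sqrt (2 * inverse (real (Suc L)))) \<longlonglongrightarrow> sqrt (2 * 0)"
      by (rule tendsto_real_sqrt)
    thus ?thesis by (simp add: divide_inverse)
  qed
  show "ell2_norm (\<lambda>n. shift i k (packet \<theta> (Suc L)) n - cis (- of_int k * \<theta> $ i) * packet \<theta> (Suc L) n)
      \<le> sqrt (2 / real (Suc L))" for L
    by (rule eq_refl, rule shift_packet_norm) (use assms in auto)
qed (simp_all add: shift_ell2 shift_ell2_norm, simp_all add: shift_def)

text \<open>
  Split \<open>T S u - z w u = T (S u - w u) + w (T u - z u)\<close>.
\<close>
lemma packet_symbol_compose:
  assumes T: "packet_symbol \<theta> T K z" and S: "packet_symbol \<theta> S M w"
  shows "packet_symbol \<theta> (\<lambda>u. T (S u)) (K * M) (z * w)"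
proof -
  note Td = packet_symbolD[OF T] and Sd = packet_symbolD[OF S]
  note TS = bounded_op_ell2[OF Td(2)] bounded_op_ell2[OF Sd(2)]
  show ?thesis
  proof (rule packet_symbolI)
    fix u :: "int ^ 'a \<Rightarrow> complex" assume u: "u \<in> ell2"
    have "ell2_norm (T (S u)) \<le> K * ell2_norm (S u)" using TS(2) u by (intro Td(3))
    also have "\<dots> \<le> K * (M * ell2_norm u)" using Td(1) Sd(3)[OF u] by (intro mult_left_mono)
    finally show "ell2_norm (T (S u)) \<le> K * M * ell2_norm u" by (simp add: mult.assoc)
  next
    let ?p = "\<lambda>L. packet \<theta> (Suc L)"
    show "(\<lambda>L. K * ell2_norm (\<lambda>n. S (?p L) n - w * ?p L n)
        + cmod w * ell2_norm (\<lambda>n. T (?p L) n - z * ?p L n)) \<longlonglongrightarrow> 0"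
      using tendsto_add[OF tendsto_mult_left[OF Sd(4), of K] tendsto_mult_left[OF Td(4), of "cmod w"]]
      by simp
    fix L
    have p: "?p L \<in> ell2" by (rule packet_ell2) simp
    have 1: "(\<lambda>n. S (?p L) n - w * ?p L n) \<in> ell2" and 2: "(\<lambda>n. T (?p L) n - z * ?p L n) \<in> ell2"
      by (intro ell2_diff ell2_scale TS p)+
    have "T (\<lambda>n. S (?p L) n - w * ?p L n) = (\<lambda>n. T (S (?p L)) n - w * T (?p L) n)"
      using bounded_op_diff[OF Td(2) TS(2)[OF p] ell2_scale[OF p, of w]]
        bounded_op_scale[OF Td(2) p, of w] by simp
    hence "(\<lambda>n. T (S (?p L)) n - z * w * ?p L n)
        = (\<lambda>n. T (\<lambda>n. S (?p L) n - w * ?p L n) n + w * (T (?p L) n - z * ?p L n))"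
      by (simp add: algebra_simps)
    hence "ell2_norm (\<lambda>n. T (S (?p L)) n - z * w * ?p L n)
        = ell2_norm (\<lambda>n. T (\<lambda>n. S (?p L) n - w * ?p L n) n + w * (T (?p L) n - z * ?p L n))"
      by (rule arg_cong)
    also have "\<dots> \<le> ell2_norm (T (\<lambda>n. S (?p L) n - w * ?p L n))
        + ell2_norm (\<lambda>n. w * (T (?p L) n - z * ?p L n))"
      by (intro ell2_norm_triangle TS(1) ell2_scale 1 2)
    also have "\<dots> \<le> K * ell2_norm (\<lambda>n. S (?p L) n - w * ?p L n)
        + cmod w * ell2_norm (\<lambda>n. T (?p L) n - z * ?p L n)"
      using Td(3)[OF 1] by (simp add: ell2_norm_scale)
    finally show "ell2_norm (\<lambda>n. T (S (?p L)) n - z * w * ?p L n)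
      \<le> K * ell2_norm (\<lambda>n. S (?p L) n - w * ?p L n)
        + cmod w * ell2_norm (\<lambda>n. T (?p L) n - z * ?p L n)" .
  qed (use Td(1) Sd(1) TS in \<open>simp_all add: bounded_op_add[OF Sd(2)] bounded_op_add[OF Td(2)]
        bounded_op_scale[OF Sd(2)] bounded_op_scale[OF Td(2)]\<close>)
qed

lemma packet_symbol_add:
  assumes T: "packet_symbol \<theta> T K z" and S: "packet_symbol \<theta> S M w"
  shows "packet_symbol \<theta> (\<lambda>u n. T u n + S u n) (K + M) (z + w)"
proof -
  note Td = packet_symbolD[OF T] and Sd = packet_symbolD[OF S]
  note TS = bounded_op_ell2[OF Td(2)] bounded_op_ell2[OF Sd(2)]
  show ?thesis
  proof (rule packet_symbolI)
    fix u :: "int ^ 'a \<Rightarrow> complex" assume u: "u \<in> ell2"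
    have "ell2_norm (\<lambda>n. T u n + S u n) \<le> ell2_norm (T u) + ell2_norm (S u)"
      by (intro ell2_norm_triangle TS u)
    also have "\<dots> \<le> K * ell2_norm u + M * ell2_norm u" by (intro add_mono Td(3) Sd(3) u)
    finally show "ell2_norm (\<lambda>n. T u n + S u n) \<le> (K + M) * ell2_norm u" by (simp add: distrib_right)
    show "(\<lambda>n. T u n + S u n) \<in> ell2" by (intro ell2_add TS u)
  next
    let ?p = "\<lambda>L. packet \<theta> (Suc L)"
    show "(\<lambda>L. ell2_norm (\<lambda>n. T (?p L) n - z * ?p L n) + ell2_norm (\<lambda>n. S (?p L) n - w * ?p L n)) \<longlonglongrightarrow> 0"
      using tendsto_add[OF Td(4) Sd(4)] by simp
    fix L
    have p: "?p L \<in> ell2" by (rule packet_ell2) simp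
    have "(\<lambda>n. T (?p L) n + S (?p L) n - (z + w) * ?p L n)
        = (\<lambda>n. (T (?p L) n - z * ?p L n) + (S (?p L) n - w * ?p L n))"
      by (simp add: algebra_simps)
    hence "ell2_norm (\<lambda>n. T (?p L) n + S (?p L) n - (z + w) * ?p L n)
        = ell2_norm (\<lambda>n. (T (?p L) n - z * ?p L n) + (S (?p L) n - w * ?p L n))"
      by (rule arg_cong)
    also have "\<dots> \<le> ell2_norm (\<lambda>n. T (?p L) n - z * ?p L n)
        + ell2_norm (\<lambda>n. S (?p L) n - w * ?p L n)"
      by (intro ell2_norm_triangle TS ell2_diff ell2_scale p)
    finally show "ell2_norm (\<lambda>n. T (?p L) n + S (?p L) n - (z + w) * ?p L n)
      \<le> ell2_norm (\<lambda>n. T (?p L) n - z * ?p L n) + ell2_norm (\<lambda>n. S (?p L) n - w * ?p L n)" .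
  next
    fix u v :: "int ^ 'a \<Rightarrow> complex" assume uv: "u \<in> ell2" "v \<in> ell2"
    show "(\<lambda>n. T (\<lambda>n. u n + v n) n + S (\<lambda>n. u n + v n) n) = (\<lambda>n. T u n + S u n + (T v n + S v n))"
      by (simp add: bounded_op_add[OF Sd(2) uv] bounded_op_add[OF Td(2) uv] algebra_simps)
  next
    fix c and u :: "int ^ 'a \<Rightarrow> complex" assume u: "u \<in> ell2"
    show "(\<lambda>n. T (\<lambda>n. c * u n) n + S (\<lambda>n. c * u n) n) = (\<lambda>n. c * (T u n + S u n))"
      by (simp add: bounded_op_scale[OF Sd(2) u] bounded_op_scale[OF Td(2) u] algebra_simps)
  qed (use Td(1) Sd(1) in simp)
qed

lemma packet_symbol_scale:
  assumes T: "packet_symbol \<theta> T K z"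
  shows "packet_symbol \<theta> (\<lambda>u n. c * T u n) (cmod c * K) (c * z)"
proof -
  note Td = packet_symbolD[OF T]
  note T2 = bounded_op_ell2[OF Td(2)]
  show ?thesis
  proof (rule packet_symbolI)
    let ?p = "\<lambda>L. packet \<theta> (Suc L)"
    show "(\<lambda>L. cmod c * ell2_norm (\<lambda>n. T (?p L) n - z * ?p L n)) \<longlonglongrightarrow> 0"
      using tendsto_mult_left[OF Td(4), of "cmod c"] by simp
    show "ell2_norm (\<lambda>n. c * T (?p L) n - c * z * ?p L n)
        \<le> cmod c * ell2_norm (\<lambda>n. T (?p L) n - z * ?p L n)" for L
      using ell2_norm_scale[of c "\<lambda>n. T (?p L) n - z * ?p L n"] by (simp add: algebra_simps)
  next
    fix u v :: "int ^ 'a \<Rightarrow> complex" assume uv: "u \<in> ell2" "v \<in> ell2"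
    show "(\<lambda>n. c * T (\<lambda>n. u n + v n) n) = (\<lambda>n. c * T u n + c * T v n)"
      by (simp add: bounded_op_add[OF Td(2) uv] algebra_simps)
  next
    fix d and u :: "int ^ 'a \<Rightarrow> complex" assume u: "u \<in> ell2"
    show "(\<lambda>n. c * T (\<lambda>n. d * u n) n) = (\<lambda>n. d * (c * T u n))"
      by (simp add: bounded_op_scale[OF Td(2) u] algebra_simps)
  next
    fix u :: "int ^ 'a \<Rightarrow> complex" assume u: "u \<in> ell2"
    show "ell2_norm (\<lambda>n. c * T u n) \<le> cmod c * K * ell2_norm u"
      using mult_left_mono[OF Td(3)[OF u], of "cmod c"] by (simp add: ell2_norm_scale mult.assoc)
    show "(\<lambda>n. c * T u n) \<in> ell2" by (intro ell2_scale T2 u)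
  qed (use Td(1) in simp)
qed

lemma shift_add: "shift i (k + l) u = shift i k (shift i l u)"
  by (auto simp: shift_def fun_eq_iff axis_def vec_eq_iff intro!: arg_cong[where f = u])

lemma shift_0 [simp]: "shift i 0 u = u"
  by (auto simp: shift_def fun_eq_iff axis_def vec_eq_iff intro!: arg_cong[where f = u])

lemma packet_symbol_shift: "packet_symbol \<theta> (shift i k) 1 (cis (- of_int k * \<theta> $ i))"
proof -
  \<comment> \<open>Powers of the two unit shifts, by composition; the sign of k decides which one.\<close>
  have step: "packet_symbol \<theta> (shift i (s * int m)) 1 (cis (- of_int (s * int m) * \<theta> $ i))"
    if s: "s = 1 \<or> s = - 1" for s m
  proof (induction m)
    case 0
    show ?case
      by (rule packet_symbolI[where f = "\<lambda>_. 0"]) (simp_all add: shift_ell2 shift_ell2_norm)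
  next
    case (Suc m)
    have "packet_symbol \<theta> (\<lambda>u. shift i s (shift i (s * int m) u)) (1 * 1)
        (cis (- of_int s * \<theta> $ i) * cis (- of_int (s * int m) * \<theta> $ i))"
      using packet_symbol_shift_unit[OF s] Suc by (rule packet_symbol_compose)
    moreover have "(\<lambda>u. shift i s (shift i (s * int m) u)) = shift i (s * int (Suc m))"
      by (simp add: distrib_left shift_add fun_eq_iff)
    moreover have "cis (- of_int s * \<theta> $ i) * cis (- of_int (s * int m) * \<theta> $ i)
        = cis (- of_int (s * int (Suc m)) * \<theta> $ i)"
      by (simp add: cis_mult algebra_simps)
    ultimately show ?case by simp
  qed
  show ?thesis using step[of 1 "nat k"] step[of "- 1" "nat (- k)"] by (cases "k \<ge> 0") auto
qed

definition shift_diff :: "'d::finite \<Rightarrow> int \<Rightarrow> (int ^ 'd \<Rightarrow> complex) \<Rightarrow> (int ^ 'd \<Rightarrow> complex)" where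
  "shift_diff i k u = (\<lambda>n. shift i k u n - shift i (- k) u n)"

lemma packet_symbol_shift_diff:
  "packet_symbol \<theta> (shift_diff i k) 2 (- 2 * \<i> * of_real (sin (of_int k * \<theta> $ i)))"
proof -
  let ?a = "of_int k * \<theta> $ i"
  have "packet_symbol \<theta> (\<lambda>u n. shift i k u n + - 1 * shift i (- k) u n) (1 + cmod (- 1) * 1)
      (cis (- of_int k * \<theta> $ i) + - 1 * cis (- of_int (- k) * \<theta> $ i))"
    by (rule packet_symbol_add[OF packet_symbol_shift packet_symbol_scale[OF packet_symbol_shift]])
  moreover have "cis (- of_int k * \<theta> $ i) + - 1 * cis (- of_int (- k) * \<theta> $ i)
      = - 2 * \<i> * of_real (sin ?a)"
    by (simp add: complex_eq_iff)
  moreover have "(\<lambda>u n. shift i k u n + - 1 * shift i (- k) u n) = shift_diff i k"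
    by (simp add: shift_diff_def fun_eq_iff)
  ultimately show ?thesis by simp
qed

lemma packet_symbol_Delta: "packet_symbol \<theta> (Delta i) 1 (of_real (cos (\<theta> $ i)))"
proof -
  have "packet_symbol \<theta> (\<lambda>u n. (1 / 2) * (shift i 1 u n + shift i (- 1) u n)) (cmod (1 / 2) * (1 + 1))
      ((1 / 2) * (cis (- of_int 1 * \<theta> $ i) + cis (- of_int (- 1) * \<theta> $ i)))"
    by (rule packet_symbol_scale[OF packet_symbol_add[OF packet_symbol_shift packet_symbol_shift]])
  moreover have "(1 / 2) * (cis (- of_int 1 * \<theta> $ i) + cis (- of_int (- 1) * \<theta> $ i))
      = of_real (cos (\<theta> $ i))"
    by (simp add: complex_eq_iff)
  moreover have "(\<lambda>u n. (1 / 2) * (shift i 1 u n + shift i (- 1) u n)) = Delta i"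
    by (simp add: Delta_def fun_eq_iff)
  ultimately show ?thesis by (simp add: norm_divide)
qed

lemma packet_symbol_MV_laplacian:
  "packet_symbol \<theta> (MV_laplacian :: (int ^ 2 \<Rightarrow> complex) \<Rightarrow> _) 1
     (of_real (cos (\<theta> $ 1) * cos (\<theta> $ 2)))"
  using packet_symbol_compose[OF packet_symbol_Delta[of \<theta> 1] packet_symbol_Delta[of \<theta> 2]]
  by (simp add: MV_laplacian_2 comp_def)

section \<open>The commutator and its symbol\<close>

lemma conj_op_i_eq:
  "\<i> * conj_op_i i k u n = (of_int (2 * n $ i - int k) * shift i (int k) u n
       - of_int (2 * n $ i + int k) * shift i (- int k) u n) / 4"
proof -
  have cancel: "\<i> * (1 / (4 * \<i>) * x) = x / 4" for x :: complex by simp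
  have comp: "(n - axis i m) $ i = n $ i - m" for m by simp
  show ?thesis
    unfolding conj_op_i_def Let_def cancel position_def shift_def comp by (simp add: algebra_simps)
qed

lemma Delta_conj_op_i_commute:
  assumes "l \<noteq> i"
  shows "Delta l (\<lambda>m. \<i> * conj_op_i i k u m) n = \<i> * conj_op_i i k (Delta l u) n"
  using assms unfolding conj_op_i_eq
  by (simp add: Delta_def shift_def axis_def[of l] field_simps)

text \<open>
  The coefficients of \<open>\<i> A\<^sub>i\<close> grow linearly in the position, but their increments under a unit shift
  are constant.  The commutator is therefore a polynomial in the shifts.
\<close>
lemma Delta_conj_op_i_commutator:
  "Delta i (\<lambda>m. \<i> * conj_op_i i k u m) n - \<i> * conj_op_i i k (Delta i u) n
     = shift_diff i (int k) (shift_diff i (- 1) u) n / 4"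
  unfolding conj_op_i_eq
  by (simp add: Delta_def shift_diff_def shift_def field_simps)

text \<open>
  The commutator \<open>[D, \<i> A\<^sub>k]\<close> in closed form.  On a plane wave of angle \<open>\<theta>\<close> the factor
  \<open>S\<^sup>k - S\<^sup>-\<^sup>k\<close> becomes \<open>- 2 \<i> sin (k \<theta>)\<close> and \<open>S\<^sup>-\<^sup>1 - S\<close> becomes \<open>2 \<i> sin \<theta>\<close>; the
  factor \<open>1 / 4\<close> compensates the product of the two constants.
\<close>
definition commutator_op :: "nat \<Rightarrow> (int ^ 2 \<Rightarrow> complex) \<Rightarrow> (int ^ 2 \<Rightarrow> complex)" where
  "commutator_op k u = (\<lambda>n. (1 / 4) *
     (shift_diff 1 (int k) (shift_diff 1 (- 1) (Delta 2 u)) n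
      + shift_diff 2 (int k) (shift_diff 2 (- 1) (Delta 1 u)) n))"

text \<open>
  In the summand for direction \<open>i\<close>, move the factor of the Laplacian in the other direction, which
  commutes with \<open>A\<^sub>i\<close>, to the right.
\<close>
lemma MV_laplacian_conj_op_commutator:
  "MV_laplacian (\<lambda>m. \<i> * conj_op k u m) n - \<i> * conj_op k (MV_laplacian u) n = commutator_op k u n"
proof -
  let ?Q = "\<lambda>i u m. \<i> * conj_op_i i k u m"
  have D: "MV_laplacian v = Delta 1 (Delta 2 v)" "MV_laplacian v = Delta 2 (Delta 1 v)" for v :: "int^2 \<Rightarrow> complex"
    using fun_cong[OF Delta_commute, of 1 2 v] by (simp_all add: MV_laplacian_2)
  have sum: "\<i> * conj_op k v m = ?Q 1 v m + ?Q 2 v m" for v :: "int^2 \<Rightarrow> complex" and m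
    by (simp add: conj_op_def UNIV_2 distrib_left)
  have add: "Delta i (\<lambda>m. v m + w m) = (\<lambda>m. Delta i v m + Delta i w m)" for i and v w :: "int^2 \<Rightarrow> complex"
    by (simp add: Delta_def shift_def add_divide_distrib algebra_simps)
  have "MV_laplacian (?Q 1 u) n = Delta 1 (Delta 2 (?Q 1 u)) n" by (simp only: D(1))
  also have "Delta 2 (?Q 1 u) = ?Q 1 (Delta 2 u)" by (rule ext) (rule Delta_conj_op_i_commute, simp)
  finally have 1: "MV_laplacian (?Q 1 u) n - ?Q 1 (MV_laplacian u) n
      = shift_diff 1 (int k) (shift_diff 1 (- 1) (Delta 2 u)) n / 4"
    using Delta_conj_op_i_commutator[of 1 k "Delta 2 u" n] by (simp only: D(1))
  have "MV_laplacian (?Q 2 u) n = Delta 2 (Delta 1 (?Q 2 u)) n" by (simp only: D(2))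
  also have "Delta 1 (?Q 2 u) = ?Q 2 (Delta 1 u)" by (rule ext) (rule Delta_conj_op_i_commute, simp)
  finally have 2: "MV_laplacian (?Q 2 u) n - ?Q 2 (MV_laplacian u) n
      = shift_diff 2 (int k) (shift_diff 2 (- 1) (Delta 1 u)) n / 4"
    using Delta_conj_op_i_commutator[of 2 k "Delta 1 u" n] by (simp only: D(2))
  have "MV_laplacian (\<lambda>m. \<i> * conj_op k u m) n = MV_laplacian (?Q 1 u) n + MV_laplacian (?Q 2 u) n"
    by (simp only: sum D(1) add)
  thus ?thesis using 1 2 by (simp add: sum commutator_op_def field_simps)
qed

lemma packet_symbol_commutator_op:
  "packet_symbol \<theta> (commutator_op k) 2
     (of_real (sin (real k * \<theta> $ 1) * sin (\<theta> $ 1) * cos (\<theta> $ 2)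
            + sin (real k * \<theta> $ 2) * sin (\<theta> $ 2) * cos (\<theta> $ 1)))"
proof -
  let ?z = "\<lambda>i l. (- 2 * \<i> * of_real (sin (of_int (int k) * \<theta> $ i))) *
      ((- 2 * \<i> * of_real (sin (of_int (- 1) * \<theta> $ i))) * of_real (cos (\<theta> $ l)))"
  have S: "packet_symbol \<theta> (\<lambda>u. shift_diff i (int k) (shift_diff i (- 1) (Delta l u))) (2 * (2 * 1)) (?z i l)" for i l
    by (rule packet_symbol_compose[OF packet_symbol_shift_diff
          packet_symbol_compose[OF packet_symbol_shift_diff packet_symbol_Delta]])
  have "packet_symbol \<theta> (commutator_op k) (cmod (1 / 4) * (2 * (2 * 1) + 2 * (2 * 1)))
      (1 / 4 * (?z 1 2 + ?z 2 1))"
    unfolding commutator_op_def by (rule packet_symbol_scale[OF packet_symbol_add[OF S S]])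
  moreover have "1 / 4 * (?z 1 2 + ?z 2 1) = of_real (sin (real k * \<theta> $ 1) * sin (\<theta> $ 1) * cos (\<theta> $ 2)
            + sin (real k * \<theta> $ 2) * sin (\<theta> $ 2) * cos (\<theta> $ 1))"
    by (simp add: algebra_simps)
  moreover have "cmod (1 / 4) * (2 * (2 * 1) + 2 * (2 * 1)) = (2 :: real)" by (simp add: norm_divide)
  ultimately show ?thesis by (simp only:)
qed

lemma UNIV_2_minus: "UNIV - {1 :: 2} = {2}" "UNIV - {2 :: 2} = {1}"
  by (auto simp: UNIV_2)

lemma g_fun_trig:
  fixes \<theta> :: "real ^ 2"
  assumes "k > 0"
  shows "g_fun k (\<chi> i. cos (\<theta> $ i)) = sin (real k * \<theta> $ 1) * sin (\<theta> $ 1) * cos (\<theta> $ 2)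
            + sin (real k * \<theta> $ 2) * sin (\<theta> $ 2) * cos (\<theta> $ 1)"
proof -
  have "(1 - (cos t)\<^sup>2) * cheb_U (k - 1) (cos t) = sin (real k * t) * sin t" for t
  proof -
    have "(1 - (cos t)\<^sup>2) * cheb_U (k - 1) (cos t) = (cheb_U (k - 1) (cos t) * sin t) * sin t"
      unfolding sin_squared_eq[symmetric] by (simp add: power2_eq_square mult_ac)
    thus ?thesis unfolding cheb_U_sin using assms by simp
  qed
  note U = this[of "\<theta> $ 1"] this[of "\<theta> $ 2"]
  have "g_fun k (\<chi> i. cos (\<theta> $ i)) = cos (\<theta> $ 2) * ((1 - (cos (\<theta> $ 1))\<^sup>2) * cheb_U (k - 1) (cos (\<theta> $ 1)))
      + cos (\<theta> $ 1) * ((1 - (cos (\<theta> $ 2))\<^sup>2) * cheb_U (k - 1) (cos (\<theta> $ 2)))"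
    by (simp add: g_fun_def UNIV_2_minus sum_2 mult.assoc)
  also have "\<dots> = sin (real k * \<theta> $ 1) * sin (\<theta> $ 1) * cos (\<theta> $ 2)
            + sin (real k * \<theta> $ 2) * sin (\<theta> $ 2) * cos (\<theta> $ 1)"
    unfolding U by simp
  finally show ?thesis .
qed

lemma S_set_angles:
  assumes "x \<in> (S_set E :: (real ^ 2) set)"
  obtains \<theta> :: "real ^ 2" where "x = (\<chi> i. cos (\<theta> $ i))" and "cos (\<theta> $ 1) * cos (\<theta> $ 2) = E"
proof
  show x: "x = (\<chi> i. cos ((\<chi> i. arccos (x $ i)) $ i))"
    using assms by (auto simp: S_set_def vec_eq_iff)
  have "cos (arccos (x $ i)) = x $ i" for i using assms by (auto simp: S_set_def)
  thus "cos ((\<chi> i. arccos (x $ i)) $ 1) * cos ((\<chi> i. arccos (x $ i)) $ 2) = E"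
    using assms by (simp add: S_set_def UNIV_2)
qed

lemma g_fun_le_2:
  assumes "k > 0" "x \<in> (S_set E :: (real ^ 2) set)"
  shows "\<bar>g_fun k x\<bar> \<le> 2"
proof -
  obtain \<theta> :: "real ^ 2" where x: "x = (\<chi> i. cos (\<theta> $ i))" using S_set_angles[OF assms(2)] .
  have "\<bar>sin a * sin b * cos c\<bar> \<le> 1" for a b c :: real
    using mult_mono[OF mult_mono[OF abs_sin_le_one[of a] abs_sin_le_one[of b]] abs_cos_le_one[of c]]
    by (simp add: abs_mult)
  note this[of "real k * \<theta> $ 1" "\<theta> $ 1" "\<theta> $ 2"] this[of "real k * \<theta> $ 2" "\<theta> $ 2" "\<theta> $ 1"]
  thus ?thesis unfolding x g_fun_trig[OF assms(1)] by linarith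
qed

text \<open>
  Weyl's criterion: the packets are unit vectors on which \<open>D - E\<close> tends to 0.
\<close>
lemma S_set_subset_spectrum:
  assumes "x \<in> (S_set E :: (real ^ 2) set)"
  shows "E \<in> sigma_D TYPE(2)"
proof -
  obtain \<theta> :: "real ^ 2" where \<theta>: "cos (\<theta> $ 1) * cos (\<theta> $ 2) = E" using S_set_angles[OF assms] .
  let ?D = "MV_laplacian :: (int ^ 2 \<Rightarrow> complex) \<Rightarrow> _"
  let ?p = "\<lambda>L. packet \<theta> (Suc L)"
  have D: "packet_symbol \<theta> ?D 1 (of_real E)" using packet_symbol_MV_laplacian[of \<theta>] \<theta> by simp
  show ?thesis unfolding sigma_D_def op_spectrum_def mem_Collect_eq
  proof (rule notI, elim exE conjE)
    fix R assume R: "bounded_op R" and inv: "\<forall>u\<in>ell2. R (\<lambda>n. ?D u n - of_real E * u n) = u \<and>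
        (\<lambda>n. ?D (R u) n - of_real E * R u n) = u"
    obtain K where K: "\<And>u. u \<in> ell2 \<Longrightarrow> ell2_norm (R u) \<le> K * ell2_norm u"
      using bounded_op_bound[OF R] by blast
    have "1 \<le> K * ell2_norm (\<lambda>n. ?D (?p L) n - of_real E * ?p L n)" for L
    proof -
      have p: "?p L \<in> ell2" "ell2_norm (?p L) = 1" by (auto intro!: packet_ell2 packet_norm)
      have "(\<lambda>n. ?D (?p L) n - of_real E * ?p L n) \<in> ell2"
        by (intro ell2_diff ell2_scale bounded_op_ell2[OF packet_symbolD(2)[OF D]] p(1))
      moreover have "R (\<lambda>n. ?D (?p L) n - of_real E * ?p L n) = ?p L" using inv p(1) by blast
      ultimately show ?thesis using K p(2) by metis
    qed
    moreover have "(\<lambda>L. K * ell2_norm (\<lambda>n. ?D (?p L) n - of_real E * ?p L n)) \<longlonglongrightarrow> 0"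
      using tendsto_mult_left[OF packet_symbolD(4)[OF D], of K] by simp
    ultimately have "(1 :: real) \<le> 0" by (intro LIMSEQ_le_const) auto
    thus False by simp
  qed
qed

lemma conj_op_delta:
  fixes i :: "'d::finite"
  assumes "k > 0" "l > 0"
  shows "conj_op k (\<lambda>n. if n = 0 then 1 else 0) (axis i (int l) :: int ^ 'd)
      = (if k = l then of_nat l / (4 * \<i>) else 0)"
proof -
  let ?\<delta> = "\<lambda>n::int^'d. if n = 0 then (1::complex) else 0"
  have ne: "axis i (int l) - axis j m \<noteq> 0" if "j \<noteq> i \<or> m \<noteq> int l" for j and m :: int
    using that assms by (auto simp: axis_eq_axis)
  have one: "\<i> * conj_op_i j k ?\<delta> (axis i (int l)) = (if j = i \<and> k = l then of_nat l / 4 else 0)" for j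
    unfolding conj_op_i_eq shift_def
    using ne[of j "int k"] ne[of j "- int k"] assms by auto
  have "\<i> * conj_op k ?\<delta> (axis i (int l)) = (\<Sum>j\<in>UNIV. if j = i \<and> k = l then of_nat l / 4 else 0)"
    unfolding conj_op_def sum_distrib_left by (rule sum.cong[OF refl one])
  also have "\<dots> = (if k = l then of_nat l / 4 else 0)" by (simp add: sum.delta)
  finally have *: "\<i> * conj_op k ?\<delta> (axis i (int l)) = (if k = l then of_nat l / 4 else 0)" .
  have "conj_op k ?\<delta> (axis i (int l)) = (\<i> * conj_op k ?\<delta> (axis i (int l))) / \<i>" by simp
  thus ?thesis unfolding * by simp
qed

lemma compact_supp_shift: "u \<in> compact_supp \<Longrightarrow> shift i k u \<in> compact_supp"
proof -
  assume "u \<in> compact_supp"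
  hence "finite ((\<lambda>n. n + axis i k) ` {n. u n \<noteq> 0})" by (simp add: compact_supp_def)
  moreover have "{n. shift i k u n \<noteq> 0} \<subseteq> (\<lambda>n. n + axis i k) ` {n. u n \<noteq> 0}"
    by (auto simp: shift_def image_iff intro!: exI[where x = "_ - axis i k"])
  ultimately show ?thesis unfolding compact_supp_def using finite_subset by blast
qed

lemma compact_supp_pointwise:
  assumes "u \<in> compact_supp" "v \<in> compact_supp" and "\<And>n. u n = 0 \<Longrightarrow> v n = 0 \<Longrightarrow> w n = 0"
  shows "w \<in> compact_supp"
proof -
  have "{n. w n \<noteq> 0} \<subseteq> {n. u n \<noteq> 0} \<union> {n. v n \<noteq> 0}" using assms(3) by blast
  thus ?thesis using assms(1,2) unfolding compact_supp_def mem_Collect_eq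
    by (meson finite_UnI finite_subset)
qed

lemma compact_supp_Delta: "u \<in> compact_supp \<Longrightarrow> Delta i u \<in> compact_supp"
  by (rule compact_supp_pointwise[OF compact_supp_shift[of u i 1] compact_supp_shift[of u i "- 1"]])
    (simp_all add: Delta_def)

lemma compact_supp_MV_laplacian:
  "u \<in> compact_supp \<Longrightarrow> (MV_laplacian :: (int ^ 2 \<Rightarrow> complex) \<Rightarrow> _) u \<in> compact_supp"
  by (simp add: MV_laplacian_2 compact_supp_Delta)

lemma compact_supp_sum:
  assumes "finite I" "\<And>i. i \<in> I \<Longrightarrow> f i \<in> compact_supp"
  shows "(\<lambda>n. \<Sum>i\<in>I. c i * f i n) \<in> compact_supp"
  using assms
proof (induction rule: finite_induct)
  case empty
  show ?case by (simp add: compact_supp_def)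
next
  case (insert i I)
  have "f i \<in> compact_supp" "(\<lambda>n. \<Sum>i\<in>I. c i * f i n) \<in> compact_supp" using insert by auto
  thus ?case by (rule compact_supp_pointwise) (use insert in simp)
qed

lemma compact_supp_conj_op:
  assumes "u \<in> compact_supp"
  shows "conj_op k u \<in> compact_supp"
proof -
  have "conj_op_i i k u \<in> compact_supp" for i
  proof (rule compact_supp_pointwise[OF compact_supp_shift[OF assms, of i "int k"]
          compact_supp_shift[OF assms, of i "- int k"]])
    fix n assume "shift i (int k) u n = 0" "shift i (- int k) u n = 0"
    hence "\<i> * conj_op_i i k u n = 0" unfolding conj_op_i_eq by simp
    thus "conj_op_i i k u n = 0" by simp
  qed
  hence "(\<lambda>n. \<Sum>i\<in>UNIV. 1 * conj_op_i i k u n) \<in> compact_supp" by (intro compact_supp_sum) auto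
  thus ?thesis by (simp add: conj_op_def[abs_def])
qed

text \<open>
  Evaluate the combination on the point mass at the origin.  The site at distance \<open>p \<kappa>\<close> on an axis is
  reached only by the term \<open>p\<close>, with coefficient \<open>p \<kappa> \<rho>\<^sub>p\<^sub>\<kappa> / (4 \<i>)\<close>; so \<open>(p \<rho>\<^sub>p\<^sub>\<kappa>)\<close> is square summable, and
  \<open>2 \<bar>\<rho>\<^sub>p\<^sub>\<kappa>\<bar> \<le> (p \<rho>\<^sub>p\<^sub>\<kappa>)\<^sup>2 + p\<^sup>-\<^sup>2\<close>.
\<close>
lemma coefficients_summable:
  fixes \<rho> :: "nat \<Rightarrow> real"
  assumes \<kappa>: "\<kappa> > 0"
    and dom: "(compact_supp :: (int ^ 'd::finite \<Rightarrow> complex) set) \<subseteq> Domain (conj_comb_core \<kappa> \<rho>)"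
  shows "summable (\<lambda>p. \<bar>\<rho> (Suc p * \<kappa>)\<bar>)"
proof -
  define i :: 'd where "i = undefined"
  let ?\<delta> = "\<lambda>n::int^'d. if n = 0 then (1::complex) else 0"
  have \<delta>: "?\<delta> \<in> compact_supp" by (simp add: compact_supp_def)
  with dom have "?\<delta> \<in> Domain (conj_comb_core \<kappa> \<rho>)" by blast
  then obtain v where v: "v \<in> ell2" and lim:
    "(\<lambda>N. ell2_norm (\<lambda>n. (\<Sum>p=1..N. of_real (\<rho> (p * \<kappa>)) * conj_op (p * \<kappa>) ?\<delta> n) - v n)) \<longlonglongrightarrow> 0"
    by (auto simp: conj_comb_core_def)
  let ?s = "\<lambda>N n. \<Sum>p=1..N. of_real (\<rho> (p * \<kappa>)) * conj_op (p * \<kappa>) ?\<delta> n"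
  have s: "?s N \<in> ell2" for N
    by (rule subsetD[OF compact_supp_ell2]) (intro compact_supp_sum compact_supp_conj_op \<delta> finite_atLeastAtMost)
  have coord: "v (axis i (int (p * \<kappa>))) = of_real (\<rho> (p * \<kappa>)) * of_nat (p * \<kappa>) / (4 * \<i>)"
    if p: "p > 0" for p
  proof -
    let ?n = "axis i (int (p * \<kappa>)) :: int^'d" and ?c = "of_real (\<rho> (p * \<kappa>)) * of_nat (p * \<kappa>) / (4 * \<i>) :: complex"
    have val: "?s N ?n = ?c" if "N \<ge> p" for N
    proof -
      have "?s N ?n = (\<Sum>q=1..N. if q = p then ?c else 0)"
      proof (rule sum.cong[OF refl])
        fix q assume "q \<in> {1..N}"
        hence "conj_op (q * \<kappa>) ?\<delta> ?n = (if q * \<kappa> = p * \<kappa> then of_nat (p * \<kappa>) / (4 * \<i>) else 0)"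
          using p \<kappa> by (intro conj_op_delta) auto
        also have "q * \<kappa> = p * \<kappa> \<longleftrightarrow> q = p" using \<kappa> by simp
        finally show "of_real (\<rho> (q * \<kappa>)) * conj_op (q * \<kappa>) ?\<delta> ?n = (if q = p then ?c else 0)"
          by (cases "q = p") (simp_all only: if_True if_False simp_thms mult_zero_right times_divide_eq_right)
      qed
      thus ?thesis using that p by simp
    qed
    have "(\<lambda>N. ?s N ?n - v ?n) \<longlonglongrightarrow> 0"
    proof (rule Lim_null_comparison[OF _ lim])
      show "\<forall>\<^sub>F N in sequentially. norm (?s N ?n - v ?n) \<le> ell2_norm (\<lambda>n. ?s N n - v n)"
        using ell2_norm_ge_coord[OF ell2_diff[OF s v]] by (intro always_eventually allI)
    qed
    moreover have "(\<lambda>N. ?s N ?n - v ?n) \<longlonglongrightarrow> ?c - v ?n"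
      by (rule tendsto_eventually, rule eventually_sequentiallyI[of p]) (simp only: val)
    ultimately have "0 = ?c - v ?n" by (rule LIMSEQ_unique)
    hence "?c - v ?n = 0" by (rule sym)
    hence "?c = v ?n" by (rule right_minus_eq[THEN iffD1])
    thus ?thesis by (rule sym)
  qed
  let ?f = "\<lambda>p. axis i (int (Suc p * \<kappa>)) :: int^'d"
  have inj: "inj ?f"
  proof (rule injI)
    fix p q assume "?f p = ?f q"
    hence "int (Suc p * \<kappa>) = int (Suc q * \<kappa>)" by (metis axis_nth)
    hence "Suc p * \<kappa> = Suc q * \<kappa>" by (simp only: of_nat_eq_iff)
    thus "p = q" using \<kappa> by (simp only: mult_cancel2) simp
  qed
  have "(\<lambda>n. (cmod (v n))\<^sup>2) summable_on range ?f"
    by (rule summable_on_subset_banach[of _ UNIV]) (use v in \<open>simp_all add: ell2_def\<close>)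
  hence "(\<lambda>p. (cmod (v (?f p)))\<^sup>2) summable_on UNIV"
    using summable_on_reindex[OF inj, of "\<lambda>n. (cmod (v n))\<^sup>2"] by (simp add: comp_def)
  hence sq: "summable (\<lambda>p. (cmod (v (?f p)))\<^sup>2)" by (rule summable_on_imp_summable)
  have "summable (\<lambda>p. 8 * (cmod (v (?f p)))\<^sup>2 + inverse (real (Suc p) ^ 2))"
  proof (intro summable_add summable_mult sq)
    have "summable (\<lambda>p. inverse (real p ^ 2))" by (rule inverse_power_summable) simp
    thus "summable (\<lambda>p. inverse (real (Suc p) ^ 2))" by (subst summable_Suc_iff)
  qed
  thus ?thesis
  proof (rule summable_comparison_test')
    fix p :: nat assume "p \<ge> 0"
    define r where "r = \<bar>\<rho> (Suc p * \<kappa>)\<bar>"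
    define t where "t = real (Suc p)"
    define c where "c = cmod (v (?f p))"
    have t: "t > 0" and r: "r \<ge> 0" by (simp_all add: t_def r_def)
    have "c = r * real (Suc p * \<kappa>) / 4"
      unfolding c_def r_def coord[OF zero_less_Suc] norm_mult norm_divide norm_of_real norm_of_nat by simp
    hence "r * t * real \<kappa> = 4 * c" by (simp only: of_nat_mult t_def[symmetric])
    moreover have "r * t * 1 \<le> r * t * real \<kappa>" using \<kappa> r t by (intro mult_left_mono) auto
    ultimately have "r * t \<le> 4 * c" by simp
    hence "(r * t)\<^sup>2 \<le> (4 * c)\<^sup>2" using r t by (intro power_mono) auto
    hence c: "(r * t)\<^sup>2 \<le> 16 * c\<^sup>2" by (simp add: power_mult_distrib)
    have "2 * (r * t) * inverse t \<le> (r * t)\<^sup>2 + (inverse t)\<^sup>2" by (rule sum_squares_bound)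
    moreover have "2 * (r * t) * inverse t = 2 * r" using t by simp
    moreover have "0 \<le> (inverse t)\<^sup>2" by simp
    ultimately have "r \<le> 8 * c\<^sup>2 + (inverse t)\<^sup>2" using c by linarith
    thus "norm \<bar>\<rho> (Suc p * \<kappa>)\<bar> \<le> 8 * (cmod (v (?f p)))\<^sup>2 + inverse (real (Suc p) ^ 2)"
      unfolding r_def c_def t_def power_inverse real_norm_def abs_idempotent .
  qed
qed

section \<open>Positivity of the symbol at regular energies\<close>

definition commutator_symbol :: "nat \<Rightarrow> (nat \<Rightarrow> real) \<Rightarrow> real ^ 2 \<Rightarrow> real" where
  "commutator_symbol \<kappa> \<rho> x = (\<Sum>p. \<rho> (Suc p * \<kappa>) * g_fun (Suc p * \<kappa>) x)"

lemma commutator_symbol_abs_summable: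
  fixes x :: "real ^ 2"
  assumes "\<kappa> > 0" "summable (\<lambda>p. \<bar>\<rho> (Suc p * \<kappa>)\<bar>)" "x \<in> S_set E"
  shows "summable (\<lambda>p. \<bar>\<rho> (Suc p * \<kappa>) * g_fun (Suc p * \<kappa>) x\<bar>)"
proof (rule summable_comparison_test'[OF summable_mult2[OF assms(2), of 2]])
  fix p :: nat assume "p \<ge> 0"
  have "\<bar>g_fun (Suc p * \<kappa>) x\<bar> \<le> 2" by (rule g_fun_le_2[OF _ assms(3)]) (use assms(1) in simp)
  hence "\<bar>\<rho> (Suc p * \<kappa>)\<bar> * \<bar>g_fun (Suc p * \<kappa>) x\<bar> \<le> \<bar>\<rho> (Suc p * \<kappa>)\<bar> * 2"
    by (rule mult_left_mono) simp
  thus "norm \<bar>\<rho> (Suc p * \<kappa>) * g_fun (Suc p * \<kappa>) x\<bar> \<le> \<bar>\<rho> (Suc p * \<kappa>)\<bar> * 2"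
    by (simp only: real_norm_def abs_idempotent abs_mult)
qed

text \<open>
  The abstract commutator is only given on vectors; on compactly supported ones both terms of
  \<open>D (\<i> v) - \<i> w\<close> are norm limits of partial sums, because \<open>D\<close> is bounded and preserves compact
  supports.
\<close>
lemma commutator_ext_limit:
  fixes C :: "(int ^ 2 \<Rightarrow> complex) \<Rightarrow> (int ^ 2 \<Rightarrow> complex)"
  assumes ext: "commutator_ext MV_laplacian (conj_comb \<kappa> \<rho>) C"
    and dom: "compact_supp \<subseteq> Domain (conj_comb_core \<kappa> \<rho> :: ((int ^ 2 \<Rightarrow> complex) \<times> _) set)"
    and u: "u \<in> compact_supp"
  shows "(\<lambda>N. ell2_norm (\<lambda>n. (\<Sum>p<N. of_real (\<rho> (Suc p * \<kappa>)) * commutator_op (Suc p * \<kappa>) u n) - C u n)) \<longlonglongrightarrow> 0"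
proof -
  let ?D = "MV_laplacian :: (int ^ 2 \<Rightarrow> complex) \<Rightarrow> _"
  let ?s = "\<lambda>u N n. \<Sum>p=1..N. of_real (\<rho> (p * \<kappa>)) * conj_op (p * \<kappa>) u n"
  have core_closure: "(u, v) \<in> conj_comb \<kappa> \<rho>" if "(u, v) \<in> conj_comb_core \<kappa> \<rho>"
    for u v :: "int ^ 2 \<Rightarrow> complex"
  proof -
    have "u \<in> ell2" "v \<in> ell2" using that compact_supp_ell2 by (auto simp: conj_comb_core_def)
    moreover have "\<exists>a b. (\<forall>k::nat. (a k, b k) \<in> conj_comb_core \<kappa> \<rho>) \<and>
           (\<lambda>k. ell2_norm (\<lambda>n. a k n - u n)) \<longlonglongrightarrow> 0 \<and>
           (\<lambda>k. ell2_norm (\<lambda>n. b k n - v n)) \<longlonglongrightarrow> 0"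
      using that by (intro exI[of _ "\<lambda>_. u"] exI[of _ "\<lambda>_. v"]) simp
    ultimately show ?thesis by (simp add: conj_comb_def op_closure_def)
  qed
  have Du: "?D u \<in> compact_supp" using u by (rule compact_supp_MV_laplacian)
  obtain v where v: "(u, v) \<in> conj_comb_core \<kappa> \<rho>" using dom u by blast
  obtain w where w: "(?D u, w) \<in> conj_comb_core \<kappa> \<rho>" using dom Du by blast
  have v2: "v \<in> ell2" and vlim: "(\<lambda>N. ell2_norm (\<lambda>n. ?s u N n - v n)) \<longlonglongrightarrow> 0"
    using v by (auto simp: conj_comb_core_def)
  have w2: "w \<in> ell2" and wlim: "(\<lambda>N. ell2_norm (\<lambda>n. ?s (?D u) N n - w n)) \<longlonglongrightarrow> 0"
    using w by (auto simp: conj_comb_core_def)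
  have C: "C u = (\<lambda>n. ?D (\<lambda>m. \<i> * v m) n - \<i> * w n)"
    using ext u core_closure[OF v] core_closure[OF w] unfolding commutator_ext_def by blast
  have s2: "?s u N \<in> ell2" if "u \<in> compact_supp" for N u
    by (rule subsetD[OF compact_supp_ell2]) (intro compact_supp_sum compact_supp_conj_op that finite_atLeastAtMost)
  have D: "packet_symbol (0 :: real ^ 2) ?D 1 (of_real (cos ((0 :: real ^ 2) $ 1) * cos ((0 :: real ^ 2) $ 2)))"
    by (rule packet_symbol_MV_laplacian)
  note Db = packet_symbolD(2)[OF D] and Dn = packet_symbolD(3)[OF D]
  have key: "ell2_norm (\<lambda>n. (\<Sum>p<N. of_real (\<rho> (Suc p * \<kappa>)) * commutator_op (Suc p * \<kappa>) u n) - C u n)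
      \<le> ell2_norm (\<lambda>n. ?s u N n - v n) + ell2_norm (\<lambda>n. ?s (?D u) N n - w n)" for N
  proof -
    have lin: "?D (\<lambda>m. \<i> * ?s u N m) n = (\<Sum>p=1..N. of_real (\<rho> (p * \<kappa>)) * ?D (\<lambda>m. \<i> * conj_op (p * \<kappa>) u m) n)" for n
    proof (induction N arbitrary: n)
      case 0
      have "?D (\<lambda>m. 0) = (\<lambda>n. 0)" using bounded_op_scale[OF Db ell2_zero, of 0] by simp
      thus ?case by simp
    next
      case (Suc N)
      let ?c = "of_real (\<rho> (Suc N * \<kappa>)) :: complex" and ?q = "\<lambda>m. \<i> * conj_op (Suc N * \<kappa>) u m"
      have q: "?q \<in> ell2"
        using compact_supp_conj_op[OF u] compact_supp_ell2 by (intro ell2_scale) blast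
      have "(\<lambda>m. \<i> * ?s u (Suc N) m) = (\<lambda>m. \<i> * ?s u N m + ?c * ?q m)"
        by (simp add: algebra_simps del: mult_Suc)
      hence "?D (\<lambda>m. \<i> * ?s u (Suc N) m) n = ?D (\<lambda>m. \<i> * ?s u N m) n + ?c * ?D ?q n"
        using bounded_op_add[OF Db ell2_scale[OF s2[OF u]] ell2_scale[OF q]]
          bounded_op_scale[OF Db q] by (simp only:)
      thus ?case using Suc by (simp del: mult_Suc)
    qed
    have "(\<Sum>p<N. of_real (\<rho> (Suc p * \<kappa>)) * commutator_op (Suc p * \<kappa>) u n)
        = (\<Sum>p=1..N. of_real (\<rho> (p * \<kappa>)) * commutator_op (p * \<kappa>) u n)" for n
      by (rule sum.reindex_bij_witness[of _ "\<lambda>p. p - 1" Suc]) auto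
    also have "(\<Sum>p=1..N. of_real (\<rho> (p * \<kappa>)) * commutator_op (p * \<kappa>) u n)
        = ?D (\<lambda>m. \<i> * ?s u N m) n - \<i> * ?s (?D u) N n" for n
    proof -
      have "\<i> * ?s (?D u) N n = (\<Sum>p=1..N. of_real (\<rho> (p * \<kappa>)) * (\<i> * conj_op (p * \<kappa>) (?D u) n))"
        unfolding sum_distrib_left by (rule sum.cong[OF refl]) (rule mult.left_commute)
      thus ?thesis
        by (simp only: lin MV_laplacian_conj_op_commutator flip: sum_subtractf right_diff_distrib)
    qed
    finally have S: "(\<Sum>p<N. of_real (\<rho> (Suc p * \<kappa>)) * commutator_op (Suc p * \<kappa>) u n)
        = ?D (\<lambda>m. \<i> * ?s u N m) n - \<i> * ?s (?D u) N n" for n .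
    have a: "(\<lambda>n. ?s u N n - v n) \<in> ell2" and b: "(\<lambda>n. ?s (?D u) N n - w n) \<in> ell2"
      by (intro ell2_diff s2 u Du v2 w2)+
    have Dd: "?D (\<lambda>m. \<i> * (?s u N m - v m)) n = ?D (\<lambda>m. \<i> * ?s u N m) n - ?D (\<lambda>m. \<i> * v m) n" for n
      using bounded_op_diff[OF Db ell2_scale[OF s2[OF u], of \<i> N] ell2_scale[OF v2, of \<i>]]
      by (simp only: right_diff_distrib)
    have "(\<lambda>n. (\<Sum>p<N. of_real (\<rho> (Suc p * \<kappa>)) * commutator_op (Suc p * \<kappa>) u n) - C u n)
        = (\<lambda>n. ?D (\<lambda>m. \<i> * (?s u N m - v m)) n + (- \<i>) * (?s (?D u) N n - w n))"
      unfolding S C Dd by (simp add: algebra_simps)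
    hence "ell2_norm (\<lambda>n. (\<Sum>p<N. of_real (\<rho> (Suc p * \<kappa>)) * commutator_op (Suc p * \<kappa>) u n) - C u n)
        = ell2_norm (\<lambda>n. ?D (\<lambda>m. \<i> * (?s u N m - v m)) n + (- \<i>) * (?s (?D u) N n - w n))"
      by (rule arg_cong)
    also have "\<dots> \<le> ell2_norm (?D (\<lambda>m. \<i> * (?s u N m - v m)))
        + ell2_norm (\<lambda>n. (- \<i>) * (?s (?D u) N n - w n))"
      by (rule ell2_norm_triangle[OF bounded_op_ell2[OF Db ell2_scale[OF a]] ell2_scale[OF b]])
    also have "ell2_norm (?D (\<lambda>m. \<i> * (?s u N m - v m))) \<le> 1 * ell2_norm (\<lambda>m. \<i> * (?s u N m - v m))"
      by (rule Dn[OF ell2_scale[OF a]])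
    finally show ?thesis by (simp only: ell2_norm_scale norm_minus_cancel norm_ii mult_1)
  qed
  show ?thesis
    by (rule tendsto_sandwich[OF _ _ tendsto_const tendsto_add_zero[OF vlim wlim]])
       (use key in \<open>auto intro!: always_eventually\<close>)
qed

text \<open>
  For each \<open>p\<close> the error of the \<open>p\<close>-th commutator on the packets tends to 0, possibly not uniformly
  in \<open>p\<close>; it is bounded by 4.  As the coefficients are summable, Tannery's theorem applies to the series
  of errors.
\<close>
lemma commutator_ext_packet:
  fixes C :: "(int ^ 2 \<Rightarrow> complex) \<Rightarrow> (int ^ 2 \<Rightarrow> complex)" and \<theta> :: "real ^ 2"
  assumes ext: "commutator_ext MV_laplacian (conj_comb \<kappa> \<rho>) C"
    and dom: "compact_supp \<subseteq> Domain (conj_comb_core \<kappa> \<rho> :: ((int ^ 2 \<Rightarrow> complex) \<times> _) set)"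
    and \<kappa>: "\<kappa> > 0" and x: "x = (\<chi> i. cos (\<theta> $ i))" "x \<in> S_set E"
  shows "(\<lambda>L. ell2_norm (\<lambda>n. C (packet \<theta> (Suc L)) n
            - of_real (commutator_symbol \<kappa> \<rho> x) * packet \<theta> (Suc L) n)) \<longlonglongrightarrow> 0"
proof -
  let ?p = "\<lambda>L. packet \<theta> (Suc L)"
  let ?r = "\<lambda>p. \<rho> (Suc p * \<kappa>)" and ?B = "\<lambda>p. commutator_op (Suc p * \<kappa>)" and ?g = "\<lambda>p. g_fun (Suc p * \<kappa>) x"
  let ?G = "commutator_symbol \<kappa> \<rho> x"
  define e where "e = (\<lambda>p L. ell2_norm (\<lambda>n. ?B p (?p L) n - of_real (?g p) * ?p L n))"
  have \<rho>: "summable (\<lambda>p. \<bar>?r p\<bar>)" using \<kappa> dom by (rule coefficients_summable)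
  have B: "packet_symbol \<theta> (?B p) 2 (of_real (?g p))" for p
  proof -
    have "Suc p * \<kappa> > 0" using \<kappa> by simp
    from packet_symbol_commutator_op[of \<theta> "Suc p * \<kappa>"] show ?thesis
      unfolding x(1) g_fun_trig[OF \<open>Suc p * \<kappa> > 0\<close>] .
  qed
  have g2: "\<bar>?g p\<bar> \<le> 2" for p by (rule g_fun_le_2[OF _ x(2)]) (use \<kappa> in simp)
  have p: "?p L \<in> ell2" "ell2_norm (?p L) = 1" "?p L \<in> compact_supp" for L
    by (auto intro!: packet_ell2 packet_norm packet_compact_supp)
  have Bp: "?B p (?p L) \<in> ell2" for p L by (rule bounded_op_ell2[OF packet_symbolD(2)[OF B] p(1)])
  have d: "(\<lambda>n. ?B p (?p L) n - of_real (?g p) * ?p L n) \<in> ell2" for p L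
    by (intro ell2_diff ell2_scale Bp p(1))
  have e0: "e p L \<ge> 0" for p L by (simp add: e_def)
  have e4: "e p L \<le> 4" for p L
  proof -
    have "e p L = ell2_norm (\<lambda>n. ?B p (?p L) n + of_real (- ?g p) * ?p L n)" by (simp add: e_def)
    also have "\<dots> \<le> ell2_norm (?B p (?p L)) + ell2_norm (\<lambda>n. of_real (- ?g p) * ?p L n)"
      by (rule ell2_norm_triangle[OF Bp ell2_scale[OF p(1)]])
    also have "\<dots> \<le> 2 * 1 + \<bar>?g p\<bar> * 1"
      using packet_symbolD(3)[OF B p(1), of p L] p(2)[of L]
      unfolding ell2_norm_scale norm_of_real abs_minus_cancel by simp
    finally show ?thesis using g2[of p] by linarith
  qed
  have bound: "\<bar>?r p\<bar> * e p L \<le> 4 * \<bar>?r p\<bar>" for p L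
    using mult_left_mono[OF e4[of p L], of "\<bar>?r p\<bar>"] by simp
  have "(\<lambda>L. \<Sum>p. \<bar>?r p\<bar> * e p L) \<longlonglongrightarrow> (\<Sum>p. \<bar>?r p\<bar> * 0)"
  proof (rule tannerys_theorem[THEN conjunct2, THEN conjunct2])
    show "(\<lambda>L. \<bar>?r p\<bar> * e p L) \<longlonglongrightarrow> \<bar>?r p\<bar> * 0" for p
      unfolding e_def by (intro tendsto_mult tendsto_const packet_symbolD(4)[OF B])
    show "summable (\<lambda>p. 4 * \<bar>?r p\<bar>)" by (rule summable_mult[OF \<rho>])
    show "\<forall>\<^sub>F (p, L) in sequentially \<times>\<^sub>F sequentially. norm (\<bar>?r p\<bar> * e p L) \<le> 4 * \<bar>?r p\<bar>"
    proof (rule always_eventually, clarify)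
      fix p L
      show "norm (\<bar>?r p\<bar> * e p L) \<le> 4 * \<bar>?r p\<bar>"
        using bound[of p L] e0[of p L] by (simp only: real_norm_def abs_mult abs_idempotent abs_of_nonneg)
    qed
  qed simp
  hence lim: "(\<lambda>L. \<Sum>p. \<bar>?r p\<bar> * e p L) \<longlonglongrightarrow> 0" by simp
  have le: "ell2_norm (\<lambda>n. C (?p L) n - of_real ?G * ?p L n) \<le> (\<Sum>p. \<bar>?r p\<bar> * e p L)" for L
  proof -
    let ?S = "\<lambda>N n. \<Sum>p<N. of_real (?r p) * ?B p (?p L) n"
    let ?GN = "\<lambda>N. \<Sum>p<N. ?r p * ?g p"
    have Cb: "bounded_op C" using ext by (simp add: commutator_ext_def)
    have Cp: "C (?p L) \<in> ell2" by (rule bounded_op_ell2[OF Cb p(1)])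
    have S: "?S N \<in> ell2" for N by (intro ell2_sum ell2_scale Bp finite_lessThan)
    have sm: "summable (\<lambda>p. \<bar>?r p\<bar> * e p L)"
    proof (rule summable_comparison_test'[OF summable_mult[OF \<rho>, of 4]])
      fix q :: nat assume "q \<ge> 0"
      show "norm (\<bar>?r q\<bar> * e q L) \<le> 4 * \<bar>?r q\<bar>"
        using bound[of q L] e0[of q L] by (simp only: real_norm_def abs_mult abs_idempotent abs_of_nonneg)
    qed
    have GN: "?GN \<longlonglongrightarrow> ?G"
      unfolding commutator_symbol_def
      by (rule summable_LIMSEQ, rule summable_rabs_cancel, rule commutator_symbol_abs_summable[OF \<kappa> \<rho> x(2)])
    \<comment> \<open>Compare C with its partial sum, the partial sum with its eigenvalue, and that with G.\<close>
    have step: "ell2_norm (\<lambda>n. C (?p L) n - of_real ?G * ?p L n)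
        \<le> ell2_norm (\<lambda>n. ?S N n - C (?p L) n) + (\<Sum>p. \<bar>?r p\<bar> * e p L) + \<bar>?GN N - ?G\<bar>" for N
    proof -
      have d1: "(\<lambda>n. C (?p L) n - of_real ?G * ?p L n) \<in> ell2" by (intro ell2_diff ell2_scale Cp p(1))
      have SG: "(\<lambda>n. ?S N n - of_real (?GN N) * ?p L n)
          = (\<lambda>n. \<Sum>p<N. of_real (?r p) * (?B p (?p L) n - of_real (?g p) * ?p L n))"
        by (simp only: right_diff_distrib sum_subtractf of_real_sum of_real_mult sum_distrib_right mult.assoc)
      have "ell2_norm (\<lambda>n. ?S N n - of_real (?GN N) * ?p L n)
          \<le> (\<Sum>p<N. ell2_norm (\<lambda>n. of_real (?r p) * (?B p (?p L) n - of_real (?g p) * ?p L n)))"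
        unfolding SG by (intro ell2_norm_sum_le ell2_scale d finite_lessThan)
      also have "\<dots> = (\<Sum>p<N. \<bar>?r p\<bar> * e p L)"
        unfolding ell2_norm_scale norm_of_real e_def ..
      also have "\<dots> \<le> (\<Sum>p. \<bar>?r p\<bar> * e p L)"
        by (rule sum_le_suminf[OF sm]) (auto simp: e0)
      finally have b: "ell2_norm (\<lambda>n. ?S N n - of_real (?GN N) * ?p L n) \<le> (\<Sum>p. \<bar>?r p\<bar> * e p L)" .
      have "ell2_norm (\<lambda>n. C (?p L) n - of_real ?G * ?p L n)
          \<le> ell2_norm (\<lambda>n. C (?p L) n - ?S N n) + ell2_norm (\<lambda>n. ?S N n - of_real ?G * ?p L n)"
        by (rule ell2_norm_diff_triangle[OF Cp S ell2_scale[OF p(1)]])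
      also have "ell2_norm (\<lambda>n. C (?p L) n - ?S N n) = ell2_norm (\<lambda>n. ?S N n - C (?p L) n)"
        by (rule ell2_norm_minus_commute)
      also have "ell2_norm (\<lambda>n. ?S N n - of_real ?G * ?p L n)
          \<le> ell2_norm (\<lambda>n. ?S N n - of_real (?GN N) * ?p L n)
            + ell2_norm (\<lambda>n. of_real (?GN N) * ?p L n - of_real ?G * ?p L n)"
        by (rule ell2_norm_diff_triangle[OF S ell2_scale[OF p(1)] ell2_scale[OF p(1)]])
      also have "ell2_norm (\<lambda>n. of_real (?GN N) * ?p L n - of_real ?G * ?p L n) = \<bar>?GN N - ?G\<bar>"
        unfolding left_diff_distrib[symmetric] of_real_diff[symmetric] ell2_norm_scale norm_of_real
          p(2) mult_1_right ..
      finally show ?thesis using b by linarith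
    qed
    have "(\<lambda>N. ell2_norm (\<lambda>n. ?S N n - C (?p L) n) + (\<Sum>p. \<bar>?r p\<bar> * e p L) + \<bar>?GN N - ?G\<bar>)
        \<longlonglongrightarrow> 0 + (\<Sum>p. \<bar>?r p\<bar> * e p L) + \<bar>?G - ?G\<bar>"
      by (intro tendsto_add tendsto_const tendsto_rabs tendsto_diff GN commutator_ext_limit[OF ext dom p(3)])
    hence "(\<lambda>N. ell2_norm (\<lambda>n. ?S N n - C (?p L) n) + (\<Sum>p. \<bar>?r p\<bar> * e p L) + \<bar>?GN N - ?G\<bar>)
        \<longlonglongrightarrow> (\<Sum>p. \<bar>?r p\<bar> * e p L)" by simp
    thus ?thesis by (rule LIMSEQ_le_const) (use step in blast)
  qed
  show ?thesis
    by (rule tendsto_sandwich[OF _ _ tendsto_const lim]) (use le in \<open>auto intro!: always_eventually\<close>)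
qed

text \<open>
  Insert packets at a point of \<open>S\<^sub>E\<close> into the estimate.  The spectral projection moves them by
  a quantity that tends to 0, and in the limit the two sides are \<open>\<gamma>\<close> and the value of the symbol.
\<close>
lemma mourre_estimate_symbol_ge:
  assumes M: "mourre_estimate (MV_laplacian :: (int ^ 2 \<Rightarrow> complex) \<Rightarrow> _) (conj_comb \<kappa> \<rho>) E"
    and dom: "compact_supp \<subseteq> Domain (conj_comb_core \<kappa> \<rho> :: ((int ^ 2 \<Rightarrow> complex) \<times> _) set)"
    and \<kappa>: "\<kappa> > 0"
  obtains \<gamma> where "\<gamma> > 0" "\<And>x. x \<in> S_set E \<Longrightarrow> \<gamma> \<le> commutator_symbol \<kappa> \<rho> x"
proof -
  let ?D = "MV_laplacian :: (int ^ 2 \<Rightarrow> complex) \<Rightarrow> _"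
  obtain C P J \<gamma> where ext: "commutator_ext ?D (conj_comb \<kappa> \<rho>) C" and P: "spectral_measure_of ?D P"
    and J: "open J" "E \<in> J" and \<gamma>: "\<gamma> > 0"
    and le: "op_le (\<lambda>u n. of_real \<gamma> * P J u n) (\<lambda>u. P J (C (P J u)))"
    using M unfolding mourre_estimate_def by blast
  have Db: "bounded_op ?D" by (rule packet_symbolD(2)[OF packet_symbol_MV_laplacian])
  have Cb: "bounded_op C" using ext by (simp add: commutator_ext_def)
  interpret spectral_resolution ?D P using Db P by unfold_locales
  obtain K where K: "K \<ge> 0" "\<And>u. u \<in> ell2 \<Longrightarrow> ell2_norm (C u) \<le> K * ell2_norm u"
    using bounded_op_bound[OF Cb] by blast
  obtain M where M: "\<And>u. u \<in> ell2 \<Longrightarrow> ell2_norm (\<lambda>n. P J u n - u n) \<le> M * ell2_norm (\<lambda>n. ?D u n - of_real E * u n)"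
    using spectral_localization[OF J] by blast
  have Jm: "J \<in> sets borel" using J by simp
  show ?thesis
  proof (rule that[OF \<gamma>])
    fix x :: "real ^ 2" assume x: "x \<in> S_set E"
    obtain \<theta> :: "real ^ 2" where \<theta>: "x = (\<chi> i. cos (\<theta> $ i))" "cos (\<theta> $ 1) * cos (\<theta> $ 2) = E"
      using S_set_angles[OF x] .
    define G where "G = commutator_symbol \<kappa> \<rho> x"
    let ?p = "\<lambda>L. packet \<theta> (Suc L)"
    have p: "?p L \<in> ell2" "ell2_norm (?p L) = 1" for L by (auto intro!: packet_ell2 packet_norm)
    define a where "a = (\<lambda>L. ell2_norm (\<lambda>n. P J (?p L) n - ?p L n))"
    define b where "b = (\<lambda>L. ell2_norm (\<lambda>n. C (?p L) n - of_real G * ?p L n))"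
    have D: "packet_symbol \<theta> ?D 1 (of_real E)" using packet_symbol_MV_laplacian[of \<theta>] \<theta>(2) by simp
    have a0: "a \<longlonglongrightarrow> 0"
    proof (rule tendsto_sandwich[OF _ _ tendsto_const])
      show "(\<lambda>L. M * ell2_norm (\<lambda>n. ?D (?p L) n - of_real E * ?p L n)) \<longlonglongrightarrow> 0"
        using tendsto_mult_left[OF packet_symbolD(4)[OF D], of M] by simp
    qed (use M[OF p(1)] in \<open>auto simp: a_def intro!: always_eventually\<close>)
    have b0: "b \<longlonglongrightarrow> 0"
      unfolding b_def G_def by (rule commutator_ext_packet[OF ext dom \<kappa> \<theta>(1) x])
    have est: "(\<gamma> - G) * (ell2_norm (P J (?p L)))\<^sup>2 \<le> ell2_norm (P J (?p L)) * (b L + (K + \<bar>G\<bar>) * a L)" for L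
    proof -
      let ?w = "P J (?p L)"
      have w: "?w \<in> ell2" by (rule proj_ell2[OF Jm p(1)])
      have Cw: "C ?w \<in> ell2" and Cp: "C (?p L) \<in> ell2"
        by (rule bounded_op_ell2[OF Cb w], rule bounded_op_ell2[OF Cb p(1)])
      have Gw: "(\<lambda>n. of_real G * ?w n) \<in> ell2" and Gp: "(\<lambda>n. of_real G * ?p L n) \<in> ell2"
        by (rule ell2_scale[OF w], rule ell2_scale[OF p(1)])
      have "0 \<le> Re (ell2_inner (?p L) (\<lambda>n. P J (C ?w) n - of_real \<gamma> * ?w n))"
        using le p(1) unfolding op_le_def by blast
      also have "ell2_inner (?p L) (\<lambda>n. P J (C ?w) n - of_real \<gamma> * ?w n)
          = ell2_inner (?p L) (P J (C ?w)) - of_real \<gamma> * ell2_inner (?p L) ?w"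
        unfolding ell2_inner_diff_right[OF p(1) proj_ell2[OF Jm Cw] ell2_scale[OF w]]
          ell2_inner_scale_right ..
      also have "\<dots> = ell2_inner ?w (C ?w) - of_real (\<gamma> * (ell2_norm ?w)\<^sup>2)"
        unfolding inner_proj[OF Jm p(1)] proj_symmetric[OF Jm p(1) Cw, symmetric] of_real_mult ..
      also have "ell2_inner ?w (C ?w)
          = ell2_inner ?w (\<lambda>n. C ?w n - of_real G * ?w n) + of_real (G * (ell2_norm ?w)\<^sup>2)"
        unfolding ell2_inner_diff_right[OF w Cw Gw] ell2_inner_scale_right ell2_inner_self[OF w]
        by simp
      finally have "(\<gamma> - G) * (ell2_norm ?w)\<^sup>2 \<le> Re (ell2_inner ?w (\<lambda>n. C ?w n - of_real G * ?w n))"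
        unfolding minus_complex.sel plus_complex.sel Re_complex_of_real left_diff_distrib by linarith
      also have "\<dots> \<le> ell2_norm ?w * ell2_norm (\<lambda>n. C ?w n - of_real G * ?w n)"
        by (rule order_trans[OF complex_Re_le_cmod ell2_Cauchy_Schwarz[OF w ell2_diff[OF Cw Gw]]])
      also have "\<dots> \<le> ell2_norm ?w * (b L + (K + \<bar>G\<bar>) * a L)"
      proof (rule mult_left_mono)
        have "ell2_norm (\<lambda>n. C ?w n - of_real G * ?w n)
            \<le> ell2_norm (\<lambda>n. C ?w n - C (?p L) n) + ell2_norm (\<lambda>n. C (?p L) n - of_real G * ?w n)"
          by (rule ell2_norm_diff_triangle[OF Cw Cp Gw])
        also have "ell2_norm (\<lambda>n. C (?p L) n - of_real G * ?w n)
            \<le> b L + ell2_norm (\<lambda>n. of_real G * ?p L n - of_real G * ?w n)"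
          unfolding b_def by (rule ell2_norm_diff_triangle[OF Cp Gp Gw])
        also have "ell2_norm (\<lambda>n. of_real G * ?p L n - of_real G * ?w n) = \<bar>G\<bar> * a L"
          unfolding a_def ell2_norm_minus_commute[of "?w"] right_diff_distrib[symmetric] ell2_norm_scale
            norm_of_real ..
        also have "ell2_norm (\<lambda>n. C ?w n - C (?p L) n) \<le> K * a L"
          unfolding a_def bounded_op_diff[OF Cb w p(1), symmetric]
          by (rule K(2)[OF ell2_diff[OF w p(1)]])
        finally show "ell2_norm (\<lambda>n. C ?w n - of_real G * ?w n) \<le> b L + (K + \<bar>G\<bar>) * a L"
          unfolding distrib_right by linarith
      qed simp
      finally show ?thesis .
    qed
    have n1: "(\<lambda>L. ell2_norm (P J (?p L))) \<longlonglongrightarrow> 1"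
    proof -
      have "\<bar>ell2_norm (P J (?p L)) - 1\<bar> \<le> a L" for L
        using ell2_norm_le_add_diff[OF proj_ell2[OF Jm p(1)] p(1), of L L] 
          ell2_norm_le_add_diff[OF p(1) proj_ell2[OF Jm p(1)], of L L] 
          ell2_norm_minus_commute[of "?p L" "P J (?p L)"] p(2)[of L]
        unfolding a_def by linarith
      hence "(\<lambda>L. ell2_norm (P J (?p L)) - 1) \<longlonglongrightarrow> 0"
        by (intro Lim_null_comparison[OF _ a0] always_eventually) simp
      thus ?thesis by (rule LIM_zero_cancel)
    qed
    have "(\<lambda>L. (\<gamma> - G) * (ell2_norm (P J (?p L)))\<^sup>2) \<longlonglongrightarrow> (\<gamma> - G) * 1\<^sup>2"
      by (intro tendsto_intros n1)
    moreover have "(\<lambda>L. ell2_norm (P J (?p L)) * (b L + (K + \<bar>G\<bar>) * a L)) \<longlonglongrightarrow> 1 * (0 + (K + \<bar>G\<bar>) * 0)"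
      by (intro tendsto_intros n1 a0 b0)
    ultimately have "(\<gamma> - G) * 1\<^sup>2 \<le> 1 * (0 + (K + \<bar>G\<bar>) * 0)"
      using est by (intro LIMSEQ_le) auto
    thus "\<gamma> \<le> commutator_symbol \<kappa> \<rho> x" by (simp add: G_def)
  qed
qed

text \<open>
  A positive function cannot take at one point a value that is a nonpositive combination of its other values.
\<close>
theorem Theta_m_set_subset_Theta_set:
  assumes \<kappa>: "\<kappa> > 0"
  shows "Theta_m_set TYPE(2) m \<kappa> \<subseteq> Theta_set TYPE(2) \<kappa>"
proof
  fix E assume "E \<in> Theta_m_set TYPE(2) m \<kappa>"
  then obtain x :: "nat \<Rightarrow> real ^ 2" and \<omega> where x: "\<And>q. q \<le> m \<Longrightarrow> x q \<in> S_set E"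
    and \<omega>: "\<And>q. q < m \<Longrightarrow> \<omega> q \<le> 0"
    and g: "\<And>p. p \<ge> 1 \<Longrightarrow> g_fun (p * \<kappa>) (x m) = (\<Sum>q<m. \<omega> q * g_fun (p * \<kappa>) (x q))"
    unfolding Theta_m_set_def by blast
  have "E \<notin> mu_set TYPE(2) \<kappa>"
  proof
    assume "E \<in> mu_set TYPE(2) \<kappa>"
    then obtain \<rho> where
      dom: "compact_supp \<subseteq> Domain (conj_comb_core \<kappa> \<rho> :: ((int ^ 2 \<Rightarrow> complex) \<times> _) set)"
      and M: "mourre_estimate (MV_laplacian :: (int ^ 2 \<Rightarrow> complex) \<Rightarrow> _) (conj_comb \<kappa> \<rho>) E"
      unfolding mu_set_def by blast
    obtain \<gamma> where \<gamma>: "\<gamma> > 0" "\<And>x. x \<in> S_set E \<Longrightarrow> \<gamma> \<le> commutator_symbol \<kappa> \<rho> x"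
      using mourre_estimate_symbol_ge[OF M dom \<kappa>] by blast
    have \<rho>: "summable (\<lambda>p. \<bar>\<rho> (Suc p * \<kappa>)\<bar>)" using \<kappa> dom by (rule coefficients_summable)
    have sm: "summable (\<lambda>p. \<rho> (Suc p * \<kappa>) * g_fun (Suc p * \<kappa>) (x q))" if "q \<le> m" for q
      using commutator_symbol_abs_summable[OF \<kappa> \<rho> x[OF that]] by (rule summable_rabs_cancel)
    have "commutator_symbol \<kappa> \<rho> (x m)
        = (\<Sum>p. \<Sum>q<m. \<omega> q * (\<rho> (Suc p * \<kappa>) * g_fun (Suc p * \<kappa>) (x q)))"
      unfolding commutator_symbol_def
    proof (rule suminf_cong)
      fix p
      have "1 \<le> Suc p" by simp
      show "\<rho> (Suc p * \<kappa>) * g_fun (Suc p * \<kappa>) (x m)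
          = (\<Sum>q<m. \<omega> q * (\<rho> (Suc p * \<kappa>) * g_fun (Suc p * \<kappa>) (x q)))"
        unfolding g[OF \<open>1 \<le> Suc p\<close>] sum_distrib_left
        by (rule sum.cong[OF refl]) (rule mult.left_commute)
    qed
    also have "\<dots> = (\<Sum>q<m. \<Sum>p. \<omega> q * (\<rho> (Suc p * \<kappa>) * g_fun (Suc p * \<kappa>) (x q)))"
      by (rule suminf_sum) (use sm in \<open>auto intro!: summable_mult simp del: mult_Suc\<close>)
    also have "\<dots> = (\<Sum>q<m. \<omega> q * commutator_symbol \<kappa> \<rho> (x q))"
      unfolding commutator_symbol_def by (intro sum.cong refl suminf_mult sm) auto
    also have "\<dots> \<le> 0"
    proof (rule sum_nonpos)
      fix q assume "q \<in> {..<m}"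
      hence "\<omega> q \<le> 0" "0 \<le> commutator_symbol \<kappa> \<rho> (x q)" using \<omega>[of q] \<gamma>(1) \<gamma>(2)[OF x[of q]] by auto
      thus "\<omega> q * commutator_symbol \<kappa> \<rho> (x q) \<le> 0" by (rule mult_nonpos_nonneg)
    qed
    finally show False using \<gamma>(1) \<gamma>(2)[OF x[of m]] by simp
  qed
  moreover have "E \<in> sigma_D TYPE(2)" using S_set_subset_spectrum[OF x[of m]] by simp
  ultimately show "E \<in> Theta_set TYPE(2) \<kappa>" by (simp add: Theta_set_def)
qed

section \<open>Chains generated by a reflection\<close>

text \<open>
  A decreasing map \<open>\<sigma>\<close> from \<open>{c..d}\<close> onto \<open>{\<sigma> d..c}\<close>, thought of as one half of an involution about
  \<open>c\<close>.  The last assumption implies that \<open>x \<mapsto> F / \<sigma> x\<close> has no fixed point in \<open>{c..d}\<close> when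
  \<open>F < d * \<sigma> d\<close>.
\<close>
locale reflection =
  fixes \<sigma> :: "real \<Rightarrow> real" and c d :: real
  assumes c_pos: "0 < c" and c_less_d: "c < d"
    and cont: "continuous_on {c..d} \<sigma>"
    and anti: "\<And>x y. c \<le> x \<Longrightarrow> x < y \<Longrightarrow> y \<le> d \<Longrightarrow> \<sigma> y < \<sigma> x"
    and fixpoint: "\<sigma> c = c" and end_pos: "0 < \<sigma> d"
    and product: "\<And>x. c \<le> x \<Longrightarrow> x < d \<Longrightarrow> d * \<sigma> d < x * \<sigma> x"
begin

lemma anti_weak: "c \<le> x \<Longrightarrow> x \<le> y \<Longrightarrow> y \<le> d \<Longrightarrow> \<sigma> y \<le> \<sigma> x"
  using anti[of x y] by (cases "x = y") auto

lemma pos: "c \<le> x \<Longrightarrow> x \<le> d \<Longrightarrow> 0 < \<sigma> x"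
  using anti_weak[of x d] end_pos by simp

lemma product_weak: "c \<le> x \<Longrightarrow> x \<le> d \<Longrightarrow> d * \<sigma> d \<le> x * \<sigma> x"
  using product[of x] by (cases "x = d") auto

text \<open>
  The orbit of \<open>x \<mapsto> F / \<sigma> x\<close> from \<open>d\<close>.  Truncation at \<open>c\<close> makes it defined, continuous and
  monotone in \<open>F\<close> even after it has left \<open>{c..d}\<close>; there the next value is the constant \<open>F / c\<close>.
  As \<open>F / c < c\<close> for \<open>F < d * \<sigma> d\<close>, an orbit that has dropped to \<open>c\<close> or below stays strictly below \<open>c\<close> from then on.
\<close>
fun iter :: "real \<Rightarrow> nat \<Rightarrow> real" where
  "iter F 0 = d"
| "iter F (Suc k) = F / \<sigma> (max c (iter F k))"

lemmas iter_Suc = iter.simps(2)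
declare iter.simps(2) [simp del]

lemma top_less: "d * \<sigma> d < c * c"
  using product[of c] c_less_d fixpoint by simp

lemma iter_bounds:
  assumes "0 \<le> F" "F \<le> d * \<sigma> d"
  shows "0 \<le> iter F k" "iter F k \<le> d"
proof -
  have "0 \<le> iter F k \<and> iter F k \<le> d"
  proof (induction k)
    case (Suc k)
    define y where "y = max c (iter F k)"
    have y: "c \<le> y" "y \<le> d" using Suc c_less_d by (auto simp: y_def)
    have "F \<le> y * \<sigma> y" using product_weak[OF y] assms by simp
    hence "F / \<sigma> y \<le> y" using pos[OF y] by (simp add: pos_divide_le_eq)
    hence "F / \<sigma> y \<le> d" using y by linarith
    moreover have "0 \<le> F / \<sigma> y" using pos[OF y] assms by simp
    ultimately show ?case by (simp add: y_def iter_Suc)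
  qed (use c_pos c_less_d in simp)
  thus "0 \<le> iter F k" "iter F k \<le> d" by auto
qed

lemma iter_mono:
  assumes "0 \<le> F" "F < F'" "F' \<le> d * \<sigma> d"
  shows "iter F (Suc k) < iter F' (Suc k)"
proof -
  have "iter F k \<le> iter F' k \<Longrightarrow> iter F (Suc k) < iter F' (Suc k)" for k
  proof -
    assume le: "iter F k \<le> iter F' k"
    define y where "y = max c (iter F k)"
    define z where "z = max c (iter F' k)"
    have yz: "c \<le> y" "y \<le> z" "z \<le> d"
      using le iter_bounds(2)[of F' k] assms c_less_d by (auto simp: y_def z_def)
    have s: "0 < \<sigma> z" "\<sigma> z \<le> \<sigma> y" using yz pos[of z] anti_weak[of y z] by auto
    have "F / \<sigma> y \<le> F / \<sigma> z" using s assms by (intro divide_left_mono) auto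
    also have "\<dots> < F' / \<sigma> z" using s assms by (intro divide_strict_right_mono) auto
    finally show "iter F (Suc k) < iter F' (Suc k)" by (simp add: y_def z_def iter_Suc)
  qed
  note step = this
  have "iter F k \<le> iter F' k"
    by (induction k) (use step in \<open>auto intro: less_imp_le\<close>)
  thus ?thesis by (rule step)
qed

lemma iter_top: "iter (d * \<sigma> d) k = d"
  by (induction k) (use c_less_d end_pos in \<open>auto simp: max_def iter_Suc\<close>)

lemma iter_cont: "continuous_on {0..d * \<sigma> d} (\<lambda>F. iter F k)"
proof (induction k)
  case (Suc k)
  have sub: "(\<lambda>F. max c (iter F k)) ` {0..d * \<sigma> d} \<subseteq> {c..d}"
    using iter_bounds(2) c_less_d by auto
  have "continuous_on {0..d * \<sigma> d} (\<lambda>F. max c (iter F k))"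
    by (intro continuous_on_max continuous_on_const Suc)
  hence "continuous_on {0..d * \<sigma> d} (\<lambda>F. \<sigma> (max c (iter F k)))"
    using continuous_on_compose2[OF cont _ sub] by blast
  moreover have "\<sigma> (max c (iter F k)) \<noteq> 0" if "F \<in> {0..d * \<sigma> d}" for F
    using sub that pos[of "max c (iter F k)"] by fastforce
  ultimately show ?case by (auto simp: iter_Suc intro!: continuous_on_divide continuous_on_id)
qed simp

lemma iter_decreasing:
  assumes "0 \<le> F" "F < d * \<sigma> d" "c \<le> iter F k"
  shows "iter F (Suc k) < iter F k"
proof -
  have y: "c \<le> iter F k" "iter F k \<le> d" using assms iter_bounds(2)[of F k] by auto
  have "F < iter F k * \<sigma> (iter F k)" using product_weak[OF y] assms by linarith
  thus ?thesis using pos[OF y] y by (simp add: pos_divide_less_eq max_def iter_Suc)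
qed

lemma iter_below:
  assumes "iter F k \<le> c"
  shows "iter F (Suc k) = F / c"
  using assms fixpoint by (simp add: max_def iter_Suc)

lemma div_c_less: "F < d * \<sigma> d \<Longrightarrow> F / c < c"
  using top_less c_pos by (simp add: pos_divide_less_eq)

lemma iter_above:
  assumes "0 \<le> F" "F < d * \<sigma> d" "c \<le> iter F k" "l < k"
  shows "c < iter F l"
  using assms(3,4)
proof (induction k)
  case (Suc k)
  have k: "c < iter F k"
  proof (rule ccontr)
    assume "\<not> c < iter F k"
    hence "iter F (Suc k) = F / c" by (intro iter_below) simp
    thus False using div_c_less[OF assms(2)] Suc.prems(1) by linarith
  qed
  show ?case using k Suc by (cases "l = k") auto
qed simp

text \<open>
  At \<open>F = 0\<close> the orbit is 0 after one step and at \<open>F = d * \<sigma> d\<close> it stays at \<open>d\<close>; the intermediate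
  value theorem applies in between.
\<close>
lemma ex_energy: "\<exists>F. 0 < F \<and> F < d * \<sigma> d \<and> iter F (Suc k) = c"
proof -
  have dpos: "0 < d * \<sigma> d" using c_pos c_less_d end_pos by simp
  have "\<exists>F\<ge>0. F \<le> d * \<sigma> d \<and> iter F (Suc k) = c"
    by (rule IVT'[of "\<lambda>F. iter F (Suc k)"])
       (use dpos c_pos c_less_d iter_top[of "Suc k"] iter_cont[of "Suc k"] in \<open>simp_all add: iter_Suc[of 0]\<close>)
  then obtain F where F: "0 \<le> F" "F \<le> d * \<sigma> d" "iter F (Suc k) = c" by blast
  have "F \<noteq> 0" using F(3) c_pos by (auto simp: iter_Suc)
  moreover have "F \<noteq> d * \<sigma> d" using F(3) iter_top[of "Suc k"] c_less_d by auto
  ultimately show ?thesis using F by (intro exI[of _ F]) linarith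
qed

definition energy :: "nat \<Rightarrow> real" where
  "energy k = (SOME F. 0 < F \<and> F < d * \<sigma> d \<and> iter F (Suc k) = c)"

lemma energy: "0 < energy k" "energy k < d * \<sigma> d" "iter (energy k) (Suc k) = c"
  using someI_ex[OF ex_energy[of k]] by (auto simp: energy_def)

lemma energy_0: "energy 0 = c * \<sigma> d"
  using energy(3)[of 0] end_pos c_less_d by (simp add: max_def field_simps iter_Suc)

lemma energy_next: "iter (energy k) (Suc (Suc k)) = energy k / c"
  using energy(3)[of k] by (intro iter_below) simp

text \<open>
  At \<open>energy k\<close> the orbit has just left \<open>{c..d}\<close> after \<open>Suc (Suc k)\<close> steps, whereas at
  \<open>energy (Suc k)\<close> it is still at \<open>c\<close>; the orbit increases with the energy.
\<close>
lemma energy_less: "energy k < energy (Suc k)"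
proof (rule ccontr)
  assume "\<not> energy k < energy (Suc k)"
  hence "energy (Suc k) = energy k \<or> energy (Suc k) < energy k" by auto
  hence "iter (energy (Suc k)) (Suc (Suc k)) \<le> iter (energy k) (Suc (Suc k))"
    using iter_mono[of "energy (Suc k)" "energy k" "Suc k"] energy(1)[of "Suc k"] energy(2)[of k] by auto
  thus False using energy(3)[of "Suc k"] energy_next[of k] div_c_less[OF energy(2)[of k]] by simp
qed

text \<open>
  Since \<open>\<surd>F < c\<close>, the orbit passes from \<open>F / c < \<surd>F\<close> at the left end to \<open>c > \<surd>F\<close> at the right end.
\<close>
lemma ex_sqrt_energy:
  "\<exists>F. energy k < F \<and> F < energy (Suc k) \<and> iter F (Suc (Suc k)) = sqrt F"
proof -
  let ?f = "\<lambda>F. iter F (Suc (Suc k)) - sqrt F"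
  have sq: "sqrt F < c" if "F < d * \<sigma> d" for F
    using that top_less c_pos real_less_lsqrt[of c F] by (simp add: power2_eq_square)
  have "energy k / c < sqrt (energy k)"
  proof -
    have "energy k = sqrt (energy k) * sqrt (energy k)" using energy(1)[of k] by simp
    also have "\<dots> < sqrt (energy k) * c"
      using sq[OF energy(2)] energy(1)[of k] by (intro mult_strict_left_mono) auto
    finally show ?thesis using c_pos by (simp add: pos_divide_less_eq)
  qed
  hence lo: "?f (energy k) < 0" using energy_next[of k] by simp
  have hi: "?f (energy (Suc k)) > 0" using energy(3)[of "Suc k"] sq[OF energy(2)] by simp
  have "\<exists>F\<ge>energy k. F \<le> energy (Suc k) \<and> ?f F = 0"
  proof (rule IVT')
    show "continuous_on {energy k..energy (Suc k)} ?f"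
      using energy(1)[of k] energy(2)[of "Suc k"]
      by (intro continuous_on_diff continuous_on_subset[OF iter_cont] continuous_intros) auto
  qed (use lo hi energy_less[of k] in \<open>auto\<close>)
  then obtain F where F: "energy k \<le> F" "F \<le> energy (Suc k)" "?f F = 0" by blast
  have "F \<noteq> energy k" "F \<noteq> energy (Suc k)" using F(3) lo hi by auto
  hence "energy k < F \<and> F < energy (Suc k) \<and> iter F (Suc (Suc k)) = sqrt F" using F by simp
  thus ?thesis by blast
qed

text \<open>
  Even indices close up the chain at the fixed point \<open>c\<close>, odd indices at a member
  that is its own partner in the products, \<open>X\<^sup>2 = F\<close>.  Index 0 marks the lower end \<open>c * \<sigma> d\<close> of
  the energy interval.
\<close>
definition chain_energy :: "nat \<Rightarrow> real" where
  "chain_energy n = (if even n then energy (n div 2)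
     else SOME F. energy (n div 2) < F \<and> F < energy (Suc (n div 2)) \<and> iter F (Suc (Suc (n div 2))) = sqrt F)"

lemma chain_energy_odd:
  assumes "odd n"
  shows "energy (n div 2) < chain_energy n" "chain_energy n < energy (Suc (n div 2))"
    "iter (chain_energy n) (Suc (Suc (n div 2))) = sqrt (chain_energy n)"
  using someI_ex[OF ex_sqrt_energy[of "n div 2"]] assms by (auto simp: chain_energy_def)

lemma chain_energy_less: "chain_energy n < chain_energy (Suc n)"
proof (cases "even n")
  case True
  hence "odd (Suc n)" "Suc n div 2 = n div 2" by auto
  thus ?thesis using chain_energy_odd(1)[of "Suc n"] True by (simp add: chain_energy_def)
next
  case False
  hence "even (Suc n)" "Suc n div 2 = Suc (n div 2)" by auto
  thus ?thesis using chain_energy_odd(2)[of n] False by (simp add: chain_energy_def)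
qed

lemma chain_energy_bounds: "0 < chain_energy n" "chain_energy n < d * \<sigma> d"
proof -
  show "0 < chain_energy n"
    using energy(1)[of "n div 2"] chain_energy_odd(1)[of n]
    by (cases "even n") (auto simp: chain_energy_def)
  show "chain_energy n < d * \<sigma> d"
    using energy(2)[of "n div 2"] energy(2)[of "Suc (n div 2)"] chain_energy_odd(2)[of n]
    by (cases "even n") (auto simp: chain_energy_def)
qed

lemma chain_energy_gt: "n \<ge> 1 \<Longrightarrow> c * \<sigma> d < chain_energy n"
proof -
  assume "n \<ge> 1"
  have "strict_mono chain_energy" by (rule strict_mono_Suc_iff[THEN iffD2]) (rule allI, rule chain_energy_less)
  hence "chain_energy 0 < chain_energy n" by (rule strict_monoD) (use \<open>n \<ge> 1\<close> in simp)
  thus ?thesis by (simp add: chain_energy_def energy_0)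
qed

lemma iter_chain_above:
  assumes "l \<le> (n + 1) div 2"
  shows "c < iter (chain_energy n) l"
proof (cases "even n")
  case True
  hence "iter (chain_energy n) (Suc (n div 2)) = c" using energy(3) by (simp add: chain_energy_def)
  thus ?thesis using assms True chain_energy_bounds[of n]
    by (intro iter_above[of _ "Suc (n div 2)"]) (auto)
next
  case False
  define m where "m = n div 2"
  have "iter (energy m) (Suc m) < iter (chain_energy n) (Suc m)"
    using False energy(1)[of m] chain_energy_odd(1)[of n] chain_energy_bounds(2)[of n]
    by (intro iter_mono) (auto simp: m_def)
  hence m: "c < iter (chain_energy n) (Suc m)" using energy(3) by simp
  have "l \<le> Suc m" using assms False by (simp add: m_def)
  thus ?thesis
    using m iter_above[of "chain_energy n" "Suc m" l] chain_energy_bounds[of n]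
    by (cases "l = Suc m") (auto)
qed

lemma iter_chain_Suc:
  assumes "l \<le> (n + 1) div 2"
  shows "iter (chain_energy n) (Suc l) = chain_energy n / \<sigma> (iter (chain_energy n) l)"
  using iter_chain_above[OF assms] by (simp add: max_def iter_Suc)

text \<open>
  First half: the orbit without its starting point.  Second half: the mirror image of the orbit, run
  backwards; its last member, at \<open>n + 1\<close>, is the image of the starting point \<open>d\<close>.
\<close>
definition chain :: "nat \<Rightarrow> nat \<Rightarrow> real" where
  "chain n q = (if 2 * q \<le> n then iter (chain_energy n) (Suc q)
     else \<sigma> (iter (chain_energy n) (n + 1 - q)))"

lemma iter_chain_mem:
  assumes "2 * q \<le> n + 2"
  shows "0 < iter (chain_energy n) q" and "iter (chain_energy n) q \<le> d"
    and "2 * q \<le> n + 1 \<or> even n \<Longrightarrow> c \<le> iter (chain_energy n) q"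
proof -
  show le: "iter (chain_energy n) q \<le> d" using chain_energy_bounds[of n] by (intro iter_bounds) auto
  show "2 * q \<le> n + 1 \<or> even n \<Longrightarrow> c \<le> iter (chain_energy n) q"
  proof (cases "q \<le> (n + 1) div 2")
    case True
    thus ?thesis using iter_chain_above[of q n] by simp
  next
    assume "2 * q \<le> n + 1 \<or> even n"
    case False
    hence "even n" "q = Suc (n div 2)" using \<open>2 * q \<le> n + 1 \<or> even n\<close> assms by linarith+
    thus ?thesis using energy(3)[of "n div 2"] by (simp add: chain_energy_def)
  qed
  hence "2 * q \<le> n + 1 \<Longrightarrow> 0 < iter (chain_energy n) q" using c_pos by fastforce
  moreover have "0 < iter (chain_energy n) q" if q: "2 * q = n + 2"
  proof -
    have "even n" "q = Suc (n div 2)" using q by presburger+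
    thus ?thesis using energy(3)[of "n div 2"] c_pos by (simp add: chain_energy_def)
  qed
  ultimately show "0 < iter (chain_energy n) q" using assms by linarith
qed

lemma chain_last: "chain n (n + 1) = \<sigma> d"
  by (simp add: chain_def)

lemma chain_first_less: "chain n 0 < d"
proof -
  have "iter (chain_energy n) (Suc 0) < iter (chain_energy n) 0"
    using chain_energy_bounds[of n] c_less_d by (intro iter_decreasing) auto
  thus ?thesis by (simp add: chain_def)
qed

text \<open>
  By construction, except for \<open>q = n - q\<close>, where it is the closing condition \<open>X\<^sub>q = c = \<sigma> c\<close>.
\<close>
lemma chain_reflect:
  assumes "2 * q \<le> n"
  shows "chain n (n - q) = \<sigma> (chain n q)"
proof (cases "2 * q = n")
  case True
  hence "even n" "n div 2 = q" by auto
  hence "iter (chain_energy n) (Suc q) = c" using energy(3)[of q] by (simp add: chain_energy_def)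
  thus ?thesis using True fixpoint by (auto simp: chain_def)
next
  case False
  have "\<not> 2 * (n - q) \<le> n" "n + 1 - (n - q) = Suc q" using False assms by auto
  thus ?thesis using assms by (simp add: chain_def)
qed

lemma chain_in_upper_half:
  assumes "2 * q \<le> n"
  shows "c \<le> chain n q" "chain n q < d"
proof -
  have "2 * Suc q \<le> n + 1 \<or> even n" using assms by presburger
  thus "c \<le> chain n q" using assms iter_chain_mem(3)[of "Suc q" n] by (simp add: chain_def)
  have "q \<le> (n + 1) div 2" using assms by simp
  hence "iter (chain_energy n) (Suc q) < iter (chain_energy n) q"
    using chain_energy_bounds[of n] iter_chain_above[of q n] by (intro iter_decreasing) auto
  also have "\<dots> \<le> d" using iter_chain_mem(2)[of q n] assms by simp
  finally show "chain n q < d" using assms by (simp add: chain_def)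
qed

text \<open>
  One step of the orbit, except for \<open>r = n + 1 - r\<close>, where it is the closing condition \<open>X\<^sub>r = \<surd>F\<close>.
\<close>
lemma chain_product:
  assumes "2 * r \<le> n + 1"
  shows "chain n r * chain n (n + 1 - r) = chain_energy n"
proof (cases "2 * r \<le> n")
  case True
  have r: "r \<le> (n + 1) div 2" "\<not> 2 * (n + 1 - r) \<le> n" using True by auto
  have "0 < \<sigma> (iter (chain_energy n) r)"
    using iter_chain_mem[of r n] True by (intro pos) auto
  thus ?thesis using True r iter_chain_Suc[OF r(1)] by (simp add: chain_def)
next
  case False
  hence n: "2 * r = n + 1" "odd n" "n + 1 - r = r" "Suc (n div 2) = r" "r \<le> (n + 1) div 2"
    using assms by presburger+
  have s: "0 < \<sigma> (iter (chain_energy n) r)" using iter_chain_mem[of r n] n by (intro pos) auto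
  have "chain_energy n / \<sigma> (iter (chain_energy n) r) = sqrt (chain_energy n)"
    using chain_energy_odd(3)[OF n(2)] iter_chain_Suc[OF n(5)] n(4) by simp
  hence "chain_energy n = sqrt (chain_energy n) * \<sigma> (iter (chain_energy n) r)"
    using s by (simp add: field_simps)
  moreover have "chain_energy n = sqrt (chain_energy n) * sqrt (chain_energy n)" "0 < sqrt (chain_energy n)"
    using chain_energy_bounds(1)[of n] by auto
  ultimately have "\<sigma> (iter (chain_energy n) r) = sqrt (chain_energy n)"
    by (metis mult_cancel_left less_irrefl)
  thus ?thesis using n(1,3) chain_energy_bounds(1)[of n] by (simp add: chain_def)
qed

lemma chain_decreasing:
  assumes "q \<le> n"
  shows "chain n (q + 1) < chain n q"
proof -
  let ?Z = "iter (chain_energy n)"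
  have dec: "?Z (Suc k) < ?Z k" if "k \<le> (n + 1) div 2" for k
    using chain_energy_bounds[of n] iter_chain_above[OF that] by (intro iter_decreasing) auto
  consider "2 * (q + 1) \<le> n" | "2 * q \<le> n" "n < 2 * (q + 1)" | "n < 2 * q" by linarith
  thus ?thesis
  proof cases
    case 1
    thus ?thesis using dec[of "Suc q"] by (simp add: chain_def)
  next
    case 2
    have r: "2 * (n - q) \<le> n + 1" "n - q \<le> (n + 1) div 2" using 2 by auto
    have Zm: "c < ?Z (n - q)" "?Z (n - q) \<le> d"
      using iter_chain_above[OF r(2)] iter_chain_mem(2)[of "n - q" n] r by auto
    have e: "2 * Suc q \<le> n + 2" "2 * Suc q \<le> n + 1 \<or> even n" using 2 by presburger+
    have "\<sigma> (?Z (n - q)) < \<sigma> c" using Zm by (intro anti) auto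
    also have "\<dots> = c" by (rule fixpoint)
    also have "c \<le> ?Z (Suc q)" by (rule iter_chain_mem(3)[OF e])
    finally show ?thesis using 2 by (simp add: chain_def)
  next
    case 3
    have r: "n - q \<le> (n + 1) div 2" "Suc (n - q) \<le> (n + 1) div 2" using 3 assms by auto
    have "\<sigma> (?Z (n - q)) < \<sigma> (?Z (Suc (n - q)))"
      using dec[OF r(1)] iter_chain_above[OF r(2)] iter_chain_mem(2)[of "n - q" n] 3
      by (intro anti) auto
    moreover have "n + 1 - q = Suc (n - q)" using assms by simp
    ultimately show ?thesis using 3 by (simp add: chain_def)
  qed
qed

end

section \<open>Chains of cosines and the threshold sequence\<close>

context reflection
begin

lemma chain_bounds:
  assumes "q \<le> n + 1"
  shows "0 < chain n q" "chain n q < d"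
proof -
  show "0 < chain n q"
  proof (cases "2 * q \<le> n")
    case True
    thus ?thesis using chain_in_upper_half(1)[of q n] c_pos by simp
  next
    case False
    hence q: "2 * (n + 1 - q) \<le> n + 1" "2 * (n + 1 - q) \<le> n + 2" by simp_all
    have "c \<le> iter (chain_energy n) (n + 1 - q)" "iter (chain_energy n) (n + 1 - q) \<le> d"
      by (rule iter_chain_mem(3)[OF q(2) disjI1[OF q(1)]], rule iter_chain_mem(2)[OF q(2)])
    thus ?thesis using False pos by (simp add: chain_def)
  qed
  show "chain n q < d"
    using assms
  proof (induction q)
    case (Suc q)
    thus ?case using chain_decreasing[of q n] by simp
  qed (use chain_first_less in simp)
qed

lemma chain_product_all:
  assumes "q \<le> n + 1"
  shows "chain n q * chain n (n + 1 - q) = chain_energy n"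
proof (cases "2 * q \<le> n + 1")
  case True
  thus ?thesis by (rule chain_product)
next
  case False
  hence "2 * (n + 1 - q) \<le> n + 1" "n + 1 - (n + 1 - q) = q" using assms by auto
  thus ?thesis using chain_product[of "n + 1 - q" n] by (simp add: mult.commute)
qed

end

text \<open>
  In terms of the angle \<open>t = arccos x\<close> the map is \<open>t \<mapsto> 2\<gamma> - t\<close>, and
  \<open>2 x \<sigma> x = cos (2\<gamma> - 2t) + cos 2\<gamma>\<close> decreases as \<open>t\<close> moves down from \<open>\<gamma>\<close> to \<open>\<alpha>\<close>.
\<close>
lemma reflection_cos:
  assumes \<alpha>: "0 \<le> \<alpha>" "\<alpha> < \<gamma>" and \<beta>: "2 * \<gamma> - \<alpha> < pi / 2"
  shows "reflection (\<lambda>x. cos (2 * \<gamma> - arccos x)) (cos \<gamma>) (cos \<alpha>)"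
proof
  have pi: "\<gamma> \<le> pi / 2" using \<alpha> \<beta> by linarith
  have range: "\<alpha> \<le> arccos x" "arccos x \<le> \<gamma>" "-1 \<le> x" "x \<le> 1" if "cos \<gamma> \<le> x" "x \<le> cos \<alpha>" for x
  proof -
    show x: "-1 \<le> x" "x \<le> 1" using that cos_ge_minus_one[of \<gamma>] cos_le_one[of \<alpha>] by linarith+
    have "arccos (cos \<alpha>) \<le> arccos x" using that x cos_le_one[of \<alpha>] by (intro arccos_le_arccos) auto
    thus "\<alpha> \<le> arccos x" using \<alpha> pi by (simp add: arccos_cos)
    have "arccos x \<le> arccos (cos \<gamma>)" using that x cos_ge_minus_one[of \<gamma>] by (intro arccos_le_arccos) auto
    thus "arccos x \<le> \<gamma>" using \<alpha> pi by (simp add: arccos_cos)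
  qed
  show "0 < cos \<gamma>" using \<alpha> \<beta> by (intro cos_gt_zero_pi) auto
  show "cos \<gamma> < cos \<alpha>" using \<alpha> pi by (intro cos_monotone_0_pi) auto
  show "continuous_on {cos \<gamma>..cos \<alpha>} (\<lambda>x. cos (2 * \<gamma> - arccos x))"
    by (intro continuous_on_cos continuous_on_diff continuous_on_const continuous_on_arccos
        continuous_on_id) (use range in auto)
  show "cos (2 * \<gamma> - arccos y) < cos (2 * \<gamma> - arccos x)"
    if "cos \<gamma> \<le> x" "x < y" "y \<le> cos \<alpha>" for x y
  proof (rule cos_monotone_0_pi)
    show "2 * \<gamma> - arccos x < 2 * \<gamma> - arccos y"
      using range[of x] range[of y] that arccos_less_arccos[of x y] by auto
    show "0 \<le> 2 * \<gamma> - arccos x" using range[of x] that \<alpha> by auto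
    have "\<alpha> \<le> arccos y" using range(1)[of y] that by simp
    thus "2 * \<gamma> - arccos y \<le> pi" using \<beta> pi_ge_zero by linarith
  qed
  show "cos (2 * \<gamma> - arccos (cos \<gamma>)) = cos \<gamma>" using \<alpha> pi by (simp add: arccos_cos)
  have \<beta>eq: "2 * \<gamma> - arccos (cos \<alpha>) = 2 * \<gamma> - \<alpha>" using \<alpha> pi by (simp add: arccos_cos)
  show "0 < cos (2 * \<gamma> - arccos (cos \<alpha>))" unfolding \<beta>eq using \<alpha> \<beta> by (intro cos_gt_zero_pi) auto
  show "cos \<alpha> * cos (2 * \<gamma> - arccos (cos \<alpha>)) < x * cos (2 * \<gamma> - arccos x)"
    if "cos \<gamma> \<le> x" "x < cos \<alpha>" for x
  proof -
    define t where "t = arccos x"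
    have t: "t \<le> \<gamma>" "x = cos t" using range[of x] that by (auto simp: t_def)
    have "\<alpha> < t"
      using range[of x] that arccos_less_arccos[of x "cos \<alpha>"] \<alpha> pi by (auto simp: t_def arccos_cos)
    have prod: "cos s * cos (2 * \<gamma> - s) = (cos (2 * \<gamma> - 2 * s) + cos (2 * \<gamma>)) / 2" for s
    proof -
      have "cos s * cos (2 * \<gamma> - s) = (cos (s - (2 * \<gamma> - s)) + cos (s + (2 * \<gamma> - s))) / 2"
        by (rule cos_times_cos)
      also have "cos (s - (2 * \<gamma> - s)) = cos (2 * \<gamma> - 2 * s)"
        using cos_minus[of "s - (2 * \<gamma> - s)"] by (simp add: algebra_simps)
      finally show ?thesis by simp
    qed
    have "cos (2 * \<gamma> - 2 * \<alpha>) < cos (2 * \<gamma> - 2 * t)"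
      using t \<open>\<alpha> < t\<close> \<alpha> \<beta> pi by (intro cos_monotone_0_pi) auto
    hence "cos \<alpha> * cos (2 * \<gamma> - \<alpha>) < cos t * cos (2 * \<gamma> - t)"
      unfolding prod by simp
    hence "cos \<alpha> * cos (2 * \<gamma> - \<alpha>) < x * cos (2 * \<gamma> - t)" by (simp only: t(2))
    thus ?thesis unfolding \<beta>eq t_def .
  qed
qed

text \<open>
  Solve \<open>g\<^sub>q = \<alpha>\<^sub>q h\<^sub>q - \<beta>\<^sub>q h\<^sub>q\<^sub>-\<^sub>1\<close> for \<open>h\<^sub>q\<close>: both coefficients that arise are nonnegative.  The weights come before \<open>p\<close>
  in the quantifier order because the coefficients do not depend on \<open>p\<close>.
\<close>
lemma telescoping_combination:
  fixes g h :: "nat \<Rightarrow> 'a \<Rightarrow> real"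
  assumes "\<And>p. p \<in> P \<Longrightarrow> g 0 p = \<alpha> 0 * h 0 p"
    and "\<And>q p. q < m \<Longrightarrow> p \<in> P \<Longrightarrow> g (Suc q) p = \<alpha> (Suc q) * h (Suc q) p - \<beta> (Suc q) * h q p"
    and "\<And>q. q \<le> m \<Longrightarrow> 0 < \<alpha> q" and "\<And>q. q \<le> m \<Longrightarrow> 0 \<le> \<beta> q"
  shows "\<exists>w. (\<forall>r. 0 \<le> w r) \<and> (\<forall>p\<in>P. h m p = (\<Sum>r\<le>m. w r * g r p))"
  using assms
proof (induction m)
  case 0
  have "h 0 p = inverse (\<alpha> 0) * g 0 p" if "p \<in> P" for p
    using 0(1)[OF that] 0(3)[of 0] by simp
  moreover have "0 \<le> inverse (\<alpha> 0)" using 0(3)[of 0] by simp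
  ultimately show ?case by (intro exI[of _ "\<lambda>_. inverse (\<alpha> 0)"]) auto
next
  case (Suc m)
  obtain w where w: "\<And>r. 0 \<le> w r" "\<And>p. p \<in> P \<Longrightarrow> h m p = (\<Sum>r\<le>m. w r * g r p)"
  proof -
    have "\<exists>w. (\<forall>r. 0 \<le> w r) \<and> (\<forall>p\<in>P. h m p = (\<Sum>r\<le>m. w r * g r p))"
      by (rule Suc.IH[OF Suc.prems(1) Suc.prems(2)[OF less_SucI] Suc.prems(3)[OF le_SucI]
            Suc.prems(4)[OF le_SucI]])
    thus ?thesis using that by blast
  qed
  let ?a = "\<alpha> (Suc m)" and ?b = "\<beta> (Suc m)"
  have a: "0 < ?a" and b: "0 \<le> ?b" using Suc.prems(3,4)[of "Suc m"] by auto
  let ?w = "\<lambda>r. if r = Suc m then inverse ?a else ?b / ?a * w r"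
  have comb: "h (Suc m) p = (\<Sum>r\<le>Suc m. ?w r * g r p)" if p: "p \<in> P" for p
  proof -
    have "h (Suc m) p = (g (Suc m) p + ?b * h m p) / ?a"
      using Suc.prems(2)[of m p] p a by (simp add: field_simps)
    also have "\<dots> = inverse ?a * g (Suc m) p + ?b / ?a * (\<Sum>r\<le>m. w r * g r p)"
      using a w(2)[OF p] by (simp add: field_simps)
    also have "?b / ?a * (\<Sum>r\<le>m. w r * g r p) = (\<Sum>r\<le>m. ?w r * g r p)"
      unfolding sum_distrib_left by (intro sum.cong) auto
    finally show ?thesis by simp
  qed
  have "\<forall>r. 0 \<le> ?w r" using a b w(1) by auto
  thus ?case by (intro exI[of _ ?w] conjI ballI comb)
qed

text \<open>
  The points are \<open>(X\<^sub>q, X\<^sub>n\<^sub>+\<^sub>1\<^sub>-\<^sub>q)\<close>, \<open>q \<le> (n + 1) div 2\<close>.  The reflection turns the second sine of \<open>g\<close> at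
  the point \<open>q\<close> into minus the first sine at the point \<open>q - 1\<close>, which gives the telescoping form.
\<close>
lemma chain_angles_in_Theta_m_set:
  fixes \<theta> :: "nat \<Rightarrow> real"
  assumes \<kappa>: "\<kappa> > 0" and n: "n \<ge> 1"
    and angle: "\<And>q. q \<le> n + 1 \<Longrightarrow> 0 < \<theta> q \<and> \<theta> q < pi / 2"
    and product: "\<And>q. q \<le> n + 1 \<Longrightarrow> cos (\<theta> q) * cos (\<theta> (n + 1 - q)) = F"
    and reflect: "\<And>p q. 2 * q \<le> n \<Longrightarrow> sin (real (p * \<kappa>) * \<theta> (n - q)) = - sin (real (p * \<kappa>) * \<theta> q)"
    and last: "\<And>p. sin (real (p * \<kappa>) * \<theta> (n + 1)) = 0"
  shows "F \<in> Theta_m_set TYPE(2) ((n + 1) div 2) \<kappa>"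
proof -
  define m where "m = (n - 1) div 2"
  have m: "(n + 1) div 2 = Suc m" using n by (simp add: m_def)
  define x where "x = (\<lambda>q. (\<chi> i. cos ((\<chi> i. if i = 1 then \<theta> q else \<theta> (n + 1 - q)) $ i)) :: real ^ 2)"
  define h where "h = (\<lambda>q p. sin (real (p * \<kappa>) * \<theta> q))"
  define g where "g = (\<lambda>q p. g_fun (p * \<kappa>) (x q))"
  define \<alpha> where "\<alpha> = (\<lambda>q. sin (\<theta> q) * cos (\<theta> (n + 1 - q)))"
  define \<beta> where "\<beta> = (\<lambda>q. sin (\<theta> (n + 1 - q)) * cos (\<theta> q))"
  have \<alpha>\<beta>: "0 < \<alpha> q" "0 < \<beta> q" if "q \<le> n + 1" for q
    using angle[of q] angle[of "n + 1 - q"] that pi_gt_zero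
    unfolding \<alpha>_def \<beta>_def by (auto intro!: mult_pos_pos sin_gt_zero cos_gt_zero)
  have g: "g q p = \<alpha> q * h q p + \<beta> q * h (n + 1 - q) p" if "p \<ge> 1" for q p
    unfolding g_def x_def h_def \<alpha>_def \<beta>_def using that \<kappa>
    by (subst g_fun_trig) (auto simp: algebra_simps)
  have g0: "g 0 p = \<alpha> 0 * h 0 p" if "p \<in> {1..}" for p
    using g[of p 0] last[of p] that by (simp add: h_def)
  have gSuc: "g (Suc q) p = \<alpha> (Suc q) * h (Suc q) p - \<beta> (Suc q) * h q p"
    if "2 * q \<le> n" "p \<in> {1..}" for q p
    using g[of p "Suc q"] reflect[OF that(1), of p] that by (simp add: h_def)
  obtain w where w: "\<And>r. 0 \<le> w r" "\<And>p. p \<ge> 1 \<Longrightarrow> h m p = (\<Sum>r\<le>m. w r * g r p)"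
  proof -
    have "\<exists>w. (\<forall>r. 0 \<le> w r) \<and> (\<forall>p\<in>{1..}. h m p = (\<Sum>r\<le>m. w r * g r p))"
    proof (rule telescoping_combination[where \<alpha> = \<alpha> and \<beta> = \<beta>])
      fix q p :: nat assume "q < m" "p \<in> {1..}"
      thus "g (Suc q) p = \<alpha> (Suc q) * h (Suc q) p - \<beta> (Suc q) * h q p"
        by (intro gSuc) (auto simp: m_def)
    next
      fix q assume "q \<le> m"
      hence "q \<le> n + 1" by (simp add: m_def)
      thus "0 < \<alpha> q" "0 \<le> \<beta> q" using \<alpha>\<beta>[of q] by auto
    qed (rule g0)
    thus ?thesis using that by auto
  qed
  \<comment> \<open>At the middle point the first sine vanishes (even n) or equals minus the previous one (odd n).\<close>
  define C where "C = (if even n then \<beta> (Suc m) else \<alpha> (Suc m) + \<beta> (Suc m))"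
  have Sm: "Suc m \<le> n + 1" "2 * m \<le> n" using n by (auto simp: m_def)
  have C: "0 < C" using \<alpha>\<beta>[OF Sm(1)] by (simp add: C_def)
  have gm: "g (Suc m) p = - C * h m p" if "p \<ge> 1" for p
  proof (cases "even n")
    case True
    hence "2 * Suc m = n" using n m by presburger
    hence "2 * Suc m \<le> n" "n - Suc m = Suc m" by auto
    hence "h (Suc m) p = 0" using reflect[of "Suc m" p] by (simp add: h_def)
    thus ?thesis using gSuc[OF Sm(2), of p] that True by (simp add: C_def)
  next
    case False
    hence "n - m = Suc m" using n m by presburger
    hence "h (Suc m) p = - h m p" using reflect[OF Sm(2), of p] by (simp add: h_def)
    thus ?thesis using gSuc[OF Sm(2), of p] that False by (simp add: C_def algebra_simps)
  qed
  have "g_fun (p * \<kappa>) (x (Suc m)) = (\<Sum>q<Suc m. - C * w q * g_fun (p * \<kappa>) (x q))" if "p \<ge> 1" for p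
    using gm[OF that] w(2)[OF that]
    by (simp add: g_def lessThan_Suc_atMost sum_distrib_left mult.assoc)
  moreover have "\<forall>q<Suc m. - C * w q \<le> 0" using C w(1) by (simp add: mult_nonneg_nonneg)
  moreover have "\<forall>q\<le>Suc m. x q \<in> S_set F"
  proof (intro allI impI)
    fix q assume "q \<le> Suc m"
    hence "q \<le> n + 1" using Sm by simp
    thus "x q \<in> S_set F" using product[of q] by (simp add: S_set_def x_def UNIV_2)
  qed
  moreover have "-1 \<le> F" "F \<le> 1"
  proof -
    have "\<bar>F\<bar> \<le> 1 * 1" unfolding product[OF le0, symmetric] abs_mult by (intro mult_mono) auto
    thus "-1 \<le> F" "F \<le> 1" by linarith+
  qed
  ultimately show ?thesis
    unfolding m Theta_m_set_def mem_Collect_eq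
    by (intro conjI exI[of _ x] exI[of _ "\<lambda>q. - C * w q"]) auto
qed

lemma sin_full_turns_minus: "sin (real k * (2 * pi) - t) = - sin t"
  using sin_2npi[of k] cos_2npi[of k] by (simp add: sin_diff mult_ac)

lemma cos_full_turns_minus: "cos (real k * (2 * pi) - t) = cos t"
  using sin_2npi[of k] cos_2npi[of k] by (simp add: cos_diff mult_ac)

theorem theorem9p2:
  fixes \<kappa> j :: nat
  assumes "\<kappa> \<ge> 4" and "even \<kappa>"
    and "even j" and "1 \<le> j" and "int j \<le> \<lfloor>real \<kappa> / 2\<rfloor>"
    and interval: "cos (real j * pi / \<kappa>) * cos ((real j + 1) * pi / \<kappa>)
           < cos ((real j - 1) * pi / \<kappa>) * cos ((real j + 1) * pi / \<kappa>)"
  shows "\<exists>F :: nat \<Rightarrow> real.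
     (\<forall>n\<ge>1. F n \<in> {cos (real j * pi / \<kappa>) * cos ((real j + 1) * pi / \<kappa>)
                    <..< cos ((real j - 1) * pi / \<kappa>) * cos ((real j + 1) * pi / \<kappa>)}
                   \<inter> Theta_set TYPE(2) \<kappa>) \<and>
     (\<forall>n\<ge>1. F n < F (n + 1) \<and> F (n + 1) < F (n + 2)) \<and>
     (\<forall>n\<ge>1. F (2 * n - 1) \<in> Theta_m_set TYPE(2) n \<kappa> \<and> F (2 * n) \<in> Theta_m_set TYPE(2) n \<kappa>) \<and>
     (\<forall>n\<ge>1. \<exists>X :: nat \<Rightarrow> real.
        Sigma_system \<kappa> n (F n) X \<and>
        X (n + 1) = cos ((real j + 1) * pi / \<kappa>) \<and>
        (\<forall>q\<le>n. X (q + 1) < X q) \<and>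
        X 0 < cos ((real j - 1) * pi / \<kappa>))"
proof -
  define a where "a = (real j - 1) * pi / \<kappa>"
  define c where "c = real j * pi / \<kappa>"
  define b where "b = (real j + 1) * pi / \<kappa>"
  define \<sigma> where "\<sigma> = (\<lambda>x. cos (2 * c - arccos x))"
  have \<kappa>: "\<kappa> > 0" using assms(1) by simp
  have "j \<le> \<kappa> div 2" using assms(5) by linarith
  hence "2 * (j + 1) < \<kappa>" using energy_interval_nonempty_iff[OF assms(4)] interval by blast
  hence "real (2 * (j + 1)) < real \<kappa>" by (simp only: of_nat_less_iff)
  hence jk: "2 * (real j + 1) < real \<kappa>" by simp
  have b2: "b < pi / 2"
  proof -
    have "(real j + 1) * pi * 2 < real \<kappa> * pi"
      using mult_strict_right_mono[OF jk pi_gt_zero] by (simp add: mult_ac)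
    thus ?thesis using \<kappa> by (simp add: b_def divide_less_eq)
  qed
  have bca: "b = 2 * c - a" by (simp add: a_def b_def c_def add_divide_distrib diff_divide_distrib algebra_simps)
  have a0: "0 \<le> a" using assms(4) by (simp add: a_def)
  have ac: "a < c" using \<kappa> by (simp add: a_def c_def divide_strict_right_mono)
  interpret reflection \<sigma> "cos c" "cos a"
    unfolding \<sigma>_def using a0 ac b2 by (intro reflection_cos) (simp_all add: bca)
  have \<sigma>a: "\<sigma> (cos a) = cos b" using a0 ac b2 by (simp add: \<sigma>_def bca arccos_cos)
  let ?F = chain_energy
  define \<theta> where "\<theta> = (\<lambda>n q. arccos (chain n q))"
  have chain1: "0 < chain n q" "chain n q < 1" if "q \<le> n + 1" for n q
    using chain_bounds[OF that] cos_le_one[of a] by linarith+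
  have cos\<theta>: "cos (\<theta> n q) = chain n q" if "q \<le> n + 1" for n q
    using chain1[OF that] by (simp add: \<theta>_def)
  have \<theta>_range: "0 < \<theta> n q \<and> \<theta> n q < pi / 2" if "q \<le> n + 1" for n q
    using chain1[OF that] arccos_less_arccos[of "chain n q" 1] arccos_less_arccos[of 0 "chain n q"]
    by (simp add: \<theta>_def)
  have \<theta>_reflect: "\<theta> n (n - q) = 2 * c - \<theta> n q" if q: "2 * q \<le> n" for n q
  proof -
    have ch: "cos c \<le> chain n q" "chain n q \<le> cos a" using chain_in_upper_half[OF q] by auto
    have "arccos (cos a) \<le> \<theta> n q" "\<theta> n q \<le> arccos (cos c)"
      using ch chain1[of q n] q cos_ge_minus_one[of c] cos_le_one[of a]
      by (auto simp: \<theta>_def intro!: arccos_le_arccos)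
    hence t: "a \<le> \<theta> n q" "\<theta> n q \<le> c" using a0 ac b2 by (simp_all add: bca arccos_cos)
    have "\<theta> n (n - q) = arccos (cos (2 * c - \<theta> n q))"
      using chain_reflect[OF q] by (simp add: \<theta>_def \<sigma>_def)
    thus ?thesis using t a0 ac b2 by (simp add: arccos_cos bca)
  qed
  have turns: "real (p * \<kappa>) * (2 * c - t) = real (p * j) * (2 * pi) - real (p * \<kappa>) * t" for p t
    using \<kappa> by (simp add: c_def field_simps)
  have Theta_m: "?F n \<in> Theta_m_set TYPE(2) ((n + 1) div 2) \<kappa>" if n: "n \<ge> 1" for n
  proof (rule chain_angles_in_Theta_m_set[OF \<kappa> n, where \<theta> = "\<theta> n"])
    show "0 < \<theta> n q \<and> \<theta> n q < pi / 2" if "q \<le> n + 1" for q using that by (rule \<theta>_range)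
    show "cos (\<theta> n q) * cos (\<theta> n (n + 1 - q)) = ?F n" if "q \<le> n + 1" for q
      using cos\<theta>[of q n] cos\<theta>[of "n + 1 - q" n] chain_product_all[OF that] that by simp
    show "sin (real (p * \<kappa>) * \<theta> n (n - q)) = - sin (real (p * \<kappa>) * \<theta> n q)" if "2 * q \<le> n" for p q
      unfolding \<theta>_reflect[OF that] turns by (rule sin_full_turns_minus)
    have "\<theta> n (n + 1) = arccos (cos b)" unfolding \<theta>_def chain_last \<sigma>a ..
    also have "\<dots> = b" using a0 ac b2 pi_ge_zero by (intro arccos_cos) (auto simp: bca)
    finally have "\<theta> n (n + 1) = b" .
    moreover have "real (p * \<kappa>) * b = real (p * (j + 1)) * pi" for p
      using \<kappa> by (simp add: b_def distrib_left add.commute)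
    ultimately show "sin (real (p * \<kappa>) * \<theta> n (n + 1)) = 0" for p by (simp only: sin_npi)
  qed
  have T: "cheb_T \<kappa> (chain n q) = cheb_T \<kappa> (chain n (n - q))" if q: "2 * q \<le> n" for n q
  proof -
    have "cheb_T \<kappa> (chain n (n - q)) = cos (real (1 * \<kappa>) * (2 * c - \<theta> n q))"
      using cos\<theta>[of "n - q" n] cheb_T_cos[of \<kappa> "\<theta> n (n - q)"] q by (simp add: \<theta>_reflect)
    also have "\<dots> = cos (real \<kappa> * \<theta> n q)" unfolding turns cos_full_turns_minus by simp
    also have "\<dots> = cheb_T \<kappa> (chain n q)"
      using cos\<theta>[of q n] cheb_T_cos[of \<kappa> "\<theta> n q"] q by simp
    finally show ?thesis by simp
  qed
  have R: "chain n r \<noteq> 0 \<and> chain n (n + 1 - r) = ?F n / chain n r" if "r \<le> n + 1" for n r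
    using chain1[OF that] chain_product_all[OF that] by (simp add: field_simps)
  have Sigma: "Sigma_system \<kappa> n (?F n) (chain n)" if "n \<ge> 1" for n
    unfolding Sigma_system_def using that by (auto intro!: T R simp del: One_nat_def)
  show ?thesis
    unfolding a_def[symmetric] b_def[symmetric] c_def[symmetric]
  proof (rule exI[of _ ?F], intro conjI allI impI)
    fix n :: nat assume n: "1 \<le> n"
    show "?F n \<in> {cos c * cos b<..<cos a * cos b} \<inter> Theta_set TYPE(2) \<kappa>"
      using chain_energy_gt[OF n] chain_energy_bounds(2)[of n] \<sigma>a
        Theta_m[OF n] Theta_m_set_subset_Theta_set[OF \<kappa>] by auto
    show "?F n < ?F (n + 1)" "?F (n + 1) < ?F (n + 2)"
      using chain_energy_less[of n] chain_energy_less[of "Suc n"] by simp_all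
    show "?F (2 * n - 1) \<in> Theta_m_set TYPE(2) n \<kappa>"
      using Theta_m[of "2 * n - 1"] n by simp
    show "?F (2 * n) \<in> Theta_m_set TYPE(2) n \<kappa>"
      using Theta_m[of "2 * n"] n by simp
    show "\<exists>X. Sigma_system \<kappa> n (?F n) X \<and> X (n + 1) = cos b \<and> (\<forall>q\<le>n. X (q + 1) < X q) \<and> X 0 < cos a"
      using Sigma[OF n] chain_last[of n] \<sigma>a chain_decreasing[of _ n] chain_first_less[of n]
      by (intro exI[of _ "chain n"]) simp
  qed
qed

end
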